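(* Let $v^k\in H(\mathrm{div},\Omega)$, $\varphi^{k-1},\varphi^k\in H^1(\Omega)$ and $\mu^k\in W^{1,r}(\Omega)$ with some $r>n$ be given, and let $v^{k+1}\in H(\mathrm{div},\Omega)$, $\varphi^{k+1},\mu^{k+1}\in H^1(\Omega)$ be a solution of the time discrete system $$\begin{aligned}&\tfrac1{2\tau}\int_\Omega(\rho^kv^{k+1}-\rho^{k-1}v^k)\cdot w+\rho^{k-1}(v^{k+1}-v^k)\cdot w\,dx+a(\rho^kv^k+J^k,v^{k+1},w)\\&\quad+\int_\Omega2\eta^kDv^{k+1}:Dw\,dx-\int_\Omega\mu^{k+1}\nabla\varphi^k\cdot w+\rho^kg\cdot w\,dx=0\qquad\forall w\in H(\mathrm{div},\Omega),\end{aligned}$$ $$\tfrac1\tau\int_\Omega(\varphi^{k+1}-\varphi^k)\Phi\,dx+\int_\Omega(v^{k+1}\cdot\nabla\varphi^k)\Phi\,dx+\int_\Omega m(\varphi^k)\nabla\mu^{k+1}\cdot\nabla\Phi\,dx=0\qquad\forall\Phi\in H^1(\Omega),$$ $$\sigma\epsilon\int_\Omega\nabla\varphi^{k+1}\cdot\nabla\Psi\,dx-\int_\Omega\mu^{k+1}\Psi\,dx+\int_\Omega(F_+'(\varphi^{k+1})+F_-'(\varphi^k))\Psi\,dx=0\qquad\forall\Psi\in H^1(\Omega).$$ Then $$\begin{aligned}&\tfrac12\int_\Omega\rho^k|v^{k+1}|^2dx+\tfrac{\sigma\epsilon}2\int_\Omega|\nabla\varphi^{k+1}|^2dx+\int_\Omega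 F(\varphi^{k+1})dx\\&+\tfrac12\int_\Omega\rho^{k-1}|v^{k+1}-v^k|^2dx+\tfrac{\sigma\epsilon}2\int_\Omega|\nabla\varphi^{k+1}-\nabla\varphi^k|^2dx\\&+\tau\int_\Omega2\eta^k|Dv^{k+1}|^2dx+\tau\int_\Omega m^k|\nabla\mu^{k+1}|^2dx\\&\le\tfrac12\int_\Omega\rho^{k-1}|v^k|^2dx+\tfrac{\sigma\epsilon}2\int_\Omega|\nabla\varphi^k|^2dx+\int_\Omega F(\varphi^k)dx+\tau\int_\Omega\rho^kg\cdot v^{k+1}dx.\end{aligned}$$
   Context: $\Omega\subset\mathbb R^n$, $n\in\{2,3\}$, is a bounded domain with boundary $\partial\Omega$, whose closure admits a conforming triangulation into closed simplices. $\sigma,\epsilon>0$ and the time step $\tau>0$ are constants, $g\in L^2(\Omega)^n$ is the given gravitational force, $Dv=\frac12(\nabla v+(\nabla v)^t)$. $L^2_{(0)}(\Omega)$ is the space of $L^2(\Omega)$ functions with zero mean and $H(\mathrm{div},\Omega)=\{v\in H^1_0(\Omega)^n:(\mathrm{div}\,v,q)_{L^2(\Omega)}=0\ \forall q\in L^2_{(0)}(\Omega)\}$. Trilinear form: $a(u,v,w)=\frac12\int_\Omega((u\cdot\nabla)v)\cdot w\,dx-\frac12\int_\Omega((u\cdot\nabla)w)\cdot v\,dx$ for $u\in L^q(\Omega)^n$, $q>n$, $v,w\in H^1(\Omega)^n$. Notation: $\rho^k=\rho(\varphi^k)$, $\eta^k=\eta(\varphi^k)$, $m^k=m(\varphi^k)$,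 $J^k=-\rho'(\varphi^k)m^k\nabla\mu^k$. Standing assumptions on the data: $\rho,\eta,m:\mathbb R\to\mathbb R$ are continuous with $\overline\rho\ge\rho\ge\underline\rho>0$, $\overline\eta\ge\eta\ge\underline\eta>0$, $\overline m\ge m\ge\underline m>0$. Moreover $\rho$ is smooth and monotone; for constants $0<\tilde\rho_1\le\tilde\rho_2$ it equals $\frac{\tilde\rho_2-\tilde\rho_1}2\varphi+\frac{\tilde\rho_1+\tilde\rho_2}2$ for $|\varphi|<1+\frac{\tilde\rho_1}{\tilde\rho_2-\tilde\rho_1}$ and is constant on each of $\varphi>1+\frac{2\tilde\rho_1}{\tilde\rho_2-\tilde\rho_1}$ and $\varphi<-1-\frac{2\tilde\rho_1}{\tilde\rho_2-\tilde\rho_1}$ ($\rho$ constant if $\tilde\rho_1=\tilde\rho_2$). $F=F_++F_-:\mathbb R\to\mathbb R$ is continuously differentiable, $F_+$ convex, $F_-$ concave (both differentiable). There are $C>0$ and $q\in[1,4]$ if $n=3$, $q\in[1,\infty)$ if $n=2$, with $|F(x)|\le C(1+|x|^q)$, $|F_\pm'(x)|\le C(1+|x|^{q-1})$. $F_+'$, viewed as an operator $H^1(\Omega)\to H^1(\Omega)^*$, is Newton (slantly) differentiable with Newton derivative $G$ satisfying $(G(\varphi)\delta\varphi,\delta\varphi)\ge0$ for all $\varphi,\delta\varphi\in H^1(\Omega)$.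
   Formalization: The simplices of the triangulation of the closure are also required to have their interiors inside Ω (automatic if Ω is the interior of its closure); otherwise Ω could be a dense open subset of a polyhedron on which a and the integral of F are undefined on H^1. *)

theory Defs
  imports "HOL-Analysis.Analysis"
begin

section \<open>The domain\<close>

text \<open>
  The last condition says that the boundary of \<open>\<Omega>\<close> is resolved by the triangulation. It holds
  automatically whenever \<open>\<Omega>\<close> is the interior of its closure; without it \<open>\<Omega>\<close> could be, for
  instance, any dense open connected subset of a cube, on which the Sobolev embeddings that make
  sense of the integrals below fail.
\<close>
definition conforming_triangulation :: "(real ^ 'n) set \<Rightarrow> (real ^ 'n) set set \<Rightarrow> bool" where
  "conforming_triangulation \<Omega> \<T> \<longleftrightarrow>
     triangulation \<T> \<and> (\<forall>T\<in>\<T>. int CARD('n) simplex T) \<and> \<Union>\<T> = closure \<Omega> \<and>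
     (\<forall>T\<in>\<T>. interior T \<subseteq> \<Omega>)"


section \<open>Test functions and weak gradients\<close>

definition partial :: "'n \<Rightarrow> (real ^ 'n \<Rightarrow> real) \<Rightarrow> real ^ 'n \<Rightarrow> real" where
  "partial i f x = frechet_derivative f (at x) (axis i 1)"

primrec C_class :: "nat \<Rightarrow> (real ^ 'n \<Rightarrow> real) \<Rightarrow> bool" where
  "C_class 0 f \<longleftrightarrow> continuous_on UNIV f"
| "C_class (Suc k) f \<longleftrightarrow> (\<forall>x. f differentiable (at x)) \<and> (\<forall>i. C_class k (partial i f))"

definition test_functions :: "(real ^ 'n) set \<Rightarrow> (real ^ 'n \<Rightarrow> real) set" where
  "test_functions \<Omega> =
     {\<psi>. (\<forall>k. C_class k \<psi>) \<and> compact (closure {x. \<psi> x \<noteq> 0}) \<and> closure {x. \<psi> x \<noteq> 0} \<subseteq> \<Omega>}"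

definition locally_integrable ::
    "(real ^ 'n) set \<Rightarrow> (real ^ 'n \<Rightarrow> 'b::{banach, second_countable_topology}) \<Rightarrow> bool" where
  "locally_integrable \<Omega> f \<longleftrightarrow> (\<forall>K. compact K \<and> K \<subseteq> \<Omega> \<longrightarrow> integrable (lebesgue_on K) f)"

definition has_weak_gradient ::
    "(real ^ 'n) set \<Rightarrow> (real ^ 'n \<Rightarrow> real) \<Rightarrow> (real ^ 'n \<Rightarrow> real ^ 'n) \<Rightarrow> bool" where
  "has_weak_gradient \<Omega> u h \<longleftrightarrow>
     locally_integrable \<Omega> u \<and> locally_integrable \<Omega> h \<and>
     (\<forall>\<psi>\<in>test_functions \<Omega>. \<forall>i.
        (LINT x|lebesgue_on \<Omega>. u x * partial i \<psi> x) = - (LINT x|lebesgue_on \<Omega>. h x $ i * \<psi> x))"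

text \<open>A representative; weak gradients are unique only almost everywhere on \<open>\<Omega>\<close>.\<close>
definition grad :: "(real ^ 'n) set \<Rightarrow> (real ^ 'n \<Rightarrow> real) \<Rightarrow> real ^ 'n \<Rightarrow> real ^ 'n" where
  "grad \<Omega> u = (SOME h. has_weak_gradient \<Omega> u h)"

text \<open>Row \<open>i\<close> of \<open>jac \<Omega> v x\<close> is the gradient of the \<open>i\<close>-th component of \<open>v\<close>, so that
  \<open>(u \<cdot> \<nabla>) v\<close> is \<open>jac \<Omega> v x *v u x\<close>.\<close>
definition jac :: "(real ^ 'n) set \<Rightarrow> (real ^ 'n \<Rightarrow> real ^ 'n) \<Rightarrow> real ^ 'n \<Rightarrow> real ^ 'n ^ 'n" where
  "jac \<Omega> v x = (\<chi> i. grad \<Omega> (\<lambda>y. v y $ i) x)"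

definition divergence :: "(real ^ 'n) set \<Rightarrow> (real ^ 'n \<Rightarrow> real ^ 'n) \<Rightarrow> real ^ 'n \<Rightarrow> real" where
  "divergence \<Omega> v x = (\<Sum>i\<in>UNIV. grad \<Omega> (\<lambda>y. v y $ i) x $ i)"

text \<open>The inner product and the norm of \<open>real ^ 'n ^ 'n\<close> are the Frobenius ones.\<close>
definition sym_grad :: "(real ^ 'n) set \<Rightarrow> (real ^ 'n \<Rightarrow> real ^ 'n) \<Rightarrow> real ^ 'n \<Rightarrow> real ^ 'n ^ 'n" where
  "sym_grad \<Omega> v x = (1/2) *\<^sub>R (jac \<Omega> v x + transpose (jac \<Omega> v x))"


section \<open>Function spaces\<close>

text \<open>
  All spaces are sets of representatives, i.e. of functions on the whole space of which only the
  values on \<open>\<Omega>\<close>, up to null sets, matter.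
\<close>

definition Lp ::
    "real \<Rightarrow> (real ^ 'n) set \<Rightarrow> (real ^ 'n \<Rightarrow> 'b::{banach, second_countable_topology}) set" where
  "Lp p \<Omega> = {f \<in> borel_measurable (lebesgue_on \<Omega>). integrable (lebesgue_on \<Omega>) (\<lambda>x. norm (f x) powr p)}"

definition L2_mean_zero :: "(real ^ 'n) set \<Rightarrow> (real ^ 'n \<Rightarrow> real) set" where
  "L2_mean_zero \<Omega> = {f \<in> Lp 2 \<Omega>. (LINT x|lebesgue_on \<Omega>. f x) = 0}"

definition W1 :: "real \<Rightarrow> (real ^ 'n) set \<Rightarrow> (real ^ 'n \<Rightarrow> real) set" where
  "W1 p \<Omega> = {u \<in> Lp p \<Omega>. \<exists>h \<in> Lp p \<Omega>. has_weak_gradient \<Omega> u h}"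

abbreviation H1 :: "(real ^ 'n) set \<Rightarrow> (real ^ 'n \<Rightarrow> real) set" where
  "H1 \<equiv> W1 2"

definition H1_norm :: "(real ^ 'n) set \<Rightarrow> (real ^ 'n \<Rightarrow> real) \<Rightarrow> real" where
  "H1_norm \<Omega> u =
     sqrt ((LINT x|lebesgue_on \<Omega>. (u x)\<^sup>2) + (LINT x|lebesgue_on \<Omega>. (norm (grad \<Omega> u x))\<^sup>2))"

text \<open>The closure of the test functions in the norm of \<open>H1 \<Omega>\<close>.\<close>
definition H1_0 :: "(real ^ 'n) set \<Rightarrow> (real ^ 'n \<Rightarrow> real) set" where
  "H1_0 \<Omega> = {u \<in> H1 \<Omega>. \<forall>e>0. \<exists>\<psi>\<in>test_functions \<Omega>. H1_norm \<Omega> (\<lambda>x. u x - \<psi> x) < e}"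

definition H_div :: "(real ^ 'n) set \<Rightarrow> (real ^ 'n \<Rightarrow> real ^ 'n) set" where
  "H_div \<Omega> = {v. (\<forall>i. (\<lambda>x. v x $ i) \<in> H1_0 \<Omega>) \<and>
     (\<forall>q\<in>L2_mean_zero \<Omega>. (LINT x|lebesgue_on \<Omega>. divergence \<Omega> v x * q x) = 0)}"


section \<open>Newton differentiability of operators from \<open>H1\<close> to its dual\<close>

text \<open>
  An operator from \<open>H1 \<Omega>\<close> to its dual is a function \<open>A\<close> with \<open>A \<phi> \<psi>\<close> the value of the functional
  \<open>A \<phi>\<close> at \<open>\<psi>\<close>. For \<open>G\<close> independence of the representative \<open>\<phi>\<close> is required explicitly; for the
  other arguments it follows from linearity and boundedness. The limit condition reads
  \<open>\<parallel>A (\<phi> + h) - A \<phi> - G (\<phi> + h) h\<parallel> = o(\<parallel>h\<parallel>)\<close> in the dual norm.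
\<close>

definition H1_dual :: "(real ^ 'n) set \<Rightarrow> ((real ^ 'n \<Rightarrow> real) \<Rightarrow> real) set" where
  "H1_dual \<Omega> = {L.
     (\<forall>\<psi>\<in>H1 \<Omega>. \<forall>\<psi>'\<in>H1 \<Omega>. \<forall>a b. L (\<lambda>x. a * \<psi> x + b * \<psi>' x) = a * L \<psi> + b * L \<psi>') \<and>
     (\<exists>M. \<forall>\<psi>\<in>H1 \<Omega>. \<bar>L \<psi>\<bar> \<le> M * H1_norm \<Omega> \<psi>)}"

definition H1_operator ::
    "(real ^ 'n) set \<Rightarrow> ((real ^ 'n \<Rightarrow> real) \<Rightarrow> (real ^ 'n \<Rightarrow> real) \<Rightarrow> real) \<Rightarrow> bool" where
  "H1_operator \<Omega> B \<longleftrightarrow>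
     (\<forall>\<delta>\<in>H1 \<Omega>. B \<delta> \<in> H1_dual \<Omega>) \<and>
     (\<forall>\<psi>\<in>H1 \<Omega>. \<forall>\<delta>\<in>H1 \<Omega>. \<forall>\<delta>'\<in>H1 \<Omega>. \<forall>a b.
        B (\<lambda>x. a * \<delta> x + b * \<delta>' x) \<psi> = a * B \<delta> \<psi> + b * B \<delta>' \<psi>) \<and>
     (\<exists>M. \<forall>\<delta>\<in>H1 \<Omega>. \<forall>\<psi>\<in>H1 \<Omega>. \<bar>B \<delta> \<psi>\<bar> \<le> M * H1_norm \<Omega> \<delta> * H1_norm \<Omega> \<psi>)"

definition newton_derivative ::
    "(real ^ 'n) set \<Rightarrow> ((real ^ 'n \<Rightarrow> real) \<Rightarrow> (real ^ 'n \<Rightarrow> real) \<Rightarrow> real) \<Rightarrow>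
     ((real ^ 'n \<Rightarrow> real) \<Rightarrow> (real ^ 'n \<Rightarrow> real) \<Rightarrow> (real ^ 'n \<Rightarrow> real) \<Rightarrow> real) \<Rightarrow> bool" where
  "newton_derivative \<Omega> A G \<longleftrightarrow>
     (\<forall>\<phi>\<in>H1 \<Omega>. A \<phi> \<in> H1_dual \<Omega> \<and> H1_operator \<Omega> (G \<phi>)) \<and>
     (\<forall>\<phi>\<in>H1 \<Omega>. \<forall>\<phi>'\<in>H1 \<Omega>. (AE x in lebesgue_on \<Omega>. \<phi> x = \<phi>' x) \<longrightarrow>
        (\<forall>\<delta>\<in>H1 \<Omega>. \<forall>\<psi>\<in>H1 \<Omega>. G \<phi> \<delta> \<psi> = G \<phi>' \<delta> \<psi>)) \<and>
     (\<forall>\<phi>\<in>H1 \<Omega>. \<forall>e>0. \<exists>d>0. \<forall>h\<in>H1 \<Omega>. H1_norm \<Omega> h < d \<longrightarrow>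
        (\<forall>\<psi>\<in>H1 \<Omega>. \<bar>A (\<lambda>x. \<phi> x + h x) \<psi> - A \<phi> \<psi> - G (\<lambda>x. \<phi> x + h x) h \<psi>\<bar>
                     \<le> e * H1_norm \<Omega> h * H1_norm \<Omega> \<psi>))"

definition superposition_operator ::
    "(real ^ 'n) set \<Rightarrow> (real \<Rightarrow> real) \<Rightarrow> (real ^ 'n \<Rightarrow> real) \<Rightarrow> (real ^ 'n \<Rightarrow> real) \<Rightarrow> real" where
  "superposition_operator \<Omega> f \<phi> \<psi> = (LINT x|lebesgue_on \<Omega>. f (\<phi> x) * \<psi> x)"


section \<open>Ingredients of the scheme\<close>

definition trilinear_form :: "(real ^ 'n) set \<Rightarrow> (real ^ 'n \<Rightarrow> real ^ 'n) \<Rightarrow>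
    (real ^ 'n \<Rightarrow> real ^ 'n) \<Rightarrow> (real ^ 'n \<Rightarrow> real ^ 'n) \<Rightarrow> real" where
  "trilinear_form \<Omega> u v w =
     1/2 * (LINT x|lebesgue_on \<Omega>. (jac \<Omega> v x *v u x) \<bullet> w x) -
     1/2 * (LINT x|lebesgue_on \<Omega>. (jac \<Omega> w x *v u x) \<bullet> v x)"

definition mass_flux :: "(real ^ 'n) set \<Rightarrow> (real \<Rightarrow> real) \<Rightarrow> (real \<Rightarrow> real) \<Rightarrow>
    (real ^ 'n \<Rightarrow> real) \<Rightarrow> (real ^ 'n \<Rightarrow> real) \<Rightarrow> real ^ 'n \<Rightarrow> real ^ 'n" where
  "mass_flux \<Omega> \<rho> m \<phi> \<mu> x = - (deriv \<rho> (\<phi> x) * m (\<phi> x)) *\<^sub>R grad \<Omega> \<mu> x"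

text \<open>The case distinction avoids \<open>\<rho>1 / (\<rho>2 - \<rho>1) = 0\<close> for equal densities.\<close>
definition density_law :: "real \<Rightarrow> real \<Rightarrow> (real \<Rightarrow> real) \<Rightarrow> bool" where
  "density_law \<rho>1 \<rho>2 \<rho> \<longleftrightarrow>
     (if \<rho>1 = \<rho>2 then \<exists>c. \<forall>s. \<rho> s = c
      else (\<forall>s. \<bar>s\<bar> < 1 + \<rho>1 / (\<rho>2 - \<rho>1) \<longrightarrow> \<rho> s = (\<rho>2 - \<rho>1) / 2 * s + (\<rho>1 + \<rho>2) / 2) \<and>
           (\<exists>c. \<forall>s. s > 1 + 2 * \<rho>1 / (\<rho>2 - \<rho>1) \<longrightarrow> \<rho> s = c) \<and>
           (\<exists>c. \<forall>s. s < - 1 - 2 * \<rho>1 / (\<rho>2 - \<rho>1) \<longrightarrow> \<rho> s = c))"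

text \<open>The exponent \<open>0\<close> is treated separately since \<open>0 powr 0 = 0\<close>.\<close>
definition growth_bound :: "real \<Rightarrow> real \<Rightarrow> (real \<Rightarrow> real) \<Rightarrow> bool" where
  "growth_bound C p f \<longleftrightarrow> (\<forall>s. \<bar>f s\<bar> \<le> C * (1 + (if p = 0 then 1 else \<bar>s\<bar> powr p)))"

end

theory Submission
  imports Defs
begin

text \<open>
  Testing the momentum equation with \<open>v_new\<close>, the phase equation with \<open>\<mu>_new\<close> and the potential
  equation with \<open>\<phi>_new - \<phi>\<close> and adding up, the trilinear form vanishes, the capillary work
  \<open>\<integral> \<mu>_new \<nabla>\<phi> \<cdot> v_new\<close> and the term \<open>\<integral> \<mu>_new (\<phi>_new - \<phi>)\<close> cancel, and convexity of \<open>Fp\<close> and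
  concavity of \<open>Fm\<close> bound \<open>F(\<phi>_new) - F(\<phi>)\<close> pointwise. What remains is that these integrals exist, which
  needs the embedding of \<open>H1\<close> into \<open>Lp\<close> for \<open>p = 4\<close>, and for every finite \<open>p\<close> in the plane.

  A simplex is star-shaped with respect to a ball. If \<open>a(t)\<close> is the average of \<open>u\<close> over the image of that
  ball under the contraction to \<open>x\<close> with factor \<open>t\<close>, against a smooth bump, then \<open>a'(t)\<close> is an integral of
  \<open>\<nabla>u\<close> alone, since the \<open>t\<close>-derivative of the bump is the divergence of a test field. Along \<open>t = 2^-k\<close> the increments
  are controlled by the mean of \<open>|\<nabla>u|^2\<close> over a ball around \<open>x\<close> of radius comparable to \<open>2^-k\<close>, and these means have
  integrable weighted sum over \<open>k\<close>; the limit of \<open>a(2^-k)\<close> is a multiple of \<open>u(x)\<close> at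
  every Lebesgue point.
\<close>

section \<open>Smooth functions\<close>

text \<open>The obstacle is additivity of the integral: a function that is not integrable has
  integral 0, so an integral of a sum may be split only after integrability is proved, while the
  data supply square-integrable functions and gradients only. The triple product in the capillary
  work and the growth of \<open>F\<close> exceed that. No regularity of the boundary is given, hence
  no extension operator to appeal to; the triangulation carries the geometry. The embedding is
  therefore proved on each convex cell and the cells are added up, their frontiers being null sets.
  Averages of \<open>u\<close> against bumps keep the argument inside the definition of a weak
  gradient, with no approximation of \<open>u\<close> by smooth functions; the price is that
  \<open>u(x)\<close> has to be recovered at Lebesgue points. Subcritical exponents suffice (4
  against the critical 6 in three dimensions), and the slack in the exponent pays for the geometric
  decay. A second difficulty is that \<open>grad\<close> is a Hilbert choice: its square
  integrability and its linearity come only from the uniqueness of weak gradients almost everywhere,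
  which is again obtained at Lebesgue points.\<close>

lemma partial_eq:
  assumes "(f has_derivative f') (at x)"
  shows "partial i f x = f' (axis i 1)"
  using assms frechet_derivative_at unfolding partial_def by metis

text \<open>The regularity half of \<open>test_functions\<close>, split off because polynomial
  factors and bumps are multiplied first and the support is controlled afterwards.\<close>

definition smooth :: "(real ^ 'n \<Rightarrow> real) \<Rightarrow> bool" where
  "smooth f \<longleftrightarrow> (\<forall>k. C_class k f)"

lemma smooth_differentiable: "smooth f \<Longrightarrow> f differentiable (at x)"
  unfolding smooth_def by (metis C_class.simps(2))

lemma smooth_partial: "smooth f \<Longrightarrow> smooth (partial i f)"
  unfolding smooth_def by (metis C_class.simps(2))

lemma smooth_continuous: "smooth f \<Longrightarrow> continuous_on A f"
  unfolding smooth_def by (metis C_class.simps(1) continuous_on_subset subset_UNIV)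

lemma smooth_has_derivative:
  "smooth f \<Longrightarrow> (f has_derivative frechet_derivative f (at x)) (at x)"
  using smooth_differentiable frechet_derivative_works by blast

lemma partial_const [simp]: "partial i (\<lambda>x. c) = (\<lambda>x. 0)"
  by (rule ext, subst partial_eq[of _ "\<lambda>x. 0"]) auto

lemma smooth_const: "smooth (\<lambda>x. c)"
proof -
  have "C_class k (\<lambda>x::real^'a. c)" for k and c :: real
    by (induction k arbitrary: c) auto
  then show ?thesis by (simp add: smooth_def)
qed

lemma partial_coord: "partial i (\<lambda>x. x $ j) = (\<lambda>x. if i = j then 1 else 0)"
proof
  fix x :: "real ^ 'a"
  have "((\<lambda>x. x $ j) has_derivative (\<lambda>x. x $ j)) (at x)"
    by (auto intro!: derivative_eq_intros bounded_linear_imp_has_derivative bounded_linear_vec_nth)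
  from partial_eq[OF this] show "partial i (\<lambda>x. x $ j) x = (if i = j then 1 else 0)"
    by (simp add: axis_def)
qed

lemma differentiable_coord: "(\<lambda>x::real^'n. x $ j) differentiable (at x)"
  using bounded_linear_vec_nth bounded_linear_imp_differentiable by blast

lemma smooth_coord: "smooth (\<lambda>x. x $ j)"
proof -
  have "C_class k (\<lambda>x::real^'a. x $ j)" for k
  proof (cases k)
    case (Suc k)
    have "C_class k (\<lambda>x::real^'a. c)" for c :: real
      using smooth_const unfolding smooth_def by blast
    then show ?thesis using Suc by (auto simp: partial_coord differentiable_coord)
  qed (auto intro: continuous_intros)
  then show ?thesis by (simp add: smooth_def)
qed

lemma partial_add:
  assumes "f differentiable (at x)" "g differentiable (at x)"
  shows "partial i (\<lambda>x. f x + g x) x = partial i f x + partial i g x"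
  using assms unfolding partial_def
  by (subst frechet_derivative_at[symmetric, OF has_derivative_add])
     (auto simp: frechet_derivative_works[symmetric])

lemma partial_mult:
  fixes f g :: "real ^ 'n \<Rightarrow> real"
  assumes "f differentiable (at x)" "g differentiable (at x)"
  shows "partial i (\<lambda>x. f x * g x) x = f x * partial i g x + partial i f x * g x"
  using assms unfolding partial_def
  by (subst frechet_derivative_at[symmetric, OF has_derivative_mult])
     (auto simp: frechet_derivative_works[symmetric])

lemma C_class_add: "C_class k f \<Longrightarrow> C_class k g \<Longrightarrow> C_class k (\<lambda>x. f x + g x)"
proof (induction k arbitrary: f g)
  case 0 then show ?case by (auto intro!: continuous_intros)
next
  case (Suc k)
  have "partial i (\<lambda>x. f x + g x) = (\<lambda>x. partial i f x + partial i g x)" for i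
    using Suc.prems by (auto simp: partial_add)
  then show ?case using Suc by (auto intro!: differentiable_add)
qed

lemma smooth_add: "smooth f \<Longrightarrow> smooth g \<Longrightarrow> smooth (\<lambda>x. f x + g x)"
  by (simp add: smooth_def C_class_add)

text \<open>The product rule brings back the undifferentiated factors one level lower, and
  \<open>C_class (Suc k) f\<close> does not unfold to \<open>C_class k f\<close>. With fully smooth
  factors the hypotheses survive the induction; for sums this difficulty does not arise.\<close>

lemma smooth_mult:
  assumes "smooth f" "smooth g" shows "smooth (\<lambda>x. f x * g x)"
proof -
  have "C_class k (\<lambda>x. f x * g x)" for k using assms
  proof (induction k arbitrary: f g)
    case 0 then show ?case by (simp add: continuous_on_mult smooth_continuous)
  next
    case (Suc k)
    have "partial i (\<lambda>x. f x * g x) = (\<lambda>x. f x * partial i g x + partial i f x * g x)" for i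
      using Suc.prems by (auto simp: partial_mult smooth_differentiable)
    then show ?case using Suc
      by (simp add: differentiable_mult smooth_differentiable C_class_add smooth_partial)
  qed
  then show ?thesis by (simp add: smooth_def)
qed

lemma smooth_sum: "(\<And>j. j \<in> A \<Longrightarrow> smooth (f j)) \<Longrightarrow> smooth (\<lambda>x. \<Sum>j\<in>A. f j x)"
  by (induction A rule: infinite_finite_induct) (auto intro: smooth_const smooth_add)

subsection \<open>Bump functions\<close>

text \<open>The index \<open>j\<close> makes the family closed under differentiation up to linear
  combinations: the powers of \<open>1 / t\<close> that differentiation produces are absorbed into
  \<open>t ^ j\<close>. The profile of the standard mollifier is the case
  \<open>j = 0\<close>.\<close>

definition bump_profile :: "nat \<Rightarrow> real \<Rightarrow> real" where
  "bump_profile j t = (if t > 0 then exp (- 1 / t) / t ^ j else 0)"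

text \<open>A single term of the exponential series is at most its sum. With
  \<open>s = 1 / t\<close> this bounds every \<open>bump_profile j\<close>.\<close>

lemma power_mult_exp_le: "0 \<le> s \<Longrightarrow> s ^ j * exp (- s) \<le> fact j" for s :: real
proof -
  assume s: "0 \<le> s"
  have "s ^ j / fact j \<le> exp s"
  proof -
    have "(\<Sum>n\<in>{j}. s ^ n /\<^sub>R fact n) \<le> (\<Sum>n. s ^ n /\<^sub>R fact n)"
      using s summable_exp_generic[of s] by (intro sum_le_suminf) auto
    then show ?thesis by (simp add: exp_def divide_inverse mult.commute)
  qed
  then show ?thesis by (simp add: exp_minus field_simps)
qed

lemma bump_profile_nonneg: "0 \<le> bump_profile j t"
  by (simp add: bump_profile_def)

lemma bump_profile_le: "bump_profile j t \<le> fact j"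
  using power_mult_exp_le[of "1/t" j] by (auto simp: bump_profile_def power_divide)

lemma bump_profile_deriv:
  "(bump_profile j has_real_derivative bump_profile (j + 2) t - real j * bump_profile (Suc j) t) (at t)"
proof -
  consider "t > 0" | "t < 0" | "t = 0" by linarith
  then show ?thesis
  proof cases
    case 1
    have "((\<lambda>t. exp (- 1 / t) / t ^ j) has_real_derivative
        bump_profile (j + 2) t - real j * bump_profile (Suc j) t) (at t)"
    proof -
      have "((\<lambda>t. t ^ j) has_real_derivative real j * t ^ j / t) (at t)"
        using DERIV_pow[of j t] 1 by (cases j) auto
      moreover have "((\<lambda>t. exp (- 1 / t)) has_real_derivative exp (- 1 / t) / t ^ 2) (at t)"
        using 1 by (auto intro!: derivative_eq_intros simp: power2_eq_square)
      ultimately have "((\<lambda>t. exp (- 1 / t) / t ^ j) has_real_derivative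
         (exp (- 1 / t) / t ^ 2 * t ^ j - exp (- 1 / t) * (real j * t ^ j / t)) / (t ^ j * t ^ j)) (at t)"
        using 1 by (intro DERIV_divide) auto
      moreover have "(exp (- 1 / t) / t ^ 2 * t ^ j - exp (- 1 / t) * (real j * t ^ j / t)) / (t ^ j * t ^ j)
         = bump_profile (j + 2) t - real j * bump_profile (Suc j) t"
        using 1 by (simp add: bump_profile_def divide_simps power2_eq_square) (simp add: algebra_simps)
      ultimately show ?thesis by simp
    qed
    moreover have ev: "\<forall>\<^sub>F s in nhds t. bump_profile j s = exp (- 1 / s) / s ^ j"
      using eventually_nhds_in_open[of "{0<..}" t] 1 by (auto elim!: eventually_mono simp: bump_profile_def)
    ultimately show ?thesis unfolding DERIV_cong_ev[OF refl ev refl] by blast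
  next
    case 2
    have ev: "\<forall>\<^sub>F s in nhds t. bump_profile j s = 0"
      using eventually_nhds_in_open[of "{..<0}" t] 2 by (auto elim!: eventually_mono simp: bump_profile_def)
    moreover have "((\<lambda>t. 0) has_real_derivative bump_profile (j + 2) t - real j * bump_profile (Suc j) t) (at t)"
      using 2 by (simp add: bump_profile_def)
    ultimately show ?thesis unfolding DERIV_cong_ev[OF refl ev refl] by blast
  next
    case 3
    \<comment> \<open>The difference quotient at 0 is \<open>h\<close> times the profile of index
      \<open>j + 2\<close>, which is bounded by \<open>fact (j + 2)\<close>; so it tends to
      0.\<close>
    have bd: "\<bar>bump_profile j h / h\<bar> \<le> fact (j + 2) * \<bar>h\<bar>" for h
    proof (cases "h > 0")
      case True
      have "bump_profile j h / h = h * bump_profile (j + 2) h"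
        using True by (simp add: bump_profile_def field_simps)
      then show ?thesis using True bump_profile_le[of "j + 2" h] bump_profile_nonneg[of "j+2" h] by (simp add: abs_mult)
    next
      case False
      then have "bump_profile j h = 0" by (simp add: bump_profile_def)
      then show ?thesis by simp
    qed
    have "((\<lambda>h. fact (j + 2) * \<bar>h\<bar>) \<longlongrightarrow> fact (j + 2) * \<bar>0::real\<bar>) (at 0)"
      by (intro tendsto_intros)
    then have "((\<lambda>h. fact (j + 2) * \<bar>h\<bar>) \<longlongrightarrow> (0::real)) (at 0)" by simp
    then have "((\<lambda>h. bump_profile j h / h) \<longlongrightarrow> 0) (at 0)"
      by (rule Lim_null_comparison[rotated]) (use bd in auto)
    then show ?thesis using 3 by (simp add: DERIV_def bump_profile_def)
  qed
qed

lemma bump_profile_comp_has_derivative: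
  assumes "(f has_derivative f') (at x)"
  shows "((\<lambda>x. bump_profile j (f x)) has_derivative
    (\<lambda>y. f' y * (bump_profile (j + 2) (f x) - real j * bump_profile (Suc j) (f x)))) (at x)"
  using DERIV_compose_FDERIV[OF bump_profile_deriv assms] .

lemma smooth_bump_profile:
  assumes "smooth f" shows "smooth (\<lambda>x. bump_profile j (f x))"
proof -
  note D = bump_profile_comp_has_derivative[OF smooth_has_derivative[OF assms]]
  \<comment> \<open>The induction needs an arbitrary index \<open>j\<close> and an arbitrary smooth
    factor \<open>g\<close>, since the chain rule raises the index and multiplies by
    \<open>partial i f\<close>.\<close>
  have "C_class k (\<lambda>x. bump_profile j (f x) * g x)" if "smooth g" for k g using that
  proof (induction k arbitrary: j g)
    case 0
    have "continuous_on UNIV (\<lambda>x. bump_profile j (f x))"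
      by (intro continuous_at_imp_continuous_on ballI has_derivative_continuous[OF D])
    then show ?case by (simp add: continuous_on_mult smooth_continuous 0)
  next
    case (Suc k)
    have df: "(\<lambda>x. bump_profile j (f x)) differentiable (at x)" for x
      by (rule differentiableI[OF D])
    note dg = smooth_differentiable[OF Suc.prems]
    have eq: "partial i (\<lambda>x. bump_profile j (f x) * g x) =
       (\<lambda>x. bump_profile j (f x) * partial i g x + (bump_profile (j + 2) (f x) * (partial i f x * g x)
          + bump_profile (Suc j) (f x) * ((- real j) * (partial i f x * g x))))" for i
    proof
      fix x
      have "partial i (\<lambda>x. bump_profile j (f x)) x
          = partial i f x * (bump_profile (j + 2) (f x) - real j * bump_profile (Suc j) (f x))"
        using partial_eq[OF D] by (simp add: partial_def)
      then show "partial i (\<lambda>x. bump_profile j (f x) * g x) x =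
          bump_profile j (f x) * partial i g x + (bump_profile (j + 2) (f x) * (partial i f x * g x)
          + bump_profile (Suc j) (f x) * ((- real j) * (partial i f x * g x)))"
        unfolding partial_mult[OF df dg] by (simp only:) (simp add: algebra_simps)
    qed
    have "C_class k (\<lambda>x. bump_profile j (f x) * partial i g x)"
      "C_class k (\<lambda>x. bump_profile (j + 2) (f x) * (partial i f x * g x))"
      "C_class k (\<lambda>x. bump_profile (Suc j) (f x) * ((- real j) * (partial i f x * g x)))" for i
      by (intro Suc.IH smooth_mult smooth_const smooth_partial assms Suc.prems)+
    then have "C_class k (partial i (\<lambda>x. bump_profile j (f x) * g x))" for i
      unfolding eq by (intro C_class_add)
    then show ?case using differentiable_mult[OF df dg] by simp
  qed
  from this[OF smooth_const[of 1]] show ?thesis by (simp add: smooth_def)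
qed

text \<open>The standard mollifier, left unnormalised: its mass enters only through the lower bound
  \<open>bump_mass_le\<close>.\<close>

definition bump :: "real ^ 'n \<Rightarrow> real \<Rightarrow> real ^ 'n \<Rightarrow> real" where
  "bump c r z = bump_profile 0 (1 - (norm (z - c))\<^sup>2 / r\<^sup>2)"

lemma smooth_norm_square: "smooth (\<lambda>z. 1 - (norm (z - c))\<^sup>2 / r\<^sup>2)"
proof -
  have eq: "(\<lambda>z. 1 - (norm (z - c))\<^sup>2 / r\<^sup>2)
      = (\<lambda>z. 1 + (\<Sum>i\<in>UNIV. (- 1 / r\<^sup>2) * ((z $ i + - (c $ i)) * (z $ i + - (c $ i)))))"
    by (simp add: fun_eq_iff power2_norm_eq_inner inner_vec_def sum_divide_distrib sum_negf)
  show ?thesis unfolding eq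
    by (intro smooth_add smooth_sum smooth_mult smooth_coord smooth_const)
qed

lemma smooth_bump: "smooth (bump c r)"
  using smooth_bump_profile[OF smooth_norm_square] unfolding bump_def[abs_def] .

lemma bump_nonneg: "0 \<le> bump c r z" and bump_le: "bump c r z \<le> 1"
  using bump_profile_nonneg bump_profile_le[of 0] by (auto simp: bump_def)

lemma bump_profile_eq_0:
  assumes "0 < r" "r \<le> dist c z"
  shows "bump_profile j (1 - (norm (z - c))\<^sup>2 / r\<^sup>2) = 0"
proof -
  have "r\<^sup>2 \<le> (norm (z - c))\<^sup>2"
    using assms by (intro power_mono) (auto simp: dist_norm norm_minus_commute)
  then have "1 - (norm (z - c))\<^sup>2 / r\<^sup>2 \<le> 0"
    using assms(1) by (simp only: le_divide_eq_1_pos zero_less_power diff_le_0_iff_le)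
  then show ?thesis
    unfolding bump_profile_def by (simp only: not_less[symmetric] if_False)
qed

lemma bump_eq_0: "0 < r \<Longrightarrow> r \<le> dist c z \<Longrightarrow> bump c r z = 0"
  unfolding bump_def by (rule bump_profile_eq_0)

lemma closure_support_bump: "0 < r \<Longrightarrow> closure {z. g z * bump c r z \<noteq> 0} \<subseteq> cball c r"
  by (rule closure_minimal) (use bump_eq_0 in \<open>force+\<close>)

text \<open>The factor \<open>g\<close> is 1 when functions are separated by bumps, and an affine
  coordinate function when the components of a radial test field are formed.\<close>

lemma bump_test_function:
  assumes "0 < r" "cball c r \<subseteq> \<Omega>" "smooth g"
  shows "(\<lambda>z. g z * bump c r z) \<in> test_functions \<Omega>"
proof -
  note sub = closure_support_bump[OF assms(1), of g c]
  have "compact (closure {z. g z * bump c r z \<noteq> 0})"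
    using compact_Int_closed[OF compact_cball closed_closure] sub by (metis Int_absorb1)
  then show ?thesis
    using smooth_mult[OF assms(3) smooth_bump] assms(2) sub
    by (auto simp: test_functions_def smooth_def)
qed

lemma bump_has_derivative:
  "(bump c r has_derivative (\<lambda>y. - 2 * ((z - c) \<bullet> y) / r\<^sup>2 * bump_profile 2 (1 - (norm (z - c))\<^sup>2 / r\<^sup>2))) (at z)"
proof -
  have "((\<lambda>z. 1 - (norm (z - c))\<^sup>2 / r\<^sup>2) has_derivative (\<lambda>y. - 2 * ((z - c) \<bullet> y) / r\<^sup>2)) (at z)"
    unfolding power2_norm_eq_inner divide_inverse
    by (auto intro!: derivative_eq_intros simp: inner_commute algebra_simps)
  from bump_profile_comp_has_derivative[OF this, of 0] show ?thesis
    by (simp add: bump_def[abs_def] numeral_2_eq_2)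
qed

lemma partial_bump:
  "partial i (bump c r) z = - 2 * (z - c) $ i / r\<^sup>2 * bump_profile 2 (1 - (norm (z - c))\<^sup>2 / r\<^sup>2)"
  using partial_eq[OF bump_has_derivative] by (simp add: inner_axis)

section \<open>Lebesgue points\<close>

text \<open>
  \<open>integrable_ccontinuous_explicit\<close> differentiates integrals over boxes having \<open>x\<close> as their lowest corner;
  reflections of the coordinates give the other orthants.
\<close>
definition flip :: "('a \<Rightarrow> real) \<Rightarrow> 'a::euclidean_space \<Rightarrow> 'a" where
  "flip s x = (\<Sum>j\<in>Basis. (s j * (x \<bullet> j)) *\<^sub>R j)"

text \<open>Extensional functions on \<open>Basis\<close>, so that each orthant has exactly one sign
  vector and the set is finite.\<close>

definition signs :: "('a::euclidean_space \<Rightarrow> real) set" where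
  "signs = Basis \<rightarrow>\<^sub>E {1, -1}"

lemma finite_signs: "finite signs"
  by (auto simp: signs_def intro: finite_PiE)

lemma flip_inner: "j \<in> Basis \<Longrightarrow> flip s x \<bullet> j = s j * (x \<bullet> j)"
  by (simp add: flip_def inner_sum_left inner_Basis if_distrib cong: if_cong)

lemma flip_flip: "s \<in> signs \<Longrightarrow> flip s (flip s x) = x"
  by (rule euclidean_eqI) (auto simp: flip_inner signs_def PiE_iff)

lemma flip_measurable: "s \<in> signs \<Longrightarrow> flip s \<in> lebesgue \<rightarrow>\<^sub>M lebesgue"
  and distr_flip: "s \<in> signs \<Longrightarrow> distr lebesgue lebesgue (flip s) = lebesgue"
proof -
  assume s: "s \<in> signs"
  then have nz: "\<And>j. j \<in> Basis \<Longrightarrow> s j \<noteq> 0" and 1: "(\<Prod>j\<in>Basis. \<bar>s j\<bar>) = 1"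
    by (force simp: signs_def PiE_iff intro!: prod.neutral)+
  from lebesgue_affine_euclidean[of s 0, OF nz] 1
  show "distr lebesgue lebesgue (flip s) = lebesgue"
    by (simp add: flip_def[abs_def] density_1)
  from lebesgue_affine_measurable[of s 0, OF nz]
  show "flip s \<in> lebesgue \<rightarrow>\<^sub>M lebesgue"
    by (simp add: flip_def[abs_def])
qed

text \<open>Stated coordinatewise, so that the cover of a ball can be read off from the signs of the
  coordinates; \<open>orthant_box_eq\<close> recovers the box with lowest corner
  \<open>flip s x\<close>.\<close>

definition orthant_box :: "('a \<Rightarrow> real) \<Rightarrow> 'a::euclidean_space \<Rightarrow> real \<Rightarrow> 'a set" where
  "orthant_box s x h = {z. \<forall>j\<in>Basis. 0 \<le> s j * ((z - x) \<bullet> j) \<and> s j * ((z - x) \<bullet> j) \<le> h}"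

lemma orthant_box_eq: 
  assumes "s \<in> signs"
  shows "z \<in> orthant_box s x h \<longleftrightarrow> flip s z \<in> cbox (flip s x) (flip s x + h *\<^sub>R One)"
  by (auto simp: orthant_box_def mem_box flip_inner algebra_simps)

text \<open>The sign vector of a point records the orthant that contains \<open>z - x\<close>. The
  boxes overlap on faces, which is harmless when nonnegative functions are summed over them.\<close>

lemma cball_subset_orthant_boxes: "cball x h \<subseteq> (\<Union>s\<in>signs. orthant_box s x h)"
proof
  fix z assume "z \<in> cball x h"
  then have z: "\<And>j. j \<in> Basis \<Longrightarrow> \<bar>(z - x) \<bullet> j\<bar> \<le> h"
    using Basis_le_norm[of _ "z - x"] by (force simp: dist_norm norm_minus_commute)
  define s where "s = restrict (\<lambda>j. if (z - x) \<bullet> j \<ge> 0 then 1 else - 1 :: real) Basis"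
  have "s \<in> signs" by (auto simp: s_def signs_def)
  moreover have "z \<in> orthant_box s x h"
    using z by (force simp: orthant_box_def s_def abs_if)
  ultimately show "z \<in> (\<Union>s\<in>signs. orthant_box s x h)" by blast
qed

lemma integral_orthant_box:
  fixes f :: "'a::euclidean_space \<Rightarrow> real"
  assumes "s \<in> signs" "f \<in> borel_measurable lebesgue"
  shows "(LINT z|lebesgue. f z * indicator (orthant_box s x h) z)
    = (LINT z|lebesgue. f (flip s z) * indicator (cbox (flip s x) (flip s x + h *\<^sub>R One)) z)"
proof -
  have [measurable]: "flip s \<in> lebesgue \<rightarrow>\<^sub>M lebesgue" using flip_measurable assms(1) .
  have ob: "orthant_box s x h = flip s -` cbox (flip s x) (flip s x + h *\<^sub>R One) \<inter> space lebesgue"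
    using orthant_box_eq[OF assms(1)] by auto
  have [measurable]: "orthant_box s x h \<in> sets lebesgue"
    unfolding ob by (rule measurable_sets[OF flip_measurable[OF assms(1)]]) auto
  have [measurable]: "f \<in> borel_measurable lebesgue" by fact
  have "(LINT z|lebesgue. f z * indicator (orthant_box s x h) z)
      = (LINT z|distr lebesgue lebesgue (flip s). f z * indicator (orthant_box s x h) z)"
    by (simp add: distr_flip[OF assms(1)])
  also have "\<dots> = (LINT z|lebesgue. f (flip s z) * indicator (orthant_box s x h) (flip s z))"
    by (rule integral_distr) measurable
  also have "(\<lambda>z. indicator (orthant_box s x h) (flip s z)) =
     (indicator (cbox (flip s x) (flip s x + h *\<^sub>R One)) :: 'a \<Rightarrow> real)"
    by (auto simp: fun_eq_iff indicator_def orthant_box_eq[OF assms(1)] flip_flip[OF assms(1)])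
  finally show ?thesis .
qed

text \<open>Differentiation over boxes with lowest corner is applied to the reflected function at
  the reflected point. Reflections preserve measure, so the exceptional set remains null when it is
  carried back. Only the upper bound is kept, as this is what a sum over orthants requires.\<close>

lemma orthant_differentiation:
  fixes f :: "'a::euclidean_space \<Rightarrow> real"
  assumes s: "s \<in> signs" and f: "\<And>a b. integrable lebesgue (\<lambda>z. f z * indicator (cbox a b) z)"
    and fm: "f \<in> borel_measurable lebesgue"
  shows "AE x in lebesgue. \<forall>e>0. \<exists>d>0. \<forall>h. 0 < h \<and> h < d \<longrightarrow>
    (LINT z|lebesgue. f z * indicator (orthant_box s x h) z) \<le> (f x + e) * h ^ DIM('a)"
proof -
  note fs = flip_measurable[OF s]
  have int: "set_integrable lebesgue (cbox a b) (\<lambda>z. f (flip s z))" for a b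
  proof -
    \<comment> \<open>A reflection preserves the norm, so it maps the box into a ball and hence into
      a larger box, where \<open>f\<close> is integrable.\<close>
    obtain r where r: "cbox a b \<subseteq> cball 0 r"
      using bounded_cbox[of a b] by (metis bounded_iff mem_cball_0 subsetI)
    obtain p q where pq: "cball 0 r \<subseteq> cbox p (q::'a)"
      using bounded_subset_cbox_symmetric[OF bounded_cball] by blast
    have nf: "norm (flip s z) = norm z" for z
      using s by (subst (1 2) norm_eq_sqrt_inner, subst (1 2) euclidean_inner)
        (auto simp: flip_inner signs_def PiE_iff intro!: sum.cong)
    have "integrable (distr lebesgue lebesgue (flip s)) (\<lambda>z. f z * indicator (cbox p q) z)"
      using f by (simp add: distr_flip[OF s])
    then have "integrable lebesgue (\<lambda>z. f (flip s z) * indicator (cbox p q) (flip s z))"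
      by (subst (asm) integrable_distr_eq[OF fs borel_measurable_integrable[OF f]])
    then have "integrable lebesgue (\<lambda>z. f (flip s z) * indicator (cbox p q) (flip s z) * indicator (cbox a b) z)"
      by (rule integrable_real_mult_indicator[rotated]) auto
    moreover have "flip s z \<in> cbox p q" if "z \<in> cbox a b" for z
    proof -
      have "z \<in> cball 0 r" using r that by blast
      then have "flip s z \<in> cball 0 r" using nf by simp
      then show ?thesis using pq by blast
    qed
    then have "f (flip s z) * indicator (cbox p q) (flip s z) * indicator (cbox a b) z
        = indicator (cbox a b) z *\<^sub>R f (flip s z)" for z
      by (auto simp: indicator_def)
    ultimately show ?thesis unfolding set_integrable_def by simp
  qed
  obtain N where N: "negligible N" and *: "\<And>x e. x \<notin> N \<Longrightarrow> 0 < e \<Longrightarrow>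
      \<exists>d>0. \<forall>h. 0 < h \<and> h < d \<longrightarrow>
       norm (integral (cbox x (x + h *\<^sub>R One)) (\<lambda>z. f (flip s z)) /\<^sub>R h ^ DIM('a) - f (flip s x)) < e"
    using integrable_ccontinuous_explicit[of "\<lambda>z. f (flip s z)"] set_lebesgue_integral_eq_integral(1)[OF int] by metis
  have "AE x in lebesgue. x \<notin> N"
    using N negligible_iff_null_sets AE_not_in by blast
  \<comment> \<open>The null set concerns the point \<open>flip s x\<close>; invariance of the
    measure turns it into a null set of points \<open>x\<close>.\<close>
  then have "AE x in distr lebesgue lebesgue (flip s). x \<notin> N"
    unfolding distr_flip[OF s] .
  then have "AE x in lebesgue. flip s x \<notin> N"
    using AE_distrD[OF fs] by blast
  then show ?thesis
  proof eventually_elim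
    case (elim x)
    show ?case
    proof (intro allI impI)
      fix e :: real assume "e > 0"
      from *[OF elim this] obtain d where d: "d > 0" "\<And>h. 0 < h \<Longrightarrow> h < d \<Longrightarrow>
         norm (integral (cbox (flip s x) (flip s x + h *\<^sub>R One)) (\<lambda>z. f (flip s z)) /\<^sub>R h ^ DIM('a) - f x) < e"
        by (auto simp: flip_flip[OF s])
      have "(LINT z|lebesgue. f z * indicator (orthant_box s x h) z) \<le> (f x + e) * h ^ DIM('a)" if h: "0 < h" "h < d" for h
      proof -
        have "(LINT z|lebesgue. f z * indicator (orthant_box s x h) z) = integral (cbox (flip s x) (flip s x + h *\<^sub>R One)) (\<lambda>z. f (flip s z))"
          unfolding integral_orthant_box[OF s fm] set_lebesgue_integral_eq_integral(2)[OF int, symmetric]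
          by (simp add: set_lebesgue_integral_def mult.commute)
        with d(2)[OF h] h show ?thesis by (simp add: abs_less_iff field_simps)
      qed
      then show "\<exists>d>0. \<forall>h. 0 < h \<and> h < d \<longrightarrow> (LINT z|lebesgue. f z * indicator (orthant_box s x h) z) \<le> (f x + e) * h ^ DIM('a)"
        using d(1) by blast
    qed
  qed
qed

text \<open>The exceptional set of the function \<open>\<bar>u z - q\<bar>\<close> depends on
  \<open>q\<close>, so only countably many values can be treated at once. Rational \<open>q\<close>
  suffice, because \<open>u x\<close> is approximated by one of them at the cost of an arbitrarily
  small error.\<close>

theorem AE_lebesgue_point:
  fixes u :: "'a::euclidean_space \<Rightarrow> real"
  assumes u: "integrable lebesgue u"
  shows "AE x in lebesgue. ((\<lambda>r. (LINT z|lebesgue. \<bar>u z - u x\<bar> * indicator (cball x r) z) / r ^ DIM('a)) \<longlongrightarrow> 0) (at_right 0)"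
proof -
  have [measurable]: "u \<in> borel_measurable lebesgue" using u by auto
  have int: "integrable lebesgue (\<lambda>z. \<bar>u z - q\<bar> * indicator S z)"
    if "bounded S" "S \<in> sets lebesgue" for q S
  proof -
    have fm: "S \<in> lmeasurable" using that by (rule bounded_set_imp_lmeasurable)
    show ?thesis
    proof (rule Bochner_Integration.integrable_bound)
      show "integrable lebesgue (\<lambda>z. norm (u z) + \<bar>q\<bar> * indicator S z)"
        using u fm by (auto simp: fmeasurable_def)
      show "AE z in lebesgue. norm (\<bar>u z - q\<bar> * indicator S z) \<le> norm (norm (u z) + \<bar>q\<bar> * indicator S z)"
        by (rule AE_I2) (auto simp: indicator_def)
    qed (use that(2) in measurable)
  qed
  have "AE x in lebesgue. \<forall>q\<in>\<rat>. \<forall>s\<in>signs. \<forall>e>0. \<exists>d>0. \<forall>h. 0 < h \<and> h < d \<longrightarrow>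
    (LINT z|lebesgue. \<bar>u z - q\<bar> * indicator (orthant_box s x h) z) \<le> (\<bar>u x - q\<bar> + e) * h ^ DIM('a)"
    by (intro AE_ball_countable[THEN iffD2] ballI orthant_differentiation int)
       (auto simp: countable_rat finite_signs countable_finite)
  then show ?thesis
  proof eventually_elim
    case (elim x)
    define n where "n = DIM('a)"
    \<comment> \<open>Each box contributes \<open>3 * e * r ^ n\<close>: at most
      \<open>2 * e\<close> from the mean of \<open>\<bar>u z - q\<bar>\<close> and \<open>e\<close>
      from replacing \<open>q\<close> by \<open>u x\<close>. The added 1 makes the final inequality
      strict.\<close>
    define c where "c = (1 + real (card (signs :: ('a \<Rightarrow> real) set))) * 3"
    have cpos: "c > 0" by (simp add: c_def add_pos_nonneg)
    have "\<forall>\<^sub>F r in at_right 0. norm ((LINT z|lebesgue. \<bar>u z - u x\<bar> * indicator (cball x r) z) / r ^ n) < e0"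
      if e0: "e0 > 0" for e0
    proof -
      define e where "e = e0 / c"
      have e: "e > 0" using e0 cpos by (simp add: e_def)
      obtain q where q: "q \<in> \<rat>" "\<bar>u x - q\<bar> < e"
        using Rats_dense_in_real[of "u x - e" "u x + e"] e by (auto simp: abs_less_iff)
      have "\<exists>d. \<forall>s\<in>signs. d s > 0 \<and> (\<forall>h. 0 < h \<and> h < d s \<longrightarrow>
          (LINT z|lebesgue. \<bar>u z - q\<bar> * indicator (orthant_box s x h) z) \<le> (\<bar>u x - q\<bar> + e) * h ^ n)"
        using elim q(1) e unfolding n_def by (intro bchoice) blast
      then obtain d where d: "\<And>s. s \<in> signs \<Longrightarrow> d s > 0" "\<And>s h. s \<in> signs \<Longrightarrow> 0 < h \<Longrightarrow> h < d s \<Longrightarrow>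
          (LINT z|lebesgue. \<bar>u z - q\<bar> * indicator (orthant_box s x h) z) \<le> (\<bar>u x - q\<bar> + e) * h ^ n" by blast
      define d0 where "d0 = Min (insert 1 (d ` signs))"
      have d0: "d0 > 0" "\<And>s. s \<in> signs \<Longrightarrow> d0 \<le> d s"
        using d(1) by (auto simp: d0_def finite_signs)
      have "norm ((LINT z|lebesgue. \<bar>u z - u x\<bar> * indicator (cball x r) z) / r ^ n) < e0"
        if r: "0 < r" "r < d0" for r
      proof -
        have obm: "orthant_box s x r \<in> sets lebesgue" "bounded (orthant_box s x r)" if "s \<in> signs" for s
        proof -
          have ob: "orthant_box s x r = flip s -` cbox (flip s x) (flip s x + r *\<^sub>R One) \<inter> space lebesgue"
            using orthant_box_eq[OF that] by auto
          show "orthant_box s x r \<in> sets lebesgue"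
            unfolding ob by (rule measurable_sets[OF flip_measurable[OF that]]) auto
          have "orthant_box s x r \<subseteq> cbox (x - r *\<^sub>R One) (x + r *\<^sub>R One)"
            using that by (force simp: orthant_box_def mem_box signs_def PiE_iff algebra_simps)
          then show "bounded (orthant_box s x r)" using bounded_cbox bounded_subset by blast
        qed
        have mo: "(LINT z|lebesgue. 1 * indicator (orthant_box s x r) z) = r ^ n" if "s \<in> signs" for s
        proof -
          have "(LINT z|lebesgue. 1 * indicator (orthant_box s x r) z)
             = measure lebesgue (cbox (flip s x) (flip s x + r *\<^sub>R One))"
            by (subst integral_orthant_box[OF that]) auto
          then show ?thesis using r by (simp add: content_cbox_cases algebra_simps n_def)
        qed
        have i1: "integrable lebesgue (\<lambda>z. 1 * indicator (orthant_box s x r) z :: real)" if "s \<in> signs" for s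
          using bounded_set_imp_lmeasurable[OF obm(2,1)[OF that]] by (auto simp: fmeasurable_def)
        have "(LINT z|lebesgue. \<bar>u z - u x\<bar> * indicator (cball x r) z)
           \<le> (LINT z|lebesgue. (\<Sum>s\<in>signs. \<bar>u z - q\<bar> * indicator (orthant_box s x r) z + e * (1 * indicator (orthant_box s x r) z)))"
        proof (rule integral_mono)
          show "integrable lebesgue (\<lambda>z. \<bar>u z - u x\<bar> * indicator (cball x r) z)"
            by (rule int) auto
          show "integrable lebesgue (\<lambda>z. \<Sum>s\<in>signs. \<bar>u z - q\<bar> * indicator (orthant_box s x r) z + e * (1 * indicator (orthant_box s x r) z))"
            using i1 int obm by (intro Bochner_Integration.integrable_sum Bochner_Integration.integrable_add integrable_mult_right) auto
          fix z
          show "\<bar>u z - u x\<bar> * indicator (cball x r) z \<le> (\<Sum>s\<in>signs. \<bar>u z - q\<bar> * indicator (orthant_box s x r) z + e * (1 * indicator (orthant_box s x r) z))"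
          proof (cases "z \<in> cball x r")
            case True
            then obtain s where s: "s \<in> signs" "z \<in> orthant_box s x r"
              using cball_subset_orthant_boxes by blast
            have "\<bar>u z - u x\<bar> * indicator (cball x r) z \<le> \<bar>u z - q\<bar> * indicator (orthant_box s x r) z + e * (1 * indicator (orthant_box s x r) z)"
              using s True q(2) by (auto simp: indicator_def)
            also have "\<dots> \<le> (\<Sum>s\<in>signs. \<bar>u z - q\<bar> * indicator (orthant_box s x r) z + e * (1 * indicator (orthant_box s x r) z))"
              using e s(1) by (intro member_le_sum) (auto simp: finite_signs)
            finally show ?thesis .
          qed (use e in \<open>auto intro!: sum_nonneg\<close>)
        qed
        also have "\<dots> = (\<Sum>s\<in>signs. (LINT z|lebesgue. \<bar>u z - q\<bar> * indicator (orthant_box s x r) z) + e * (LINT z|lebesgue. 1 * indicator (orthant_box s x r) z))"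
          using i1 int obm by (subst Bochner_Integration.integral_sum) (auto intro!: sum.cong)
        also have "\<dots> \<le> (\<Sum>s\<in>(signs :: ('a \<Rightarrow> real) set). (2 * e) * r ^ n + e * r ^ n)"
        proof (rule sum_mono)
          fix s :: "'a \<Rightarrow> real" assume s: "s \<in> signs"
          have "(LINT z|lebesgue. \<bar>u z - q\<bar> * indicator (orthant_box s x r) z) \<le> (\<bar>u x - q\<bar> + e) * r ^ n"
            using d(2)[OF s] r d0(2)[OF s] by simp
          also have "\<dots> \<le> (2 * e) * r ^ n" using q(2) r by (intro mult_right_mono) auto
          finally show "(LINT z|lebesgue. \<bar>u z - q\<bar> * indicator (orthant_box s x r) z) + e * (LINT z|lebesgue. 1 * indicator (orthant_box s x r) z) \<le> (2 * e) * r ^ n + e * r ^ n"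
            unfolding mo[OF s] by simp
        qed
        also have "\<dots> < e0 * r ^ n"
        proof -
          have "(\<Sum>s\<in>(signs :: ('a \<Rightarrow> real) set). (2 * e) * r ^ n + e * r ^ n) = (c - 3) * e * r ^ n"
            by (simp add: c_def algebra_simps)
          also have "\<dots> < c * e * r ^ n" using e r by (simp add: algebra_simps)
          also have "c * e = e0" using cpos by (simp add: e_def)
          finally show ?thesis .
        qed
        finally have "(LINT z|lebesgue. \<bar>u z - u x\<bar> * indicator (cball x r) z) < e0 * r ^ n" .
        moreover have "0 \<le> (LINT z|lebesgue. \<bar>u z - u x\<bar> * indicator (cball x r) z)" by simp
        ultimately show ?thesis using r by (simp add: field_simps)
      qed
      then show ?thesis
        using d0(1) by (auto simp: eventually_at_right_field)
    qed
    then show ?case unfolding tendsto_iff n_def by (simp add: dist_norm)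
  qed
qed

section \<open>Uniqueness of weak gradients\<close>

lemma integrable_lebesgue_on_iff:
  fixes f :: "'a::euclidean_space \<Rightarrow> 'b::{banach, second_countable_topology}"
  assumes "\<Omega> \<in> sets lebesgue"
  shows "integrable (lebesgue_on \<Omega>) f \<longleftrightarrow> integrable lebesgue (\<lambda>x. indicator \<Omega> x *\<^sub>R f x)"
  using assms by (subst integrable_restrict_space) auto

lemma integral_lebesgue_on_eq:
  fixes f :: "'a::euclidean_space \<Rightarrow> 'b::{banach, second_countable_topology}"
  assumes "\<Omega> \<in> sets lebesgue"
  shows "(LINT x|lebesgue_on \<Omega>. f x) = (LINT x|lebesgue. indicator \<Omega> x *\<^sub>R f x)"
  using assms by (subst integral_restrict_space) auto

lemma borel_measurable_lebesgue_on_iff: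
  fixes f :: "'a::euclidean_space \<Rightarrow> 'b::{banach, second_countable_topology}"
  assumes "\<Omega> \<in> sets lebesgue"
  shows "f \<in> borel_measurable (lebesgue_on \<Omega>) \<longleftrightarrow> (\<lambda>x. indicator \<Omega> x *\<^sub>R f x) \<in> borel_measurable lebesgue"
  using assms by (subst borel_measurable_restrict_space_iff) auto

lemma AE_lebesgue_on_iff:
  assumes "\<Omega> \<in> sets lebesgue"
  shows "(AE x in lebesgue_on \<Omega>. P x) \<longleftrightarrow> (AE x in lebesgue. x \<in> \<Omega> \<longrightarrow> P x)"
  using assms by (subst AE_restrict_space_iff) auto

text \<open>An exhaustion by compact sets exhibits \<open>f\<close> on the domain as a pointwise
  limit of integrable functions. For a gradient obtained by choice, local integrability is all that
  is known, and this supplies its measurability.\<close>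

lemma locally_integrable_measurable:
  assumes \<Omega>: "open \<Omega>" and f: "locally_integrable \<Omega> f"
  shows "f \<in> borel_measurable (lebesgue_on \<Omega>)"
proof -
  obtain C where C: "\<And>n. compact (C n)" "\<And>n. C n \<subseteq> \<Omega>" "\<And>n. C n \<subseteq> interior (C (Suc n))" "\<Union>(range C) = \<Omega>"
    by (rule open_Union_compact_subsets[OF \<Omega>]) blast
  have mono: "m \<le> n \<Longrightarrow> C m \<subseteq> C n" for m n
    by (rule lift_Suc_mono_le[of C]) (use C(3) interior_subset in blast)+
  have m: "(\<lambda>x. indicator (C n) x *\<^sub>R f x) \<in> borel_measurable lebesgue" for n
  proof -
    have "C n \<in> sets lebesgue" using lmeasurable_compact[OF C(1)] by (rule fmeasurableD)
    then have "integrable lebesgue (\<lambda>x. indicator (C n) x *\<^sub>R f x)"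
      using f C(1,2)[of n] integrable_lebesgue_on_iff[of "C n" f] by (simp add: locally_integrable_def)
    then show ?thesis by (rule borel_measurable_integrable)
  qed
  have "(\<lambda>x. indicator \<Omega> x *\<^sub>R f x) \<in> borel_measurable lebesgue"
  proof (rule borel_measurable_LIMSEQ_metric[OF m])
    fix x
    show "(\<lambda>n. indicator (C n) x *\<^sub>R f x) \<longlonglongrightarrow> indicator \<Omega> x *\<^sub>R f x"
    proof (cases "x \<in> \<Omega>")
      case True
      then obtain k where "x \<in> C k" using C(4) by blast
      then have "\<forall>n\<ge>k. indicator (C n) x *\<^sub>R f x = indicator \<Omega> x *\<^sub>R f x"
        using mono True by (auto simp: indicator_def)
      then show ?thesis by (intro tendsto_eventually) (auto simp: eventually_sequentially)
    next
      case False
      then have "x \<notin> C n" for n using C(2) by blast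
      with False show ?thesis by simp
    qed
  qed
  then show ?thesis using \<Omega> by (simp add: borel_measurable_lebesgue_on_iff)
qed

lemma integrable_mult_test:
  assumes \<Omega>: "open \<Omega>" and f: "locally_integrable \<Omega> f" and K: "compact K" "K \<subseteq> \<Omega>"
    and \<psi>: "continuous_on UNIV \<psi>" "\<And>x. x \<notin> K \<Longrightarrow> \<psi> x = 0"
  shows "integrable (lebesgue_on \<Omega>) (\<lambda>x. f x * \<psi> x :: real)"
proof -
  have Ks: "K \<in> sets lebesgue" using K(1) by (simp add: lmeasurable_compact fmeasurableD)
  have "bounded (\<psi> ` K)" by (intro compact_imp_bounded compact_continuous_image continuous_on_subset[OF \<psi>(1)] K) auto
  then obtain B where B: "\<And>x. x \<in> K \<Longrightarrow> \<bar>\<psi> x\<bar> \<le> B" by (auto simp: bounded_iff)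
  have int: "integrable lebesgue (\<lambda>x. indicator K x *\<^sub>R f x)"
    using f K integrable_lebesgue_on_iff[OF Ks, of f] by (simp add: locally_integrable_def)
  have "integrable lebesgue (\<lambda>x. indicator \<Omega> x *\<^sub>R (f x * \<psi> x))"
  proof (rule Bochner_Integration.integrable_bound)
    show "integrable lebesgue (\<lambda>x. B * (indicator K x *\<^sub>R f x))" using int by (rule integrable_mult_right)
    have [measurable]: "\<psi> \<in> borel_measurable lebesgue"
      using \<psi>(1) by (intro measurable_completion) (simp add: borel_measurable_continuous_onI)
    have "(\<lambda>x. indicator \<Omega> x *\<^sub>R (f x * \<psi> x)) = (\<lambda>x. (indicator K x *\<^sub>R f x) * \<psi> x)"
      using \<psi>(2) K(2) by (auto simp: fun_eq_iff indicator_def)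
    then show "(\<lambda>x. indicator \<Omega> x *\<^sub>R (f x * \<psi> x)) \<in> borel_measurable lebesgue"
      using borel_measurable_integrable[OF int] by simp
    show "AE x in lebesgue. norm (indicator \<Omega> x *\<^sub>R (f x * \<psi> x)) \<le> norm (B * (indicator K x *\<^sub>R f x))"
    proof (rule AE_I2)
      fix x show "norm (indicator \<Omega> x *\<^sub>R (f x * \<psi> x)) \<le> norm (B * (indicator K x *\<^sub>R f x))"
      proof (cases "x \<in> K")
        case True
        then have "\<bar>\<psi> x\<bar> \<le> \<bar>B\<bar>" using B by force
        then have "\<bar>\<psi> x\<bar> * \<bar>f x\<bar> \<le> \<bar>B\<bar> * \<bar>f x\<bar>" by (rule mult_right_mono) simp
        moreover have "x \<in> \<Omega>" using True K(2) by blast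
        ultimately show ?thesis using True by (simp add: abs_mult mult.commute)
      qed (simp add: \<psi>(2))
    qed
  qed
  then show ?thesis using \<Omega> by (simp add: integrable_lebesgue_on_iff)
qed

text \<open>One compact set serves the function and all its first partial derivatives, since off the
  closed support the function vanishes in a neighbourhood.\<close>

lemma test_function_compact_support:
  assumes "\<psi> \<in> test_functions \<Omega>"
  obtains K where "compact K" "K \<subseteq> \<Omega>" "\<And>x. x \<notin> K \<Longrightarrow> \<psi> x = 0" "\<And>x i. x \<notin> K \<Longrightarrow> partial i \<psi> x = 0"
proof
  let ?K = "closure {x. \<psi> x \<noteq> 0}"
  show "compact ?K" "?K \<subseteq> \<Omega>" using assms by (auto simp: test_functions_def)
  show z: "\<psi> x = 0" if "x \<notin> ?K" for x using that closure_subset[of "{x. \<psi> x \<noteq> 0}"] by auto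
  fix x i assume x: "x \<notin> ?K"
  have "(\<psi> has_derivative (\<lambda>_. 0)) (at x)"
  proof (rule has_derivative_transform_within_open[OF has_derivative_const])
    show "open (- ?K)" "x \<in> - ?K" using x by (simp_all add: open_Compl)
    fix y assume "y \<in> - ?K"
    then show "0 = \<psi> y" using z[of y] by (metis ComplD)
  qed
  from partial_eq[OF this] show "partial i \<psi> x = 0" .
qed

lemma test_function_smooth: "\<psi> \<in> test_functions \<Omega> \<Longrightarrow> smooth \<psi>"
  by (simp add: test_functions_def smooth_def)

lemma integrable_mult_test_function:
  assumes "open \<Omega>" "locally_integrable \<Omega> f" "\<psi> \<in> test_functions \<Omega>"
  shows "integrable (lebesgue_on \<Omega>) (\<lambda>x. f x * \<psi> x :: real)"
    and "integrable (lebesgue_on \<Omega>) (\<lambda>x. f x * partial i \<psi> x :: real)"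
proof -
  obtain K where K: "compact K" "K \<subseteq> \<Omega>" "\<And>x. x \<notin> K \<Longrightarrow> \<psi> x = 0" "\<And>x i. x \<notin> K \<Longrightarrow> partial i \<psi> x = 0"
    using test_function_compact_support[OF assms(3)] by blast
  note sm = test_function_smooth[OF assms(3)]
  show "integrable (lebesgue_on \<Omega>) (\<lambda>x. f x * \<psi> x :: real)"
    by (rule integrable_mult_test[OF assms(1,2) K(1,2) smooth_continuous[OF sm] K(3)])
  show "integrable (lebesgue_on \<Omega>) (\<lambda>x. f x * partial i \<psi> x :: real)"
    by (rule integrable_mult_test[OF assms(1,2) K(1,2) smooth_continuous[OF smooth_partial[OF sm]] K(4)])
qed

text \<open>The value of a bump at distance \<open>r / 2\<close> from its centre is
  \<open>exp (- 4 / 3)\<close>, because \<open>1 / (1 - 1 / 4) = 4 / 3\<close>; the other factor is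
  the volume of a ball of radius \<open>1 / 2\<close>. The type argument carries the
  dimension.\<close>

definition bump_mass :: "'n itself \<Rightarrow> real" where
  "bump_mass _ = exp (- 4 / 3) * (unit_ball_vol (real CARD('n)) * (1 / 2) ^ CARD('n))"

lemma bump_mass_pos: "bump_mass TYPE('n::finite) > 0"
  by (simp add: bump_mass_def)

lemma bump_measurable [measurable]: "bump c r \<in> borel_measurable lebesgue"
  by (intro measurable_completion) (simp add: borel_measurable_continuous_onI smooth_continuous smooth_bump)

lemma integrable_bump:
  assumes "0 < r" shows "integrable lebesgue (bump c r)"
proof (rule Bochner_Integration.integrable_bound)
  show "integrable lebesgue (indicator (cball c r) :: _ \<Rightarrow> real)"
    using lmeasurable_cball[of c r] by (simp add: fmeasurable_def)
  show "AE x in lebesgue. norm (bump c r x) \<le> norm (indicator (cball c r) x :: real)"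
    using bump_eq_0[OF assms, of c] by (intro AE_I2) (auto simp: indicator_def bump_nonneg bump_le)
qed measurable

lemma bump_mass_le:
  fixes c :: "real ^ 'n"
  assumes "0 < r" shows "bump_mass TYPE('n) * r ^ CARD('n) \<le> (LINT z|lebesgue. bump c r z)"
proof -
  have int: "integrable lebesgue (\<lambda>z. exp (- 4 / 3) * indicator (cball c (r / 2)) z :: real)"
    using lmeasurable_cball[of c "r/2"] by (simp add: fmeasurable_def)
  have "bump_mass TYPE('n) * r ^ CARD('n) = (LINT z|lebesgue. exp (- 4 / 3) * indicator (cball c (r / 2)) z)"
    using assms by (simp add: bump_mass_def content_cball power_divide power_one_over field_simps)
  also have "\<dots> \<le> (LINT z|lebesgue. bump c r z)"
  proof (rule integral_mono[OF int integrable_bump[OF assms]])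
    fix z :: "real ^ 'n"
    show "exp (- 4 / 3) * indicator (cball c (r / 2)) z \<le> bump c r z"
    proof (cases "z \<in> cball c (r / 2)")
      case True
      then have "(norm (z - c))\<^sup>2 \<le> (r / 2)\<^sup>2"
        using assms by (intro power_mono) (auto simp: dist_norm norm_minus_commute)
      then have "3 / 4 \<le> 1 - (norm (z - c))\<^sup>2 / r\<^sup>2"
        using assms by (simp add: field_simps power2_eq_square)
      then have "exp (- 1 / (3 / 4)) \<le> bump c r z"
        unfolding bump_def bump_profile_def
        by (auto simp: field_simps)
      then show ?thesis using True by simp
    qed (simp add: bump_nonneg)
  qed
  finally show ?thesis .
qed

text \<open>Freezing \<open>u\<close> at the value \<open>u x\<close> costs at most its oscillation
  on the ball of radius \<open>R\<close>, since the bump is at most 1 and vanishes outside that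
  ball. The centre \<open>c\<close> may differ from \<open>x\<close>: separation by test functions
  uses concentric balls, the star averages use off-centre ones.\<close>

lemma lebesgue_point_bump_le:
  fixes c x :: "real ^ 'n"
  assumes r: "0 < r" and sub: "cball c r \<subseteq> cball x R" and u: "integrable lebesgue u"
  shows "\<bar>u x\<bar> * bump_mass TYPE('n) * r ^ CARD('n) \<le>
    \<bar>LINT z|lebesgue. u z * bump c r z\<bar> + (LINT z|lebesgue. \<bar>u z - u x\<bar> * indicator (cball x R) z)"
proof -
  have um: "u \<in> borel_measurable lebesgue" using u by auto
  have i1: "integrable lebesgue (\<lambda>z. u z * bump c r z)"
    by (rule Bochner_Integration.integrable_bound[OF u])
      (use um in \<open>auto intro!: AE_I2 mult_left_le simp: abs_mult bump_nonneg bump_le\<close>)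
  have i2: "integrable lebesgue (\<lambda>z. u x * bump c r z)" using integrable_bump[OF r, of c] by simp
  have i3: "integrable lebesgue (\<lambda>z. \<bar>u z - u x\<bar> * indicator (cball x R) z)"
  proof (rule Bochner_Integration.integrable_bound)
    show "integrable lebesgue (\<lambda>z. norm (u z) + \<bar>u x\<bar> * indicator (cball x R) z)"
      using u lmeasurable_cball[of x R] by (auto simp: fmeasurable_def)
    show "(\<lambda>z. \<bar>u z - u x\<bar> * indicator (cball x R) z) \<in> borel_measurable lebesgue"
      by (intro borel_measurable_times borel_measurable_indicator borel_measurable_abs borel_measurable_diff um) auto
  qed (auto intro!: AE_I2 simp: indicator_def)
  have "\<bar>u x\<bar> * (LINT z|lebesgue. bump c r z) = \<bar>LINT z|lebesgue. u x * bump c r z\<bar>"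
    by (simp add: abs_mult bump_nonneg integral_nonneg_AE)
  also have "\<dots> = \<bar>(LINT z|lebesgue. u z * bump c r z) - (LINT z|lebesgue. (u z - u x) * bump c r z)\<bar>"
    by (subst Bochner_Integration.integral_diff[symmetric]) (use i1 i2 in \<open>auto simp: algebra_simps\<close>)
  also have "\<dots> \<le> \<bar>LINT z|lebesgue. u z * bump c r z\<bar> + \<bar>LINT z|lebesgue. (u z - u x) * bump c r z\<bar>" by simp
  also have "\<bar>LINT z|lebesgue. (u z - u x) * bump c r z\<bar> \<le> (LINT z|lebesgue. \<bar>u z - u x\<bar> * indicator (cball x R) z)"
  proof (rule order_trans[OF integral_abs_bound integral_mono])
    fix z show "\<bar>(u z - u x) * bump c r z\<bar> \<le> \<bar>u z - u x\<bar> * indicator (cball x R) z" 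
      using bump_nonneg[of c r z] bump_le[of c r z] bump_eq_0[OF r, of c z] sub
      by (cases "z \<in> cball c r") (auto simp: abs_mult mult_left_le indicator_def)
  qed (use i1 i2 i3 in \<open>auto simp: left_diff_distrib\<close>)
  finally show ?thesis
    using mult_left_mono[OF bump_mass_le[OF r, of c], of "\<bar>u x\<bar>"] by (simp add: mult.assoc)
qed

text \<open>At a Lebesgue point a nonzero value of \<open>f\<close> would give shrinking bumps a
  nonzero integral: the mass of the bump is of order \<open>r ^ n\<close>, whereas the oscillation
  is of smaller order.\<close>

theorem test_functions_separate:
  fixes f :: "real ^ 'n \<Rightarrow> real"
  assumes \<Omega>: "open \<Omega>" and f: "locally_integrable \<Omega> f"
    and zero: "\<And>\<psi>. \<psi> \<in> test_functions \<Omega> \<Longrightarrow> (LINT x|lebesgue_on \<Omega>. f x * \<psi> x) = 0"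
  shows "AE x in lebesgue_on \<Omega>. f x = 0"
proof -
  obtain C where C: "\<And>n. compact (C n)" "\<And>n. C n \<subseteq> \<Omega>" "\<And>n. C n \<subseteq> interior (C (Suc n))" "\<Union>(range C) = \<Omega>"
    by (rule open_Union_compact_subsets[OF \<Omega>]) blast
  \<comment> \<open>Lebesgue points are available for functions integrable on the whole space,
    whereas \<open>f\<close> is only locally integrable. Cutting off at a compact set is harmless
    near any point of its interior, and the interiors exhaust the domain.\<close>
  define g where "g k z = indicator (C k) z * f z" for k z
  have g: "integrable lebesgue (g k)" for k
    using f C(1,2)[of k] integrable_lebesgue_on_iff[of "C k" f] lmeasurable_compact[OF C(1)] 
    unfolding locally_integrable_def g_def[abs_def] by (auto simp: fmeasurableD)
  have "AE x in lebesgue. \<forall>k. ((\<lambda>r. (LINT z|lebesgue. \<bar>g k z - g k x\<bar> * indicator (cball x r) z) / r ^ CARD('n)) \<longlongrightarrow> 0) (at_right 0)"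
    using AE_lebesgue_point[OF g] by (subst AE_all_countable) simp
  then have "AE x in lebesgue. x \<in> \<Omega> \<longrightarrow> f x = 0"
  proof eventually_elim
    case (elim x)
    show ?case
    proof
      assume "x \<in> \<Omega>"
      then obtain k where "x \<in> C k" using C(4) by blast
      then have "x \<in> interior (C (Suc k))" using C(3) by blast
      then obtain e where e: "e > 0" "cball x e \<subseteq> C (Suc k)"
        using mem_interior_cball by blast
      have "x \<in> C (Suc k)" using e centre_in_cball[of x e] by auto
      then have gx: "g (Suc k) x = f x" by (simp add: g_def)
      have "\<bar>f x\<bar> * bump_mass TYPE('n) \<le> (LINT z|lebesgue. \<bar>g (Suc k) z - g (Suc k) x\<bar> * indicator (cball x r) z) / r ^ CARD('n)"
        if r: "0 < r" "r < e" for r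
      proof -
        have s: "cball x r \<subseteq> C (Suc k)" using r e by auto
        have "(\<lambda>z. 1 * bump x r z) \<in> test_functions \<Omega>"
          using s C(2) by (intro bump_test_function smooth_const r) blast
        from zero[OF this] have "(LINT z|lebesgue. indicator \<Omega> z *\<^sub>R (f z * bump x r z)) = 0"
          using \<Omega> by (simp add: integral_lebesgue_on_eq)
        also have "(\<lambda>z. indicator \<Omega> z *\<^sub>R (f z * bump x r z)) = (\<lambda>z. g (Suc k) z * bump x r z)"
        proof
          fix z show "indicator \<Omega> z *\<^sub>R (f z * bump x r z) = g (Suc k) z * bump x r z"
            using s C(2)[of "Suc k"] bump_eq_0[OF r(1), of x z]
            by (cases "z \<in> cball x r") (auto simp: g_def indicator_def)
        qed
        finally show ?thesis
          using lebesgue_point_bump_le[OF r(1) subset_refl g, of "Suc k" x] r gx by (simp add: field_simps)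
      qed
      then have "\<forall>\<^sub>F r in at_right 0. \<bar>f x\<bar> * bump_mass TYPE('n) \<le> (LINT z|lebesgue. \<bar>g (Suc k) z - g (Suc k) x\<bar> * indicator (cball x r) z) / r ^ CARD('n)"
        using e(1) by (auto simp: eventually_at_right_field)
      then have "\<bar>f x\<bar> * bump_mass TYPE('n) \<le> 0"
        using elim by (intro tendsto_lowerbound[OF _ _ trivial_limit_at_right_real]) auto
      then show "f x = 0" using bump_mass_pos[where 'n='n] by (simp add: mult_le_0_iff)
    qed
  qed
  then show ?thesis using \<Omega> by (simp add: AE_lebesgue_on_iff)
qed

lemma locally_integrable_component:
  fixes h :: "real ^ 'n \<Rightarrow> real ^ 'm"
  assumes "locally_integrable \<Omega> h"
  shows "locally_integrable \<Omega> (\<lambda>x. h x $ i)"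
  unfolding locally_integrable_def
proof (intro allI impI)
  fix K assume "compact K \<and> K \<subseteq> \<Omega>"
  then have "integrable (lebesgue_on K) h" using assms by (simp add: locally_integrable_def)
  then show "integrable (lebesgue_on K) (\<lambda>x. h x $ i)"
    by (rule integrable_bounded_linear[OF bounded_linear_vec_nth])
qed

lemma locally_integrable_diff:
  assumes "locally_integrable \<Omega> f" "locally_integrable \<Omega> g"
  shows "locally_integrable \<Omega> (\<lambda>x. f x - g x)"
  using assms unfolding locally_integrable_def by (simp add: Bochner_Integration.integrable_diff)

lemma has_weak_gradient_diff:
  assumes \<Omega>: "open \<Omega>" and u: "has_weak_gradient \<Omega> u h" and w: "has_weak_gradient \<Omega> w k"
  shows "has_weak_gradient \<Omega> (\<lambda>x. u x - w x) (\<lambda>x. h x - k x)"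
  unfolding has_weak_gradient_def
proof (intro conjI ballI allI)
  note lu = u[unfolded has_weak_gradient_def] and lw = w[unfolded has_weak_gradient_def]
  show "locally_integrable \<Omega> (\<lambda>x. u x - w x)" "locally_integrable \<Omega> (\<lambda>x. h x - k x)"
    using lu lw by (simp_all add: locally_integrable_diff)
  fix \<psi> i assume \<psi>: "\<psi> \<in> test_functions \<Omega>"
  have li: "locally_integrable \<Omega> (\<lambda>x. h x $ i)" "locally_integrable \<Omega> (\<lambda>x. k x $ i)"
    using lu lw by (simp_all add: locally_integrable_component)
  have "(LINT x|lebesgue_on \<Omega>. (u x - w x) * partial i \<psi> x)
      = (LINT x|lebesgue_on \<Omega>. u x * partial i \<psi> x) - (LINT x|lebesgue_on \<Omega>. w x * partial i \<psi> x)"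
    unfolding left_diff_distrib using lu lw
    by (intro Bochner_Integration.integral_diff integrable_mult_test_function(2)[OF \<Omega> _ \<psi>]) auto
  moreover have "(LINT x|lebesgue_on \<Omega>. (h x - k x) $ i * \<psi> x)
      = (LINT x|lebesgue_on \<Omega>. h x $ i * \<psi> x) - (LINT x|lebesgue_on \<Omega>. k x $ i * \<psi> x)"
    unfolding left_diff_distrib vector_minus_component
    by (intro Bochner_Integration.integral_diff integrable_mult_test_function(1)[OF \<Omega> _ \<psi>] li)
  ultimately show "(LINT x|lebesgue_on \<Omega>. (u x - w x) * partial i \<psi> x)
      = - (LINT x|lebesgue_on \<Omega>. (h x - k x) $ i * \<psi> x)"
    using lu lw \<psi> by simp
qed

text \<open>The difference \<open>h - k\<close> is a weak gradient of zero, so each component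
  integrates to 0 against every test function. This is how properties of some weak gradient pass to
  the chosen representative \<open>grad\<close>.\<close>

theorem has_weak_gradient_unique:
  fixes u :: "real ^ 'n \<Rightarrow> real"
  assumes \<Omega>: "open \<Omega>" and h: "has_weak_gradient \<Omega> u h" and k: "has_weak_gradient \<Omega> u k"
  shows "AE x in lebesgue_on \<Omega>. h x = k x"
proof -
  have d: "has_weak_gradient \<Omega> (\<lambda>x. u x - u x) (\<lambda>x. h x - k x)"
    using has_weak_gradient_diff[OF assms] .
  have "AE x in lebesgue_on \<Omega>. (h x - k x) $ i = 0" for i
  proof (rule test_functions_separate[OF \<Omega>])
    show "locally_integrable \<Omega> (\<lambda>x. (h x - k x) $ i)"
      by (rule locally_integrable_component) (use d in \<open>simp add: has_weak_gradient_def\<close>)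
    show "(LINT x|lebesgue_on \<Omega>. (h x - k x) $ i * \<psi> x) = 0" if "\<psi> \<in> test_functions \<Omega>" for \<psi>
      using d that unfolding has_weak_gradient_def by simp
  qed
  then have "AE x in lebesgue_on \<Omega>. \<forall>i. (h x - k x) $ i = 0"
    by (simp add: AE_all_countable)
  then show ?thesis by eventually_elim (simp add: vec_eq_iff)
qed

section \<open>Averages over shrinking balls in a star-shaped domain\<close>

text \<open>The mean value inequality turns the bound on the derivative into a bound by
  \<open>w\<close> on all difference quotients, so dominated convergence applies along every
  sequence tending to \<open>t0\<close>.\<close>

lemma DERIV_integral_dominated:
  fixes f f' :: "real \<Rightarrow> 'a \<Rightarrow> real"
  assumes t0: "t0 \<in> {l<..<u}"
    and int: "\<And>t. t \<in> {l<..<u} \<Longrightarrow> integrable M (f t)"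
    and deriv: "\<And>t z. t \<in> {l<..<u} \<Longrightarrow> ((\<lambda>t. f t z) has_real_derivative f' t z) (at t)"
    and bound: "\<And>t z. t \<in> {l<..<u} \<Longrightarrow> \<bar>f' t z\<bar> \<le> w z"
    and w: "integrable M w" and meas: "f' t0 \<in> borel_measurable M"
  shows "((\<lambda>t. LINT z|M. f t z) has_real_derivative (LINT z|M. f' t0 z)) (at t0)"
proof -
  have "((\<lambda>t. ((LINT z|M. f t z) - (LINT z|M. f t0 z)) / (t - t0)) \<longlongrightarrow> (LINT z|M. f' t0 z)) (at t0 within {l<..<u})"
    unfolding tendsto_at_iff_sequentially
  proof (intro allI impI)
    fix X assume X: "\<forall>i. X i \<in> {l<..<u} - {t0}" "X \<longlonglongrightarrow> t0"
    have "(\<lambda>i. LINT z|M. (f (X i) z - f t0 z) / (X i - t0)) \<longlonglongrightarrow> (LINT z|M. f' t0 z)"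
    proof (rule integral_dominated_convergence[OF meas _ w])
      show "(\<lambda>z. (f (X i) z - f t0 z) / (X i - t0)) \<in> borel_measurable M" for i
        using int[of "X i"] int[OF t0] X(1) by auto
      show "AE z in M. (\<lambda>i. (f (X i) z - f t0 z) / (X i - t0)) \<longlonglongrightarrow> f' t0 z"
      proof (rule AE_I2)
        fix z
        have "((\<lambda>t. (f t z - f t0 z) / (t - t0)) \<longlongrightarrow> f' t0 z) (at t0)"
          using deriv[OF t0, of z] by (simp add: has_field_derivative_iff)
        then show "(\<lambda>i. (f (X i) z - f t0 z) / (X i - t0)) \<longlonglongrightarrow> f' t0 z"
          using X unfolding tendsto_at_iff_sequentially by (auto simp: comp_def)
      qed
      show "AE z in M. norm ((f (X i) z - f t0 z) / (X i - t0)) \<le> w z" for i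
      proof (rule AE_I2)
        fix z
        have "norm (f (X i) z - f t0 z) \<le> w z * norm (X i - t0)"
        proof (rule field_differentiable_bound[of "{l<..<u}"])
          show "((\<lambda>t. f t z) has_field_derivative f' t z) (at t within {l<..<u})" if "t \<in> {l<..<u}" for t
            using deriv[OF that] has_field_derivative_at_within by blast
        qed (use X t0 bound in auto)
        then show "norm ((f (X i) z - f t0 z) / (X i - t0)) \<le> w z"
          using X(1) by (simp add: field_simps)
      qed
    qed
    moreover have eq: "(LINT z|M. (f (X i) z - f t0 z) / (X i - t0)) = ((LINT z|M. f (X i) z) - (LINT z|M. f t0 z)) / (X i - t0)" for i
      using int[OF t0] int[of "X i"] X(1) by simp
    ultimately show "((\<lambda>t. ((LINT z|M. f t z) - (LINT z|M. f t0 z)) / (t - t0)) \<circ> X) \<longlonglongrightarrow> (LINT z|M. f' t0 z)"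
      unfolding comp_def by (simp only: eq)
  qed
  then show ?thesis
    using t0 at_within_open[of t0 "{l<..<u}"] by (simp add: has_field_derivative_iff)
qed

text \<open>The derivative of \<open>bump_profile 0\<close> at the radial argument of
  \<open>bump\<close>, which the chain rule leaves as a factor. The bound 2 below is
  \<open>fact 2\<close>.\<close>

definition bump_slope :: "real ^ 'n \<Rightarrow> real \<Rightarrow> real ^ 'n \<Rightarrow> real" where
  "bump_slope c r z = bump_profile 2 (1 - (norm (z - c))\<^sup>2 / r\<^sup>2)"

lemma smooth_bump_slope: "smooth (bump_slope c r)"
  using smooth_bump_profile[OF smooth_norm_square] unfolding bump_slope_def[abs_def] .

lemma bump_slope_nonneg: "0 \<le> bump_slope c r z" and bump_slope_le: "bump_slope c r z \<le> 2"
  using bump_profile_nonneg bump_profile_le[of 2] by (auto simp: bump_slope_def)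

lemma bump_slope_eq_0: "0 < r \<Longrightarrow> r \<le> dist c z \<Longrightarrow> bump_slope c r z = 0"
  unfolding bump_slope_def by (rule bump_profile_eq_0)

text \<open>The weight of \<open>u\<close> on the left is the divergence of the test field \<open>(z - x) * bump c r z\<close>.\<close>
lemma weak_gradient_radial_bump:
  fixes u :: "real ^ 'n \<Rightarrow> real"
  assumes \<Omega>: "open \<Omega>" and u: "has_weak_gradient \<Omega> u h" and r: "0 < r" and sub: "cball c r \<subseteq> \<Omega>"
  shows "(LINT z|lebesgue_on \<Omega>. u z * (real CARD('n) * bump c r z - 2 * ((z - x) \<bullet> (z - c)) / r\<^sup>2 * bump_slope c r z))
    = - (LINT z|lebesgue_on \<Omega>. (h z \<bullet> (z - x)) * bump c r z)"
proof -
  define Y where "Y i z = (z $ i + - (x $ i)) * bump c r z" for i z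
  have sm: "smooth (\<lambda>z. z $ i + - (x $ i))" for i
    by (intro smooth_add smooth_coord smooth_const)
  have Y: "Y i \<in> test_functions \<Omega>" for i
    unfolding Y_def[abs_def] by (rule bump_test_function[OF r sub sm])
  have lu: "locally_integrable \<Omega> u" and lh: "locally_integrable \<Omega> (\<lambda>z. h z $ i)" for i
    using u by (auto simp: has_weak_gradient_def intro: locally_integrable_component)
  have pY: "partial i (Y i) z = bump c r z - 2 * ((z - x) $ i * (z - c) $ i) / r\<^sup>2 * bump_slope c r z" for i z
  proof -
    have "partial i (\<lambda>z. z $ i + - (x $ i)) z = 1"
      by (subst partial_add) (auto simp: differentiable_coord partial_coord)
    then show ?thesis
      unfolding Y_def[abs_def] partial_mult[OF smooth_differentiable[OF sm] smooth_differentiable[OF smooth_bump]]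
      by (simp add: partial_bump bump_slope_def divide_inverse algebra_simps)
  qed
  have "(LINT z|lebesgue_on \<Omega>. u z * (real CARD('n) * bump c r z - 2 * ((z - x) \<bullet> (z - c)) / r\<^sup>2 * bump_slope c r z))
     = (LINT z|lebesgue_on \<Omega>. (\<Sum>i\<in>UNIV. u z * partial i (Y i) z))"
  proof -
    have "(\<Sum>i\<in>UNIV. partial i (Y i) z) = real CARD('n) * bump c r z - 2 * ((z - x) \<bullet> (z - c)) / r\<^sup>2 * bump_slope c r z" for z
      unfolding pY sum_subtractf inner_vec_def sum_distrib_left sum_divide_distrib sum_distrib_right by simp
    then show ?thesis by (simp only: sum_distrib_left[symmetric])
  qed
  also have "\<dots> = (\<Sum>i\<in>UNIV. (LINT z|lebesgue_on \<Omega>. u z * partial i (Y i) z))"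
    by (intro Bochner_Integration.integral_sum integrable_mult_test_function(2)[OF \<Omega> lu Y])
  also have "\<dots> = (\<Sum>i\<in>UNIV. - (LINT z|lebesgue_on \<Omega>. h z $ i * Y i z))"
    using u Y unfolding has_weak_gradient_def by (intro sum.cong refl) blast
  also have "\<dots> = - (LINT z|lebesgue_on \<Omega>. (\<Sum>i\<in>UNIV. h z $ i * Y i z))"
    unfolding sum_negf
    by (subst Bochner_Integration.integral_sum) (auto intro!: integrable_mult_test_function(1)[OF \<Omega> lh Y])
  also have "(\<lambda>z. (\<Sum>i\<in>UNIV. h z $ i * Y i z)) = (\<lambda>z. (h z \<bullet> (z - x)) * bump c r z)"
    by (simp add: Y_def inner_vec_def sum_distrib_left mult_ac)
  finally show ?thesis .
qed

text \<open>
  The point \<open>x + t (z0 - x)\<close> is the image of \<open>z0\<close> under the contraction to \<open>x\<close>. Up to the factor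
  \<open>- 1 / t ^ (n + 1)\<close>, the derivative is the divergence in \<open>weak_gradient_radial_bump\<close>.
\<close>
lemma star_kernel_has_derivative:
  fixes x z0 z :: "real ^ 'n"
  assumes t: "t > 0" and \<rho>: "\<rho> > 0"
  defines "c \<equiv> \<lambda>t. x + t *\<^sub>R (z0 - x)"
  shows "((\<lambda>t. bump (c t) (t * \<rho>) z / t ^ n) has_real_derivative
    - (real n * bump (c t) (t * \<rho>) z - 2 * ((z - x) \<bullet> (z - c t)) / (t * \<rho>)\<^sup>2 * bump_slope (c t) (t * \<rho>) z) / t ^ Suc n) (at t)"
proof -
  define q where "q t = 1 - (norm (z - c t))\<^sup>2 / (t * \<rho>)\<^sup>2" for t
  \<comment> \<open>Expanded in powers of \<open>s\<close>, the squared distance can be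
    differentiated. After division by \<open>(s * \<rho>)^2\<close> its quadratic term is constant,
    and what remains of the derivative is recognised through \<open>e2\<close>.\<close>
  have e1: "((z - c s) \<bullet> (z - c s)) = (z - x) \<bullet> (z - x) - 2 * s * ((z - x) \<bullet> (z0 - x)) + s\<^sup>2 * ((z0 - x) \<bullet> (z0 - x))" for s
  proof -
    have "(p - s *\<^sub>R d) \<bullet> (p - s *\<^sub>R d) = p \<bullet> p - 2 * s * (p \<bullet> d) + s\<^sup>2 * (d \<bullet> d)" for p d :: "real ^ 'n"
      by (simp add: inner_diff_left inner_diff_right inner_commute power2_eq_square algebra_simps)
    moreover have "z - c s = (z - x) - s *\<^sub>R (z0 - x)" by (simp add: c_def algebra_simps)
    ultimately show ?thesis by (simp only:)
  qed
  have e2: "(z - x) \<bullet> (z - c t) = (z - x) \<bullet> (z - x) - t * ((z - x) \<bullet> (z0 - x))"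
  proof -
    have "z - c t = (z - x) - t *\<^sub>R (z0 - x)" by (simp add: c_def algebra_simps)
    then show ?thesis by (simp only: inner_diff_right[of "z - x" "z - x"] inner_scaleR_right)
  qed
  have "(q has_real_derivative 2 * ((z - x) \<bullet> (z - c t)) / (t * \<rho>)\<^sup>2 / t) (at t)"
    unfolding q_def[abs_def] power2_norm_eq_inner e1 e2
    using t \<rho> by (auto intro!: derivative_eq_intros simp: field_simps power2_eq_square)
  from DERIV_chain2[OF bump_profile_deriv this, of 0]
  have b: "((\<lambda>t. bump (c t) (t * \<rho>) z) has_real_derivative
     bump_slope (c t) (t * \<rho>) z * (2 * ((z - x) \<bullet> (z - c t)) / (t * \<rho>)\<^sup>2 / t)) (at t)"
    by (simp add: bump_def bump_slope_def q_def numeral_2_eq_2)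
  have p: "((\<lambda>t. t ^ n) has_real_derivative real n * t ^ n / t) (at t)"
    using DERIV_pow[of n t] t by (cases n) auto
  show ?thesis
    by (rule DERIV_cong[OF DERIV_divide[OF b p]]) (use t in \<open>auto simp: divide_simps\<close>, auto simp: algebra_simps)
qed

text \<open>On the support of the bump both \<open>norm (z - c t)\<close> and
  \<open>norm (z - x)\<close> are of order \<open>t\<close>, so the quotient by
  \<open>(t * \<rho>)^2\<close> is free of \<open>t\<close>. The 4 is the factor 2 of the kernel
  times the bound 2 on \<open>bump_slope\<close>. The result is the constant that dominates the
  derivative under the integral.\<close>

lemma star_kernel_derivative_bound:
  fixes x z0 z :: "real ^ 'n"
  assumes t: "l \<le> t" and l: "0 < l" and \<rho>: "\<rho> > 0"
  defines "c \<equiv> \<lambda>t. x + t *\<^sub>R (z0 - x)"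
  shows "\<bar>- (real n * bump (c t) (t * \<rho>) z - 2 * ((z - x) \<bullet> (z - c t)) / (t * \<rho>)\<^sup>2 * bump_slope (c t) (t * \<rho>) z) / t ^ Suc n\<bar>
    \<le> (real n + 4 * (\<rho> + norm (z0 - x)) / \<rho>) / l ^ Suc n"
proof -
  have tp: "t > 0" using t l by simp
  have A: "\<bar>2 * ((z - x) \<bullet> (z - c t)) / (t * \<rho>)\<^sup>2 * bump_slope (c t) (t * \<rho>) z\<bar> \<le> 4 * (\<rho> + norm (z0 - x)) / \<rho>"
  proof (cases "dist (c t) z < t * \<rho>")
    case True
    then have zc: "norm (z - c t) \<le> t * \<rho>" by (simp add: dist_norm norm_minus_commute)
    have "norm (z - x) \<le> norm (z - c t) + norm (t *\<^sub>R (z0 - x))"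
      using norm_triangle_ineq[of "z - c t" "t *\<^sub>R (z0 - x)"] by (simp add: c_def)
    also have "\<dots> \<le> t * (\<rho> + norm (z0 - x))" using zc tp by (simp add: distrib_left)
    finally have zx: "norm (z - x) \<le> t * (\<rho> + norm (z0 - x))" .
    have "\<bar>(z - x) \<bullet> (z - c t)\<bar> \<le> norm (z - x) * norm (z - c t)" by (rule Cauchy_Schwarz_ineq2)
    also have "\<dots> \<le> (t * (\<rho> + norm (z0 - x))) * (t * \<rho>)"
      using zx zc tp \<rho> by (intro mult_mono) auto
    finally have B: "\<bar>(z - x) \<bullet> (z - c t)\<bar> \<le> (t * (\<rho> + norm (z0 - x))) * (t * \<rho>)" .
    have "\<bar>2 * ((z - x) \<bullet> (z - c t)) / (t * \<rho>)\<^sup>2 * bump_slope (c t) (t * \<rho>) z\<bar>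
       = 2 * \<bar>(z - x) \<bullet> (z - c t)\<bar> / (t * \<rho>)\<^sup>2 * bump_slope (c t) (t * \<rho>) z"
      by (simp add: abs_mult bump_slope_nonneg)
    also have "\<dots> \<le> 2 * ((t * (\<rho> + norm (z0 - x))) * (t * \<rho>)) / (t * \<rho>)\<^sup>2 * 2"
      using B tp \<rho> by (intro mult_mono divide_right_mono mult_left_mono) (auto simp: bump_slope_nonneg bump_slope_le)
    also have "\<dots> = 4 * (\<rho> + norm (z0 - x)) / \<rho>" using tp \<rho> by (simp add: power2_eq_square)
    finally show ?thesis .
  next
    case False
    then have "bump_slope (c t) (t * \<rho>) z = 0" using tp \<rho> by (intro bump_slope_eq_0) auto
    then show ?thesis using \<rho> by (simp add: add_nonneg_nonneg)
  qed
  have "\<bar>real n * bump (c t) (t * \<rho>) z\<bar> \<le> real n"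
    by (simp add: abs_mult bump_nonneg bump_le mult_left_le)
  then have "\<bar>real n * bump (c t) (t * \<rho>) z - 2 * ((z - x) \<bullet> (z - c t)) / (t * \<rho>)\<^sup>2 * bump_slope (c t) (t * \<rho>) z\<bar> \<le> real n + 4 * (\<rho> + norm (z0 - x)) / \<rho>"
    using A by linarith
  then have "\<bar>real n * bump (c t) (t * \<rho>) z - 2 * ((z - x) \<bullet> (z - c t)) / (t * \<rho>)\<^sup>2 * bump_slope (c t) (t * \<rho>) z\<bar> / t ^ Suc n
     \<le> (real n + 4 * (\<rho> + norm (z0 - x)) / \<rho>) / l ^ Suc n"
    using t l \<rho> by (intro frac_le power_mono zero_less_power) auto
  then show ?thesis using tp by (simp only: abs_divide abs_minus_cancel power_abs abs_of_pos)
qed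

text \<open>Division by \<open>t ^ CARD('n)\<close> compensates the shrinking of the ball, so the
  total weight does not depend on \<open>t\<close> as long as the ball stays in the domain. The
  weight is not normalised to 1, which is why a multiple of \<open>u x\<close> appears in the
  limit.\<close>

definition star_average :: "(real ^ 'n) set \<Rightarrow> (real ^ 'n \<Rightarrow> real) \<Rightarrow> real ^ 'n \<Rightarrow> real \<Rightarrow> real ^ 'n \<Rightarrow> real \<Rightarrow> real" where
  "star_average \<Omega> u z0 \<rho> x t =
    (LINT z|lebesgue_on \<Omega>. u z * (bump (x + t *\<^sub>R (z0 - x)) (t * \<rho>) z / t ^ CARD('n)))"

lemma smooth_measurable: "smooth f \<Longrightarrow> \<Omega> \<in> sets lebesgue \<Longrightarrow> f \<in> borel_measurable (lebesgue_on \<Omega>)"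
  by (intro continuous_imp_measurable_on_sets_lebesgue smooth_continuous)

lemma integrable_mult_bounded:
  fixes f g :: "'a \<Rightarrow> real"
  assumes "integrable M f" "g \<in> borel_measurable M" "\<And>z. \<bar>g z\<bar> \<le> B"
  shows "integrable M (\<lambda>z. f z * g z)"
proof (rule Bochner_Integration.integrable_bound)
  show "integrable M (\<lambda>z. B * f z)" using assms(1) by simp
  show "(\<lambda>z. f z * g z) \<in> borel_measurable M" using assms(1,2) by auto
  show "AE z in M. norm (f z * g z) \<le> norm (B * f z)"
  proof (rule AE_I2)
    fix z
    have "\<bar>g z\<bar> \<le> \<bar>B\<bar>" using assms(3)[of z] by linarith
    from mult_left_mono[OF this, of "\<bar>f z\<bar>"] show "norm (f z * g z) \<le> norm (B * f z)"
      by (simp add: abs_mult mult.commute)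
  qed
qed

text \<open>By the mean value theorem the difference is \<open>s\<close> times the derivative at
  some intermediate parameter. There the divergence structure of the kernel moves the derivative
  onto \<open>u\<close>, leaving only \<open>h\<close> on a ball around \<open>x\<close>.\<close>

lemma star_average_diff_le:
  fixes u :: "real ^ 'n \<Rightarrow> real"
  assumes \<Omega>: "open \<Omega>" and u: "has_weak_gradient \<Omega> u h"
    and ui: "integrable (lebesgue_on \<Omega>) u" and hi: "integrable (lebesgue_on \<Omega>) h"
    and T: "convex T" "x \<in> T" "cball z0 \<rho> \<subseteq> interior T" "interior T \<subseteq> \<Omega>" and \<rho>: "\<rho> > 0"
    and s: "0 < s" "s \<le> 1 / 2" and L: "\<rho> + norm (z0 - x) \<le> L"
  shows "\<bar>star_average \<Omega> u z0 \<rho> x (2 * s) - star_average \<Omega> u z0 \<rho> x s\<bar>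
    \<le> s / s ^ CARD('n) * L * (LINT z|lebesgue_on \<Omega>. norm (h z) * indicator (cball x (2 * s * L)) z)"
proof -
  define n where "n = CARD('n)"
  define c where "c t = x + t *\<^sub>R (z0 - x)" for t
  define D where "D t z = - (real n * bump (c t) (t * \<rho>) z - 2 * ((z - x) \<bullet> (z - c t)) / (t * \<rho>)\<^sup>2 * bump_slope (c t) (t * \<rho>) z) / t ^ Suc n" for t z
  \<comment> \<open>The bound for parameters above \<open>s / 2\<close>: the derivative is needed on
    an open interval around \<open>[s, 2 * s]\<close>, and \<open>{s/2<..<3}\<close> is one because
    \<open>2 * s \<le> 1\<close>.\<close>
  define B where "B = (real n + 4 * (\<rho> + norm (z0 - x)) / \<rho>) / (s / 2) ^ Suc n"
  have \<Omega>s: "\<Omega> \<in> sets lebesgue" using \<Omega> by simp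
  have Dm: "D t \<in> borel_measurable (lebesgue_on \<Omega>)" for t
  proof -
    have "continuous_on UNIV (D t)" 
      unfolding D_def[abs_def] divide_inverse
      by (intro continuous_intros smooth_continuous smooth_bump smooth_bump_slope)
    then show ?thesis by (intro continuous_imp_measurable_on_sets_lebesgue \<Omega>s) (auto intro: continuous_on_subset)
  qed
  have Db: "\<bar>D t z\<bar> \<le> B" if "t \<in> {s/2<..<3}" for t z
    using star_kernel_derivative_bound[of "s/2" t \<rho> n x z0 z] that s(1) \<rho>
    by (simp add: D_def B_def c_def)
  have deriv: "((\<lambda>t. star_average \<Omega> u z0 \<rho> x t) has_real_derivative (LINT z|lebesgue_on \<Omega>. u z * D t z)) (at t)"
    if t: "t \<in> {s/2<..<3}" for t
    unfolding star_average_def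
  proof (rule DERIV_integral_dominated[OF t, of _ _ _ "\<lambda>z. \<bar>u z\<bar> * B"])
    fix t assume t: "t \<in> {s/2<..<3}"
    then have tp: "t > 0" using s(1) by auto
    have "\<bar>bump (x + t *\<^sub>R (z0 - x)) (t * \<rho>) z / t ^ CARD('n)\<bar> \<le> 1 / t ^ CARD('n)" for z
      using tp by (simp add: bump_nonneg bump_le divide_right_mono)
    then show "integrable (lebesgue_on \<Omega>) (\<lambda>z. u z * (bump (x + t *\<^sub>R (z0 - x)) (t * \<rho>) z / t ^ CARD('n)))"
      using smooth_measurable[OF smooth_bump \<Omega>s] by (intro integrable_mult_bounded[OF ui]) auto
    show "((\<lambda>t. u z * (bump (x + t *\<^sub>R (z0 - x)) (t * \<rho>) z / t ^ CARD('n))) has_real_derivative u z * D t z) (at t)" for z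
      using DERIV_cmult[OF star_kernel_has_derivative[OF tp \<rho>, of x z0 z n], of "u z"]
      unfolding D_def c_def n_def .
    show "\<bar>u z * D t z\<bar> \<le> \<bar>u z\<bar> * B" for z
      using Db[OF t, of z] by (simp add: abs_mult mult_left_mono)
  qed (use ui Dm in auto)
  have "\<exists>\<xi>. s < \<xi> \<and> \<xi> < 2 * s \<and> star_average \<Omega> u z0 \<rho> x (2 * s) - star_average \<Omega> u z0 \<rho> x s
      = (2 * s - s) * (LINT z|lebesgue_on \<Omega>. u z * D \<xi> z)"
    using s by (intro MVT2 deriv) auto
  then obtain \<xi> where \<xi>: "s < \<xi>" "\<xi> < 2 * s" "star_average \<Omega> u z0 \<rho> x (2 * s) - star_average \<Omega> u z0 \<rho> x s
      = s * (LINT z|lebesgue_on \<Omega>. u z * D \<xi> z)" by auto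
  have \<xi>p: "0 < \<xi>" "\<xi> \<le> 1" using \<xi> s by auto
  \<comment> \<open>Star-shapedness enters here: every point of the contracted ball is the
    contraction of some \<open>v\<close> in the reference ball, and moving an interior point of a
    convex set towards a point of that set stays in the interior.\<close>
  have sub: "cball (c \<xi>) (\<xi> * \<rho>) \<subseteq> \<Omega>"
  proof
    fix y assume y: "y \<in> cball (c \<xi>) (\<xi> * \<rho>)"
    define v where "v = z0 + (1 / \<xi>) *\<^sub>R (y - c \<xi>)"
    have "norm ((1 / \<xi>) *\<^sub>R (y - c \<xi>)) \<le> \<rho>"
      using y \<xi>p unfolding norm_scaleR by (simp add: dist_norm norm_minus_commute divide_le_eq mult.commute)
    then have "v \<in> cball z0 \<rho>" unfolding v_def by (simp add: dist_norm)
    then have "v \<in> interior T" using T(3) by blast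
    from mem_interior_convex_shrink[OF T(1) this T(2) \<xi>p]
    have "x - \<xi> *\<^sub>R (x - v) \<in> \<Omega>" using T(4) by blast
    also have "x - \<xi> *\<^sub>R (x - v) = y"
      using \<xi>p by (simp add: v_def c_def algebra_simps)
    finally show "y \<in> \<Omega>" .
  qed
  have bx: "norm (z - x) \<le> \<xi> * L \<and> z \<in> cball x (2 * s * L)" if "bump (c \<xi>) (\<xi> * \<rho>) z \<noteq> 0" for z
  proof -
    have "dist (c \<xi>) z < \<xi> * \<rho>" using bump_eq_0[of "\<xi> * \<rho>" "c \<xi>" z] that \<xi>p \<rho> by force
    then have zc: "norm (z - c \<xi>) \<le> \<xi> * \<rho>" by (simp add: dist_norm norm_minus_commute)
    have "norm (z - x) \<le> norm (z - c \<xi>) + norm (\<xi> *\<^sub>R (z0 - x))"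
      using norm_triangle_ineq[of "z - c \<xi>" "\<xi> *\<^sub>R (z0 - x)"] by (simp add: c_def)
    also have "\<dots> \<le> \<xi> * (\<rho> + norm (z0 - x))" using zc \<xi>p by (simp add: distrib_left)
    also have "\<dots> \<le> \<xi> * L" using L \<xi>p by (intro mult_left_mono) auto
    finally have 1: "norm (z - x) \<le> \<xi> * L" .
    also have "\<dots> \<le> 2 * s * L" using L \<rho> \<xi>(2) by (intro mult_right_mono) (auto intro: order_trans[OF _ L])
    finally show ?thesis using 1 by (simp add: dist_norm norm_minus_commute)
  qed
  have "(LINT z|lebesgue_on \<Omega>. u z * D \<xi> z) = (LINT z|lebesgue_on \<Omega>. u z * (real CARD('n) * bump (c \<xi>) (\<xi> * \<rho>) z - 2 * ((z - x) \<bullet> (z - c \<xi>)) / (\<xi> * \<rho>)\<^sup>2 * bump_slope (c \<xi>) (\<xi> * \<rho>) z) * (- 1 / \<xi> ^ Suc n))"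
  proof -
    have "a * (- N / P) = a * N * (- 1 / P)" for a N P :: real by simp
    then show ?thesis unfolding D_def n_def by (simp only:)
  qed
  also have "\<dots> = (LINT z|lebesgue_on \<Omega>. u z * (real CARD('n) * bump (c \<xi>) (\<xi> * \<rho>) z - 2 * ((z - x) \<bullet> (z - c \<xi>)) / (\<xi> * \<rho>)\<^sup>2 * bump_slope (c \<xi>) (\<xi> * \<rho>) z)) * (- 1 / \<xi> ^ Suc n)"
    by (rule integral_mult_left_zero)
  also have "\<dots> = (LINT z|lebesgue_on \<Omega>. (h z \<bullet> (z - x)) * bump (c \<xi>) (\<xi> * \<rho>) z) / \<xi> ^ Suc n"
    using \<xi>p \<rho> by (subst weak_gradient_radial_bump[OF \<Omega> u _ sub]) auto
  finally have "\<bar>LINT z|lebesgue_on \<Omega>. u z * D \<xi> z\<bar> = \<bar>LINT z|lebesgue_on \<Omega>. (h z \<bullet> (z - x)) * bump (c \<xi>) (\<xi> * \<rho>) z\<bar> / \<xi> ^ Suc n"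
    using \<xi>p by simp
  also have "\<dots> \<le> (LINT z|lebesgue_on \<Omega>. (\<xi> * L) * (norm (h z) * indicator (cball x (2 * s * L)) z)) / \<xi> ^ Suc n"
  proof (rule divide_right_mono)
    have hm: "h \<in> borel_measurable (lebesgue_on \<Omega>)" using hi by auto
    have cm: "indicator (cball x (2 * s * L)) \<in> borel_measurable (lebesgue_on \<Omega>)"
      by (intro measurable_restrict_space1 borel_measurable_indicator) auto
    have i2: "integrable (lebesgue_on \<Omega>) (\<lambda>z. (\<xi> * L) * (norm (h z) * indicator (cball x (2 * s * L)) z))"
      by (intro integrable_mult_right, rule integrable_mult_bounded[OF integrable_norm[OF hi] cm, where B = 1])
        (simp add: indicator_def)
    have pw: "\<bar>(h z \<bullet> (z - x)) * bump (c \<xi>) (\<xi> * \<rho>) z\<bar> \<le> (\<xi> * L) * (norm (h z) * indicator (cball x (2 * s * L)) z)" for z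
    proof (cases "bump (c \<xi>) (\<xi> * \<rho>) z = 0")
      case True
      have "0 \<le> L" using L \<rho> norm_ge_zero[of "z0 - x"] by linarith
      then show ?thesis using True \<xi>p by simp
    next
      case False
      have "\<bar>(h z \<bullet> (z - x)) * bump (c \<xi>) (\<xi> * \<rho>) z\<bar> \<le> \<bar>h z \<bullet> (z - x)\<bar>"
        by (simp add: abs_mult bump_nonneg bump_le mult_left_le)
      also have "\<dots> \<le> norm (h z) * norm (z - x)" by (rule Cauchy_Schwarz_ineq2)
      also have "\<dots> \<le> norm (h z) * (\<xi> * L)" using bx[OF False] by (intro mult_left_mono) auto
      finally show ?thesis using bx[OF False] by (simp add: mult_ac)
    qed
    have i1: "integrable (lebesgue_on \<Omega>) (\<lambda>z. (h z \<bullet> (z - x)) * bump (c \<xi>) (\<xi> * \<rho>) z)"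
    proof (rule Bochner_Integration.integrable_bound[OF i2])
      have "(\<lambda>z. z - x) \<in> borel_measurable (lebesgue_on \<Omega>)"
        by (intro continuous_imp_measurable_on_sets_lebesgue \<Omega>s continuous_intros)
      then show "(\<lambda>z. (h z \<bullet> (z - x)) * bump (c \<xi>) (\<xi> * \<rho>) z) \<in> borel_measurable (lebesgue_on \<Omega>)"
        using hm smooth_measurable[OF smooth_bump \<Omega>s] by (intro borel_measurable_times borel_measurable_inner) 
    qed (use pw in \<open>auto intro!: AE_I2 order_trans[OF pw]\<close>)
    show "\<bar>LINT z|lebesgue_on \<Omega>. (h z \<bullet> (z - x)) * bump (c \<xi>) (\<xi> * \<rho>) z\<bar> \<le> (LINT z|lebesgue_on \<Omega>. (\<xi> * L) * (norm (h z) * indicator (cball x (2 * s * L)) z))"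
      by (rule order_trans[OF integral_abs_bound integral_mono[OF _ i2]]) (use i1 pw in auto)
  qed (use \<xi>p in simp)
  \<comment> \<open>The factor \<open>\<xi>\<close> gained from
    \<open>norm (z - x) \<le> \<xi> * L\<close> cancels one of the \<open>n + 1\<close> powers in
    the kernel; the remaining ones are then estimated by \<open>s < \<xi>\<close>.\<close>
  also have "\<dots> = L * (LINT z|lebesgue_on \<Omega>. norm (h z) * indicator (cball x (2 * s * L)) z) / \<xi> ^ n"
    using \<xi>p by simp
  also have "\<dots> \<le> L * (LINT z|lebesgue_on \<Omega>. norm (h z) * indicator (cball x (2 * s * L)) z) / s ^ n"
  proof (rule divide_left_mono)
    have "0 \<le> L" using L \<rho> norm_ge_zero[of "z0 - x"] by linarith
    then show "0 \<le> L * (LINT z|lebesgue_on \<Omega>. norm (h z) * indicator (cball x (2 * s * L)) z)" by simp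
  qed (use \<xi> s in \<open>auto intro!: power_mono\<close>)
  finally have "\<bar>LINT z|lebesgue_on \<Omega>. u z * D \<xi> z\<bar> \<le> L * (LINT z|lebesgue_on \<Omega>. norm (h z) * indicator (cball x (2 * s * L)) z) / s ^ n" .
  from mult_left_mono[OF this, of s] show ?thesis
    unfolding \<xi>(3) n_def using s by (simp add: abs_mult mult_ac)
qed

lemma star_average_1:
  "star_average \<Omega> u z0 \<rho> x 1 = (LINT z|lebesgue_on \<Omega>. u z * bump z0 \<rho> z)"
  by (simp add: star_average_def)

section \<open>The Sobolev embedding\<close>

text \<open>The induction carries the closed form of the partial geometric sum; bounding it by the
  full sum at the end makes the estimate uniform in \<open>k\<close>.\<close>

lemma geometric_increments_bound:
  fixes a :: "nat \<Rightarrow> real"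
  assumes "\<And>k. \<bar>a k - a (Suc k)\<bar> \<le> D * \<gamma> ^ k" "0 < \<gamma>" "\<gamma> < 1" "0 \<le> D"
  shows "\<bar>a k\<bar> \<le> \<bar>a 0\<bar> + D / (1 - \<gamma>)"
proof -
  have "\<bar>a k - a 0\<bar> \<le> D * ((1 - \<gamma> ^ k) / (1 - \<gamma>))"
  proof (induction k)
    case (Suc k)
    have "\<bar>a (Suc k) - a 0\<bar> \<le> D * ((1 - \<gamma> ^ k) / (1 - \<gamma>)) + D * \<gamma> ^ k"
      using Suc assms(1)[of k] by linarith
    also have "\<dots> = D * ((1 - \<gamma> ^ Suc k) / (1 - \<gamma>))"
      using assms by (simp add: field_simps)
    finally show ?case .
  qed simp
  also have "\<dots> \<le> D * (1 / (1 - \<gamma>))"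
    using assms by (intro mult_left_mono divide_right_mono) auto
  finally show ?thesis by simp
qed

text \<open>
  One factor \<open>b\<close> is kept, to be integrated over \<open>x\<close>, and the other \<open>p / 2 - 1\<close> are bounded by \<open>E\<close>. The condition
  \<open>\<beta> > 0\<close> is the Sobolev condition \<open>n (p / 2 - 1) < p\<close>; half of the decay rate \<open>\<beta>\<close> goes into the
  weight of \<open>b\<close> in \<open>S\<close>, the other half into the geometric decay of \<open>d\<close>.
\<close>
lemma increment_powr_bound:
  fixes d b E S C p \<beta> :: real and n k :: nat
  assumes d: "0 \<le> d" "d\<^sup>2 \<le> C * 2 powr (real k * (real n - 2)) * b" and b: "0 \<le> b" "b \<le> E"
    and S: "2 powr (real k * (real n - \<beta> / 2)) * b \<le> S"
    and C: "0 < C" and E: "0 < E" and p: "2 \<le> p" and \<beta>: "\<beta> = real n - (real n - 2) * p / 2"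
  shows "d \<le> (C powr (p / 2) * E powr (p / 2 - 1) * S) powr (1 / p) * (2 powr (- \<beta> / (2 * p))) ^ k"
proof -
  have S0: "0 \<le> S" using S b by (smt (verit) mult_nonneg_nonneg powr_ge_zero)
  have bE: "b powr (p / 2) \<le> E powr (p / 2 - 1) * b"
  proof (cases "b = 0")
    case False
    then have "b powr (p / 2) = b powr (p / 2 - 1) * b"
      using b powr_add[of b "p / 2 - 1" 1] by simp
    also have "\<dots> \<le> E powr (p / 2 - 1) * b"
      using b p by (intro mult_right_mono powr_mono2) auto
    finally show ?thesis .
  qed simp
  have bS: "b \<le> S * 2 powr (- (real k * (real n - \<beta> / 2)))"
    using S by (simp add: powr_minus field_simps)
  have "d powr p = (d\<^sup>2) powr (p / 2)"
  proof (cases "d = 0")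
    case False
    then have "d\<^sup>2 = d powr 2" using d by (simp add: powr_numeral)
    then show ?thesis by (simp add: powr_powr)
  qed simp
  also have "\<dots> \<le> (C * 2 powr (real k * (real n - 2)) * b) powr (p / 2)"
    using d p by (intro powr_mono2) auto
  also have "\<dots> = C powr (p / 2) * 2 powr (real k * (real n - 2) * (p / 2)) * b powr (p / 2)"
    using C b by (simp add: powr_mult powr_powr)
  also have "\<dots> \<le> C powr (p / 2) * 2 powr (real k * (real n - 2) * (p / 2)) * (E powr (p / 2 - 1) * (S * 2 powr (- (real k * (real n - \<beta> / 2)))))"
    using bE bS by (intro mult_left_mono order_trans[OF bE]) auto
  also have "\<dots> = C powr (p / 2) * E powr (p / 2 - 1) * S * (2 powr (real k * (real n - 2) * (p / 2)) * 2 powr (- (real k * (real n - \<beta> / 2))))"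
    by (simp add: mult_ac)
  \<comment> \<open>By the choice of \<open>\<beta>\<close>, \<open>(n - 2) * p / 2 - n\<close>
    equals \<open>- \<beta>\<close>, and the weight of \<open>b\<close> gives back
    \<open>\<beta> / 2\<close>; the exponent that remains is
    \<open>- k * \<beta> / 2\<close>.\<close>
  also have "2 powr (real k * (real n - 2) * (p / 2)) * 2 powr (- (real k * (real n - \<beta> / 2))) = (2 :: real) powr (- real k * \<beta> / 2)"
    unfolding powr_add[symmetric] \<beta> by (rule arg_cong[where f = "\<lambda>x. 2 powr x"]) (simp add: field_simps)
  finally have "(d powr p) powr (1 / p) \<le> (C powr (p / 2) * E powr (p / 2 - 1) * S * 2 powr (- real k * \<beta> / 2)) powr (1 / p)"
    using p by (intro powr_mono2) auto
  also have "\<dots> = (C powr (p / 2) * E powr (p / 2 - 1) * S) powr (1 / p) * (2 powr (- real k * \<beta> / 2)) powr (1 / p)"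
    using S0 by (simp add: powr_mult)
  also have "(2 powr (- real k * \<beta> / 2)) powr (1 / p) = ((2 powr (- \<beta> / (2 * p))) ^ k :: real)"
    using p by (simp add: powr_powr powr_realpow[symmetric] field_simps)
  finally show ?thesis using d p by (simp add: powr_powr)
qed

text \<open>Tonelli, combined with the symmetry of the relation \<open>dist x z \<le> r\<close>: the
  inner integral over \<open>x\<close> is the volume of a ball around \<open>z\<close>.
  \<open>H\<close> is Borel because the product measure is that of \<open>lborel\<close>.\<close>

lemma nn_integral_ball_averages:
  fixes H :: "'a::euclidean_space \<Rightarrow> ennreal"
  assumes [measurable]: "H \<in> borel_measurable borel" and r: "0 \<le> r"
  shows "(\<lambda>x. \<integral>\<^sup>+z. H z * indicator (cball x r) z \<partial>lborel) \<in> borel_measurable borel"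
    and "(\<integral>\<^sup>+x. (\<integral>\<^sup>+z. H z * indicator (cball x r) z \<partial>lborel) \<partial>lborel)
      = (\<integral>\<^sup>+z. H z \<partial>lborel) * ennreal (unit_ball_vol (real DIM('a)) * r ^ DIM('a))"
proof -
  have [measurable]: "{y::'a \<times> 'a. dist (fst y) (snd y) \<le> r} \<in> sets (borel \<Otimes>\<^sub>M borel)"
    unfolding borel_prod by (intro borel_closed closed_Collect_le continuous_intros)
  have eq: "(\<lambda>(x, z). H z * indicator (cball x r) z) = (\<lambda>y. H (snd y) * indicator {y. dist (fst y) (snd y) \<le> r} y)"
    by (auto simp: fun_eq_iff indicator_def)
  have meas [measurable]: "(\<lambda>(x, z). H z * indicator (cball x r) z) \<in> borel_measurable (lborel \<Otimes>\<^sub>M lborel)"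
    unfolding eq by measurable
  show "(\<lambda>x. \<integral>\<^sup>+z. H z * indicator (cball x r) z \<partial>lborel) \<in> borel_measurable borel"
    using lborel.borel_measurable_nn_integral[OF meas] by simp
  have "(\<integral>\<^sup>+x. (\<integral>\<^sup>+z. H z * indicator (cball x r) z \<partial>lborel) \<partial>lborel)
     = (\<integral>\<^sup>+z. (\<integral>\<^sup>+x. H z * indicator (cball x r) z \<partial>lborel) \<partial>lborel)"
    using lborel_pair.Fubini'[OF meas] by simp
  also have "\<dots> = (\<integral>\<^sup>+z. (\<integral>\<^sup>+x. H z * indicator (cball z r) x \<partial>lborel) \<partial>lborel)"
    by (intro nn_integral_cong) (auto simp: indicator_def dist_commute)
  also have "\<dots> = (\<integral>\<^sup>+z. H z * emeasure lborel (cball z r) \<partial>lborel)"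
    by (simp add: nn_integral_cmult_indicator)
  also have "\<dots> = (\<integral>\<^sup>+z. H z \<partial>lborel) * ennreal (unit_ball_vol (real DIM('a)) * r ^ DIM('a))"
    using r by (simp add: emeasure_cball nn_integral_multc)
  finally show "(\<integral>\<^sup>+x. (\<integral>\<^sup>+z. H z * indicator (cball x r) z \<partial>lborel) \<partial>lborel)
      = (\<integral>\<^sup>+z. H z \<partial>lborel) * ennreal (unit_ball_vol (real DIM('a)) * r ^ DIM('a))" .
qed

text \<open>Cauchy-Schwarz against the indicator of the ball, carried out with extended nonnegative
  integrals.\<close>

lemma integral_norm_square_le:
  fixes h :: "'a::euclidean_space \<Rightarrow> 'b::euclidean_space"
  assumes \<Omega>: "\<Omega> \<in> sets lebesgue" and h: "h \<in> borel_measurable (lebesgue_on \<Omega>)"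
    and hi: "integrable (lebesgue_on \<Omega>) (\<lambda>z. (norm (h z))\<^sup>2)" and r: "0 \<le> r"
  shows "(LINT z|lebesgue_on \<Omega>. norm (h z) * indicator (cball x r) z)\<^sup>2
    \<le> (LINT z|lebesgue_on \<Omega>. (norm (h z))\<^sup>2 * indicator (cball x r) z) * (unit_ball_vol (real DIM('a)) * r ^ DIM('a))"
proof -
  have cm: "(indicator (cball x r) :: 'a \<Rightarrow> real) \<in> borel_measurable (lebesgue_on \<Omega>)"
    by (intro measurable_restrict_space1 borel_measurable_indicator) auto
  have fm: "(\<lambda>z. norm (h z) * indicator (cball x r) z) \<in> borel_measurable (lebesgue_on \<Omega>)"
    by (intro borel_measurable_times borel_measurable_norm[THEN measurable_compose[OF h], unfolded o_def] cm)
  have i2: "integrable (lebesgue_on \<Omega>) (\<lambda>z. (norm (h z))\<^sup>2 * indicator (cball x r) z)"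
    by (rule integrable_mult_bounded[OF hi cm, where B = 1]) (simp add: indicator_def)
  have "ennreal ((LINT z|lebesgue_on \<Omega>. norm (h z) * indicator (cball x r) z)\<^sup>2)
     \<le> (\<integral>\<^sup>+z. ennreal (norm (h z) * indicator (cball x r) z) \<partial>lebesgue_on \<Omega>)\<^sup>2"
  proof -
    \<comment> \<open>If the integrand were not integrable, the left side would be the default value
      0, so the comparison holds in either case.\<close>
    have "ennreal (LINT z|lebesgue_on \<Omega>. norm (h z) * indicator (cball x r) z) \<le> (\<integral>\<^sup>+z. ennreal (norm (h z) * indicator (cball x r) z) \<partial>lebesgue_on \<Omega>)"
    proof (cases "integrable (lebesgue_on \<Omega>) (\<lambda>z. norm (h z) * indicator (cball x r) z)")
      case True
      from integral_norm_bound_ennreal[OF this] show ?thesis by simp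
    qed (simp add: not_integrable_integral_eq)
    then show ?thesis
      by (simp add: ennreal_power[symmetric] power_mono)
  qed
  \<comment> \<open>The indicator is idempotent, so a second copy can serve as the other factor in
    Cauchy-Schwarz.\<close>
  also have "\<dots> = (\<integral>\<^sup>+z. ennreal (norm (h z) * indicator (cball x r) z) * indicator (cball x r) z \<partial>lebesgue_on \<Omega>)\<^sup>2"
    by (intro arg_cong[where f = "\<lambda>x. x\<^sup>2"] nn_integral_cong) (auto simp: indicator_def)
  also have "\<dots> \<le> (\<integral>\<^sup>+z. (ennreal (norm (h z) * indicator (cball x r) z))\<^sup>2 \<partial>lebesgue_on \<Omega>) * (\<integral>\<^sup>+z. (indicator (cball x r) z)\<^sup>2 \<partial>lebesgue_on \<Omega>)"
  proof (rule Cauchy_Schwarz_nn_integral)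
    show "(\<lambda>z. ennreal (norm (h z) * indicator (cball x r) z)) \<in> borel_measurable (lebesgue_on \<Omega>)"
      using fm by (rule measurable_compose) simp
    show "indicator (cball x r) \<in> borel_measurable (lebesgue_on \<Omega>)"
      by (intro measurable_restrict_space1 borel_measurable_indicator) auto
  qed
  also have "(\<integral>\<^sup>+z. (ennreal (norm (h z) * indicator (cball x r) z))\<^sup>2 \<partial>lebesgue_on \<Omega>)
      = (\<integral>\<^sup>+z. ennreal ((norm (h z))\<^sup>2 * indicator (cball x r) z) \<partial>lebesgue_on \<Omega>)"
    by (intro nn_integral_cong) (auto simp: indicator_def ennreal_power)
  also have "\<dots> = ennreal (LINT z|lebesgue_on \<Omega>. (norm (h z))\<^sup>2 * indicator (cball x r) z)"
    by (rule nn_integral_eq_integral[OF i2]) auto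
  also have "(\<integral>\<^sup>+z. (indicator (cball x r) z)\<^sup>2 \<partial>lebesgue_on \<Omega>) \<le> ennreal (unit_ball_vol (real DIM('a)) * r ^ DIM('a))"
  proof -
    have "(\<integral>\<^sup>+z. (indicator (cball x r) z)\<^sup>2 \<partial>lebesgue_on \<Omega>) = (\<integral>\<^sup>+z. indicator (cball x r) z * indicator \<Omega> z \<partial>lebesgue)"
      using \<Omega> by (subst nn_integral_restrict_space) (auto intro!: nn_integral_cong simp: indicator_def)
    also have "\<dots> \<le> (\<integral>\<^sup>+z. indicator (cball x r) z \<partial>lebesgue)"
      by (intro nn_integral_mono) (auto simp: indicator_def)
    also have "\<dots> = ennreal (unit_ball_vol (real DIM('a)) * r ^ DIM('a))"
      using r by (simp add: emeasure_cball)
    finally show ?thesis .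
  qed
  finally have le: "ennreal ((LINT z|lebesgue_on \<Omega>. norm (h z) * indicator (cball x r) z)\<^sup>2)
     \<le> ennreal (LINT z|lebesgue_on \<Omega>. (norm (h z))\<^sup>2 * indicator (cball x r) z) * ennreal (unit_ball_vol (real DIM('a)) * r ^ DIM('a))"
    by (simp add: mult_left_mono)
  have "0 \<le> (LINT z|lebesgue_on \<Omega>. (norm (h z))\<^sup>2 * indicator (cball x r) z)"
    by (intro integral_nonneg_AE AE_I2) simp
  then show ?thesis
    using le r by (simp add: ennreal_mult[symmetric] ennreal_le_iff)
qed

text \<open>A bound uniform in \<open>k\<close> survives the limit. The contracted balls lie in
  balls around \<open>x\<close> of radius proportional to their own, so the oscillation divided by
  \<open>t ^ n\<close> vanishes at a Lebesgue point.\<close>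

lemma star_average_lower_bound:
  fixes u :: "real ^ 'n \<Rightarrow> real"
  assumes \<Omega>: "\<Omega> \<in> sets lebesgue" and ui: "integrable (lebesgue_on \<Omega>) u" and x: "x \<in> \<Omega>"
    and \<rho>: "0 < \<rho>" and L: "\<rho> + norm (z0 - x) \<le> L"
    and leb: "((\<lambda>r. (LINT z|lebesgue. \<bar>indicator \<Omega> z * u z - indicator \<Omega> x * u x\<bar> * indicator (cball x r) z) / r ^ CARD('n)) \<longlongrightarrow> 0) (at_right 0)"
    and M: "\<And>k. \<bar>star_average \<Omega> u z0 \<rho> x ((1 / 2) ^ k)\<bar> \<le> M"
  shows "\<bar>u x\<bar> * (bump_mass TYPE('n) * \<rho> ^ CARD('n)) \<le> M"
proof -
  \<comment> \<open>Extension by zero, since Lebesgue points were established for functions on the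
    whole space.\<close>
  define U where "U z = indicator \<Omega> z * u z" for z
  have Ui: "integrable lebesgue U"
    using ui integrable_lebesgue_on_iff[OF \<Omega>, of u] by (simp add: U_def[abs_def])
  have Ux: "U x = u x" using x by (simp add: U_def)
  have Lp: "0 < L" using L \<rho> norm_ge_zero[of "z0 - x"] by linarith
  define E where "E r = (LINT z|lebesgue. \<bar>U z - U x\<bar> * indicator (cball x r) z)" for r
  have "\<bar>u x\<bar> * (bump_mass TYPE('n) * \<rho> ^ CARD('n)) \<le> M + L ^ CARD('n) * (E ((1/2)^k * L) / ((1/2)^k * L) ^ CARD('n))" for k
  proof -
    define t where "t = (1 / 2 :: real) ^ k"
    have t: "0 < t" "t \<le> 1" by (auto simp: t_def power_le_one)
    have sub: "cball (x + t *\<^sub>R (z0 - x)) (t * \<rho>) \<subseteq> cball x (t * L)"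
    proof -
      have "dist x (x + t *\<^sub>R (z0 - x)) + t * \<rho> \<le> t * L"
        using L t by (simp add: dist_norm distrib_left[symmetric] add.commute)
      then show ?thesis by (simp add: cball_subset_cball_iff dist_commute)
    qed
    have "\<bar>U x\<bar> * bump_mass TYPE('n) * (t * \<rho>) ^ CARD('n) \<le>
       \<bar>LINT z|lebesgue. U z * bump (x + t *\<^sub>R (z0 - x)) (t * \<rho>) z\<bar> + E (t * L)"
      unfolding E_def using t \<rho> by (intro lebesgue_point_bump_le sub Ui) auto
    moreover have "(LINT z|lebesgue. U z * bump (x + t *\<^sub>R (z0 - x)) (t * \<rho>) z) = star_average \<Omega> u z0 \<rho> x t * t ^ CARD('n)"
    proof -
      have "(LINT z|lebesgue. U z * bump (x + t *\<^sub>R (z0 - x)) (t * \<rho>) z) = (LINT z|lebesgue_on \<Omega>. u z * bump (x + t *\<^sub>R (z0 - x)) (t * \<rho>) z)"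
        unfolding integral_lebesgue_on_eq[OF \<Omega>] by (simp add: U_def mult.assoc)
      also have "\<dots> = (LINT z|lebesgue_on \<Omega>. u z * bump (x + t *\<^sub>R (z0 - x)) (t * \<rho>) z / t ^ CARD('n)) * t ^ CARD('n)"
        using t by simp
      finally show ?thesis by (simp add: star_average_def)
    qed
    ultimately have "\<bar>u x\<bar> * bump_mass TYPE('n) * (t * \<rho>) ^ CARD('n) \<le> M * t ^ CARD('n) + E (t * L)"
    proof -
      assume 1: "\<bar>U x\<bar> * bump_mass TYPE('n) * (t * \<rho>) ^ CARD('n) \<le>
         \<bar>LINT z|lebesgue. U z * bump (x + t *\<^sub>R (z0 - x)) (t * \<rho>) z\<bar> + E (t * L)"
        and 2: "(LINT z|lebesgue. U z * bump (x + t *\<^sub>R (z0 - x)) (t * \<rho>) z) = star_average \<Omega> u z0 \<rho> x t * t ^ CARD('n)"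
      have "\<bar>star_average \<Omega> u z0 \<rho> x t * t ^ CARD('n)\<bar> \<le> M * t ^ CARD('n)"
        unfolding abs_mult using t M[of k, folded t_def] by (intro mult_mono) auto
      then show ?thesis using 1 unfolding 2 Ux by linarith
    qed
    then have "\<bar>u x\<bar> * bump_mass TYPE('n) * \<rho> ^ CARD('n) \<le> M + E (t * L) / t ^ CARD('n)"
      using t by (simp add: field_simps power_mult_distrib)
    also have "E (t * L) / t ^ CARD('n) = L ^ CARD('n) * (E (t * L) / (t * L) ^ CARD('n))"
      using Lp by (simp add: power_mult_distrib)
    finally show ?thesis by (simp add: t_def mult.assoc)
  qed
  moreover have "(\<lambda>k. M + L ^ CARD('n) * (E ((1/2)^k * L) / ((1/2)^k * L) ^ CARD('n))) \<longlonglongrightarrow> M + L ^ CARD('n) * 0"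
  proof (intro tendsto_intros filterlim_compose[OF leb[folded U_def, folded E_def]])
    have "(\<lambda>k. (1/2::real)^k * L) \<longlonglongrightarrow> 0 * L" by (intro tendsto_intros LIMSEQ_realpow_zero) auto
    then show "filterlim (\<lambda>k. (1/2)^k * L) (at_right 0) sequentially"
      using Lp by (auto simp: filterlim_at)
  qed
  ultimately show ?thesis
    by (intro LIMSEQ_le_const[where X = "\<lambda>k. M + L ^ CARD('n) * (E ((1/2)^k * L) / ((1/2)^k * L) ^ CARD('n))"]) auto
qed

text \<open>The pointwise bound by \<open>S x\<close> replaces a maximal function: one weighted
  series controls all dyadic increments at once, and its integral is computed by Tonelli. Convexity
  allows the same reference ball for all \<open>x\<close>.\<close>

theorem sobolev_embedding_convex:
  fixes u :: "real ^ 'n \<Rightarrow> real"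
  assumes \<Omega>: "open \<Omega>" and u: "has_weak_gradient \<Omega> u h"
    and ui: "integrable (lebesgue_on \<Omega>) u" and hi: "integrable (lebesgue_on \<Omega>) h"
    and h2: "integrable (lebesgue_on \<Omega>) (\<lambda>z. (norm (h z))\<^sup>2)"
    and T: "convex T" "bounded T" "interior T \<subseteq> \<Omega>"
    and p: "2 \<le> p" "real CARD('n) * (p / 2 - 1) < p"
  shows "integrable (lebesgue_on (interior T)) (\<lambda>x. \<bar>u x\<bar> powr p)"
proof (cases "interior T = {}")
  case True
  then show ?thesis by (simp add: integrable_lebesgue_on_iff)
next
  case False
  then obtain z0 \<rho> where \<rho>: "0 < \<rho>" and z0: "cball z0 \<rho> \<subseteq> interior T"
    using open_contains_cball[of "interior T"] by blast
  obtain R where R: "\<And>x. x \<in> T \<Longrightarrow> norm x \<le> R" using T(2) by (auto simp: bounded_iff)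
  \<comment> \<open>One radius for all \<open>x\<close> in \<open>T\<close>: it bounds
    \<open>\<rho> + norm (z0 - x)\<close> by boundedness of \<open>T\<close>.\<close>
  define L where "L = \<rho> + norm z0 + R"
  have L: "\<rho> + norm (z0 - x) \<le> L" if "x \<in> T" for x
    using R[OF that] norm_triangle_ineq4[of z0 x] by (simp add: L_def)
  have "z0 \<in> T" using z0 \<rho> interior_subset by (meson centre_in_cball less_imp_le subsetD)
  then have Lp: "0 < L" using L[of z0] \<rho> by simp
  have \<Omega>s: "\<Omega> \<in> sets lebesgue" using \<Omega> by simp
  define n where "n = CARD('n)"
  define V where "V = unit_ball_vol (real n)"
  have Vp: "0 < V" by (simp add: V_def)
  define \<beta> where "\<beta> = real n - (real n - 2) * p / 2"
  have \<beta>: "0 < \<beta>" using p by (simp add: \<beta>_def n_def algebra_simps)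
  define b where "b k x = (LINT z|lebesgue_on \<Omega>. (norm (h z))\<^sup>2 * indicator (cball x (L * (1 / 2) ^ k)) z)" for k x
  \<comment> \<open>The added 1 makes the bound on the local energies strictly positive, as
    \<open>increment_powr_bound\<close> requires.\<close>
  define E where "E = (LINT z|lebesgue_on \<Omega>. (norm (h z))\<^sup>2) + 1"
  have Ep: "0 < E" unfolding E_def by (simp add: add_nonneg_pos)
  have hm: "h \<in> borel_measurable (lebesgue_on \<Omega>)" using hi by auto
  have cm: "(indicator (cball x r) :: _ \<Rightarrow> real) \<in> borel_measurable (lebesgue_on \<Omega>)" for x r
    by (intro measurable_restrict_space1 borel_measurable_indicator) auto
  have bi: "integrable (lebesgue_on \<Omega>) (\<lambda>z. (norm (h z))\<^sup>2 * indicator (cball x r) z)" for x r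
    by (rule integrable_mult_bounded[OF h2 cm, where B = 1]) (simp add: indicator_def)
  have b0: "0 \<le> b k x" for k x unfolding b_def by (intro integral_nonneg_AE AE_I2) simp
  have bE: "b k x \<le> E" for k x
  proof -
    have "b k x \<le> (LINT z|lebesgue_on \<Omega>. (norm (h z))\<^sup>2)"
      unfolding b_def by (rule integral_mono[OF bi h2]) (simp add: indicator_def)
    then show ?thesis by (simp add: E_def)
  qed
  define a where "a x k = star_average \<Omega> u z0 \<rho> x ((1 / 2) ^ k)" for x k
  \<comment> \<open>Squaring the increment estimate and inserting Cauchy-Schwarz leaves
    \<open>s ^ 2 / s ^ n\<close> times constants. Since \<open>s\<close> is
    \<open>(1 / 2) ^ Suc k\<close>, this power is \<open>2 powr ((k + 1) * (n - 2))\<close>; the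
    shift by one is the first factor of \<open>C\<close>.\<close>
  define C where "C = 2 powr (real n - 2) * L\<^sup>2 * (V * (2 * L) ^ n)"
  have Cp: "0 < C" using Lp Vp by (simp add: C_def)
  have inc: "(\<bar>a x k - a x (Suc k)\<bar>)\<^sup>2 \<le> C * 2 powr (real k * (real n - 2)) * b k x" if x: "x \<in> T" for x k
  proof -
    define s where "s = (1 / 2 :: real) ^ Suc k"
    have s: "0 < s" "s \<le> 1 / 2" "2 * s = (1 / 2) ^ k" by (auto simp: s_def power_le_one)
    define I where "I = (LINT z|lebesgue_on \<Omega>. norm (h z) * indicator (cball x (2 * s * L)) z)"
    have "\<bar>a x k - a x (Suc k)\<bar> \<le> s / s ^ n * L * I"
      using star_average_diff_le[OF \<Omega> u ui hi T(1) x z0 T(3) \<rho> s(1,2) L[OF x]]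
      unfolding a_def I_def n_def s(3)[symmetric] s_def[symmetric] .
    then have "(\<bar>a x k - a x (Suc k)\<bar>)\<^sup>2 \<le> (s / s ^ n * L * I)\<^sup>2" by (intro power_mono) auto
    also have "\<dots> = (s / s ^ n * L)\<^sup>2 * I\<^sup>2" by (rule power_mult_distrib)
    also have "\<dots> \<le> (s / s ^ n * L)\<^sup>2 * (b k x * (V * (2 * s * L) ^ n))"
    proof (intro mult_left_mono)
      have "I\<^sup>2 \<le> (LINT z|lebesgue_on \<Omega>. (norm (h z))\<^sup>2 * indicator (cball x (2 * s * L)) z) * (unit_ball_vol (real DIM(real ^ 'n)) * (2 * s * L) ^ DIM(real ^ 'n))"
        unfolding I_def by (rule integral_norm_square_le[OF \<Omega>s hm h2]) (use s Lp in auto)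
      then show "I\<^sup>2 \<le> b k x * (V * (2 * s * L) ^ n)"
        unfolding b_def V_def n_def s(3) by (simp add: mult.commute)
    qed simp
    also have "\<dots> = (s\<^sup>2 / s ^ n) * (L\<^sup>2 * (V * (2 * L) ^ n)) * b k x"
      using s(1) by (simp add: power_mult_distrib power_divide power2_eq_square)
    also have "s\<^sup>2 / s ^ n = 2 powr (real n - 2) * 2 powr (real k * (real n - 2))"
    proof -
      have s': "s = 2 powr (- (real k + 1))"
      proof -
        have "s = inverse (2 ^ Suc k)" by (simp add: s_def power_one_over inverse_eq_divide)
        also have "\<dots> = 2 powr (- real (Suc k))" by (simp only: powr_minus powr_realpow zero_less_numeral)
        finally show ?thesis by (simp add: add.commute)
      qed
      have "s\<^sup>2 / s ^ n = s powr 2 / s powr real n" using s(1) by (simp add: powr_realpow powr_numeral)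
      also have "\<dots> = 2 powr (- (real k + 1) * 2 - (- (real k + 1) * real n))"
        unfolding s' powr_powr by (rule powr_diff[symmetric])
      also have "\<dots> = 2 powr (real n - 2) * 2 powr (real k * (real n - 2))"
        unfolding powr_add[symmetric] by (rule arg_cong[where f = "\<lambda>x. 2 powr x"]) (simp add: algebra_simps)
      finally show ?thesis .
    qed
    finally show ?thesis by (simp add: C_def mult_ac)
  qed
  \<comment> \<open>A Borel representative of the squared gradient, extended by zero, because
    Tonelli is applied on \<open>lborel\<close> and \<open>h\<close> is only Lebesgue
    measurable.\<close>
  obtain H where Hm [measurable]: "H \<in> borel_measurable lborel"
    and H: "AE z in lborel. indicator \<Omega> z * ennreal ((norm (h z))\<^sup>2) = H z"
  proof -
    have "(\<lambda>z. indicator \<Omega> z *\<^sub>R (norm (h z))\<^sup>2) \<in> borel_measurable lebesgue"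
      using h2 integrable_lebesgue_on_iff[OF \<Omega>s] borel_measurable_integrable by blast
    then have "(\<lambda>z. ennreal (indicator \<Omega> z *\<^sub>R (norm (h z))\<^sup>2)) \<in> borel_measurable lebesgue"
      by simp
    also have "(\<lambda>z. ennreal (indicator \<Omega> z *\<^sub>R (norm (h z))\<^sup>2)) = (\<lambda>z. indicator \<Omega> z * ennreal ((norm (h z))\<^sup>2))"
      by (auto simp: indicator_def)
    finally show ?thesis using completion_ex_borel_measurable that by blast
  qed
  have bH: "ennreal (b k x) = (\<integral>\<^sup>+z. H z * indicator (cball x (L * (1 / 2) ^ k)) z \<partial>lborel)" for k x
  proof -
    have "ennreal (b k x) = (\<integral>\<^sup>+z. ennreal ((norm (h z))\<^sup>2 * indicator (cball x (L * (1 / 2) ^ k)) z) \<partial>lebesgue_on \<Omega>)"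
      unfolding b_def by (rule nn_integral_eq_integral[OF bi, symmetric]) auto
    also have "\<dots> = (\<integral>\<^sup>+z. ennreal ((norm (h z))\<^sup>2 * indicator (cball x (L * (1 / 2) ^ k)) z) * indicator \<Omega> z \<partial>lebesgue)"
      using \<Omega>s by (subst nn_integral_restrict_space) auto
    also have "\<dots> = (\<integral>\<^sup>+z. H z * indicator (cball x (L * (1 / 2) ^ k)) z \<partial>lebesgue)"
      using AE_completion[OF H] by (intro nn_integral_cong_AE) (auto elim!: eventually_mono simp: indicator_def)
    also have "\<dots> = (\<integral>\<^sup>+z. H z * indicator (cball x (L * (1 / 2) ^ k)) z \<partial>lborel)"
      by (rule nn_integral_completion)
    finally show ?thesis .
  qed
  have HE: "(\<integral>\<^sup>+z. H z \<partial>lborel) < \<infinity>"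
  proof -
    have "(\<integral>\<^sup>+z. H z \<partial>lborel) = (\<integral>\<^sup>+z. H z \<partial>lebesgue)" by (rule nn_integral_completion[symmetric])
    also have "\<dots> = (\<integral>\<^sup>+z. ennreal ((norm (h z))\<^sup>2) * indicator \<Omega> z \<partial>lebesgue)"
      using AE_completion[OF H] by (intro nn_integral_cong_AE) (auto elim!: eventually_mono simp: mult.commute)
    also have "\<dots> = (\<integral>\<^sup>+z. ennreal ((norm (h z))\<^sup>2) \<partial>lebesgue_on \<Omega>)"
      using \<Omega>s by (subst nn_integral_restrict_space) auto
    also have "\<dots> = ennreal (LINT z|lebesgue_on \<Omega>. (norm (h z))\<^sup>2)" by (rule nn_integral_eq_integral[OF h2]) auto
    finally show ?thesis by simp
  qed
  \<comment> \<open>Integrating \<open>b k\<close> over \<open>x\<close> yields a factor of order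
    \<open>2 powr (- k * n)\<close>, the volume of the ball. The weight stays below its reciprocal
    by \<open>2 powr (- k * \<beta> / 2)\<close>, so the series of integrals is geometric.\<close>
  define w where "w k = 2 powr (real k * (real n - \<beta> / 2))" for k :: nat
  define S where "S x = (\<Sum>k. ennreal (w k) * ennreal (b k x))" for x
  have bm: "(\<lambda>x. ennreal (b k x)) \<in> borel_measurable borel" for k
    unfolding bH using nn_integral_ball_averages(1)[of H "L * (1 / 2) ^ k"] Lp by simp
  have Sm [measurable]: "S \<in> borel_measurable borel"
    unfolding S_def[abs_def] using bm by measurable
  have SI: "(\<integral>\<^sup>+x. S x \<partial>lborel) < \<infinity>"
  proof -
    define \<gamma> where "\<gamma> = 2 powr (- \<beta> / 2)"
    have \<gamma>: "0 < \<gamma>" "\<gamma> < 1" using \<beta> by (auto simp: \<gamma>_def powr_less_one)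
    have wk: "w k * (V * (L * (1 / 2) ^ k) ^ n) = V * L ^ n * \<gamma> ^ k" for k
    proof -
      have "((1 / 2 :: real) ^ k) ^ n = 2 powr (- (real k * real n))"
      proof -
        have "((1 / 2 :: real) ^ k) ^ n = inverse (2 ^ (k * n))"
          by (simp add: power_mult power_one_over inverse_eq_divide)
        also have "\<dots> = 2 powr (- real (k * n))" by (simp only: powr_minus powr_realpow zero_less_numeral)
        finally show ?thesis by simp
      qed
      then have "w k * ((1 / 2) ^ k) ^ n = 2 powr (real k * (real n - \<beta> / 2) + - (real k * real n))"
        unfolding w_def powr_add by simp
      also have "\<dots> = \<gamma> ^ k"
      proof -
        have "\<gamma> ^ k = \<gamma> powr real k" using \<gamma> by (simp add: powr_realpow)
        also have "\<dots> = 2 powr (- \<beta> / 2 * real k)" unfolding \<gamma>_def powr_powr ..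
        finally show ?thesis by (simp add: algebra_simps)
      qed
      finally show ?thesis by (simp add: power_mult_distrib mult_ac)
    qed
    have "(\<integral>\<^sup>+x. S x \<partial>lborel) = (\<Sum>k. \<integral>\<^sup>+x. ennreal (w k) * ennreal (b k x) \<partial>lborel)"
      unfolding S_def by (rule nn_integral_suminf) (use bm in measurable)
    also have "\<dots> = (\<Sum>k. ennreal (w k) * ((\<integral>\<^sup>+z. H z \<partial>lborel) * ennreal (V * (L * (1 / 2) ^ k) ^ n)))"
    proof (intro suminf_cong)
      fix k
      have "(\<integral>\<^sup>+x. ennreal (w k) * ennreal (b k x) \<partial>lborel) = ennreal (w k) * (\<integral>\<^sup>+x. ennreal (b k x) \<partial>lborel)"
        by (rule nn_integral_cmult) (use bm in simp)
      also have "(\<integral>\<^sup>+x. ennreal (b k x) \<partial>lborel) = (\<integral>\<^sup>+z. H z \<partial>lborel) * ennreal (V * (L * (1 / 2) ^ k) ^ n)"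
        unfolding bH V_def n_def using nn_integral_ball_averages(2)[of H "L * (1 / 2) ^ k"] Lp by simp
      finally show "(\<integral>\<^sup>+x. ennreal (w k) * ennreal (b k x) \<partial>lborel) = ennreal (w k) * ((\<integral>\<^sup>+z. H z \<partial>lborel) * ennreal (V * (L * (1 / 2) ^ k) ^ n))" .
    qed
    also have "\<dots> = (\<Sum>k. (\<integral>\<^sup>+z. H z \<partial>lborel) * ennreal (V * L ^ n * \<gamma> ^ k))"
      unfolding wk[symmetric] using Vp Lp by (simp add: ennreal_mult w_def mult_ac)
    also have "\<dots> = (\<integral>\<^sup>+z. H z \<partial>lborel) * (\<Sum>k. ennreal (V * L ^ n * \<gamma> ^ k))"
      by (rule ennreal_suminf_cmult)
    also have "(\<Sum>k. ennreal (V * L ^ n * \<gamma> ^ k)) = ennreal (\<Sum>k. V * L ^ n * \<gamma> ^ k)"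
      using \<gamma> Vp Lp by (intro suminf_ennreal2 summable_mult summable_geometric) auto
    finally show ?thesis using HE by (simp add: ennreal_mult_less_top)
  qed
  \<comment> \<open>At \<open>t = 1\<close> the ball is the reference ball itself, so the starting
    value of the averages is the same for every \<open>x\<close>.\<close>
  define K where "K = \<bar>LINT z|lebesgue_on \<Omega>. u z * bump z0 \<rho> z\<bar>"
  define \<gamma> where "\<gamma> = 2 powr (- \<beta> / (2 * p))"
  have \<gamma>: "0 < \<gamma>" "\<gamma> < 1" using \<beta> p by (auto simp: \<gamma>_def powr_less_one)
  define Q where "Q = C powr (p / 2) * E powr (p / 2 - 1)"
  have Q: "0 < Q" using Cp Ep by (simp add: Q_def)
  define \<kappa> where "\<kappa> = bump_mass TYPE('n) * \<rho> ^ n"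
  have \<kappa>: "0 < \<kappa>" using bump_mass_pos[where 'n = 'n] \<rho> by (simp add: \<kappa>_def)
  \<comment> \<open>\<open>A\<close> and \<open>B\<close> come from
    \<open>X + Y \<le> max (2 * X) (2 * Y)\<close> followed by the power \<open>p\<close>:
    \<open>A\<close> is the share of the starting average, \<open>B\<close> that of the
    increments.\<close>
  define A where "A = (2 * K / \<kappa>) powr p"
  define B where "B = (2 / ((1 - \<gamma>) * \<kappa>)) powr p * Q"
  have B: "0 < B" using \<gamma> \<kappa> Q by (simp add: B_def)
  have AB: "0 \<le> A" by (simp add: A_def)
  have key: "ennreal (\<bar>u x\<bar> powr p) \<le> ennreal A + ennreal B * S x"
    if x: "x \<in> interior T" and leb: "((\<lambda>r. (LINT z|lebesgue. \<bar>indicator \<Omega> z * u z - indicator \<Omega> x * u x\<bar> * indicator (cball x r) z) / r ^ CARD('n)) \<longlongrightarrow> 0) (at_right 0)" for x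
  proof (cases "S x = \<infinity>")
    case True
    then show ?thesis using B by (simp add: ennreal_mult_top)
  next
    case False
    have xT: "x \<in> T" using x interior_subset by blast
    define \<sigma> where "\<sigma> = enn2real (S x)"
    have \<sigma>: "ennreal \<sigma> = S x" "0 \<le> \<sigma>" using False by (auto simp: \<sigma>_def top.not_eq_extremum)
    \<comment> \<open>A single term of a nonnegative series is at most its sum, which gives the
      weighted bound on \<open>b k x\<close> for all \<open>k\<close> simultaneously.\<close>
    have wb: "w k * b k x \<le> \<sigma>" for k
    proof -
      have "ennreal (w k * b k x) = (\<Sum>k\<in>{k}. ennreal (w k) * ennreal (b k x))"
        by (simp add: ennreal_mult w_def b0)
      also have "\<dots> \<le> S x" unfolding S_def by (rule sum_le_suminf) auto
      finally show ?thesis unfolding \<sigma>(1)[symmetric] using \<sigma>(2) by (simp add: ennreal_le_iff)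
    qed
    have "\<bar>a x k - a x (Suc k)\<bar> \<le> (Q * \<sigma>) powr (1 / p) * \<gamma> ^ k" for k
      unfolding Q_def \<gamma>_def
      by (rule increment_powr_bound[OF _ inc[OF xT] b0 bE wb[unfolded w_def] Cp Ep p(1) \<beta>_def]) simp
    then have "\<bar>a x k\<bar> \<le> \<bar>a x 0\<bar> + (Q * \<sigma>) powr (1 / p) / (1 - \<gamma>)" for k
      by (rule geometric_increments_bound[OF _ \<gamma>]) simp
    then have "\<bar>star_average \<Omega> u z0 \<rho> x ((1 / 2) ^ k)\<bar> \<le> K + (Q * \<sigma>) powr (1 / p) / (1 - \<gamma>)" for k
      by (simp add: a_def K_def star_average_1)
    from star_average_lower_bound[OF \<Omega>s ui _ \<rho> L[OF xT] leb this] x T(3)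
    have "\<bar>u x\<bar> * \<kappa> \<le> K + (Q * \<sigma>) powr (1 / p) / (1 - \<gamma>)" by (auto simp: \<kappa>_def n_def)
    then have "\<bar>u x\<bar> \<le> (K + (Q * \<sigma>) powr (1 / p) / (1 - \<gamma>)) / \<kappa>"
      using \<kappa> by (simp add: pos_le_divide_eq)
    then have "\<bar>u x\<bar> \<le> K / \<kappa> + (Q * \<sigma>) powr (1 / p) / ((1 - \<gamma>) * \<kappa>)"
      by (simp add: add_divide_distrib)
    also have "\<dots> \<le> max (2 * K / \<kappa>) (2 / ((1 - \<gamma>) * \<kappa>) * (Q * \<sigma>) powr (1 / p))"
      by (simp add: max_def)
    finally have "\<bar>u x\<bar> powr p \<le> (max (2 * K / \<kappa>) (2 / ((1 - \<gamma>) * \<kappa>) * (Q * \<sigma>) powr (1 / p))) powr p"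
      using p by (intro powr_mono2) auto
    also have "\<dots> \<le> A + (2 / ((1 - \<gamma>) * \<kappa>) * (Q * \<sigma>) powr (1 / p)) powr p"
      by (simp add: max_def A_def)
    also have "(2 / ((1 - \<gamma>) * \<kappa>) * (Q * \<sigma>) powr (1 / p)) powr p = B * \<sigma>"
    proof -
      have "(2 / ((1 - \<gamma>) * \<kappa>) * (Q * \<sigma>) powr (1 / p)) powr p = (2 / ((1 - \<gamma>) * \<kappa>)) powr p * ((Q * \<sigma>) powr (1 / p)) powr p"
        by (rule powr_mult)
      moreover have "((Q * \<sigma>) powr (1 / p)) powr p = Q * \<sigma>"
        using Q \<sigma>(2) p by (simp add: powr_powr)
      ultimately show ?thesis by (simp only: B_def mult.assoc)
    qed
    finally have "ennreal (\<bar>u x\<bar> powr p) \<le> ennreal (A + B * \<sigma>)" by (rule ennreal_leI)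
    also have "\<dots> = ennreal A + ennreal B * S x"
      using AB B \<sigma> by (simp add: ennreal_plus ennreal_mult)
    finally show ?thesis .
  qed
  have Ts: "interior T \<in> sets lebesgue" by simp
  have "integrable lebesgue (\<lambda>z. indicator \<Omega> z * u z)"
    using ui integrable_lebesgue_on_iff[OF \<Omega>s, of u] by simp
  from AE_lebesgue_point[OF this]
  have AEk: "AE x in lebesgue. x \<in> interior T \<longrightarrow> ennreal (\<bar>u x\<bar> powr p) \<le> ennreal A + ennreal B * S x"
    by eventually_elim (use key in simp)
  show ?thesis
    unfolding integrable_lebesgue_on_iff[OF Ts]
  proof (rule integrableI_bounded)
    have "(\<lambda>x. indicator \<Omega> x *\<^sub>R u x) \<in> borel_measurable lebesgue"
      using ui integrable_lebesgue_on_iff[OF \<Omega>s] borel_measurable_integrable by blast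
    then have "(\<lambda>x. indicator (interior T) x *\<^sub>R (\<bar>indicator \<Omega> x *\<^sub>R u x\<bar> powr p)) \<in> borel_measurable lebesgue"
      using Ts by measurable
    also have "(\<lambda>x. indicator (interior T) x *\<^sub>R (\<bar>indicator \<Omega> x *\<^sub>R u x\<bar> powr p)) = (\<lambda>x. indicator (interior T) x *\<^sub>R (\<bar>u x\<bar> powr p))"
      using T(3) by (auto simp: fun_eq_iff indicator_def)
    finally show "(\<lambda>x. indicator (interior T) x *\<^sub>R (\<bar>u x\<bar> powr p)) \<in> borel_measurable lebesgue" .
    have "(\<integral>\<^sup>+x. ennreal (norm (indicator (interior T) x *\<^sub>R (\<bar>u x\<bar> powr p))) \<partial>lebesgue)
        \<le> (\<integral>\<^sup>+x. ennreal A * indicator (interior T) x + ennreal B * S x \<partial>lebesgue)"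
      using AEk by (intro nn_integral_mono_AE) (auto elim!: eventually_mono simp: indicator_def)
    also have "\<dots> = (\<integral>\<^sup>+x. ennreal A * indicator (interior T) x + ennreal B * S x \<partial>lborel)"
      by (rule nn_integral_completion)
    also have "\<dots> = ennreal A * emeasure lborel (interior T) + ennreal B * (\<integral>\<^sup>+x. S x \<partial>lborel)"
      by (subst nn_integral_add) (auto simp: nn_integral_cmult)
    also have "\<dots> < \<infinity>"
      using SI emeasure_bounded_finite[of "interior T"] bounded_subset[OF T(2) interior_subset]
      by (auto simp: ennreal_mult_less_top)
    finally show "(\<integral>\<^sup>+x. ennreal (norm (indicator (interior T) x *\<^sub>R (\<bar>u x\<bar> powr p))) \<partial>lebesgue) < \<infinity>" .
  qed
qed

section \<open>Integrability in the energy identity\<close>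

lemma powr_2: "0 \<le> x \<Longrightarrow> x powr 2 = x\<^sup>2" for x :: real
  by (cases "x = 0") (auto simp: powr_numeral)

lemma Lp2_integrable:
  "f \<in> Lp 2 \<Omega> \<longleftrightarrow> f \<in> borel_measurable (lebesgue_on \<Omega>) \<and> integrable (lebesgue_on \<Omega>) (\<lambda>x. (norm (f x))\<^sup>2)"
  by (simp add: Lp_def powr_2)

lemma integrable_const_bounded:
  assumes "\<Omega> \<in> sets lebesgue" "bounded \<Omega>"
  shows "integrable (lebesgue_on \<Omega>) (\<lambda>x. c :: real)"
  by (intro finite_measure.integrable_const finite_measure_lebesgue_on bounded_set_imp_lmeasurable assms)

lemma Lp2_imp_integrable:
  fixes f :: "real ^ 'n \<Rightarrow> 'b::{banach, second_countable_topology}"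
  assumes \<Omega>: "\<Omega> \<in> sets lebesgue" "bounded \<Omega>" and f: "f \<in> Lp 2 \<Omega>"
  shows "integrable (lebesgue_on \<Omega>) f"
proof (rule Bochner_Integration.integrable_bound)
  show "integrable (lebesgue_on \<Omega>) (\<lambda>x. 1 + (norm (f x))\<^sup>2)"
    using f integrable_const_bounded[OF \<Omega>] unfolding Lp2_integrable by (intro Bochner_Integration.integrable_add) auto
  show "f \<in> borel_measurable (lebesgue_on \<Omega>)" using f unfolding Lp2_integrable by blast
  have "norm (f x) \<le> 1 + (norm (f x))\<^sup>2" for x
    using sum_squares_bound[of 1 "norm (f x)"] norm_ge_zero[of "f x"] unfolding one_power2 by linarith
  then show "AE x in lebesgue_on \<Omega>. norm (f x) \<le> norm (1 + (norm (f x))\<^sup>2)"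
    unfolding real_norm_def by (intro AE_I2) (rule order_trans[OF _ abs_ge_self])
qed

lemma AE_measurable_transfer:
  fixes f g :: "'a::euclidean_space \<Rightarrow> 'b::{banach, second_countable_topology}"
  assumes "AE x in M. f x = g x" "integrable M f" "g \<in> borel_measurable M"
  shows "integrable M g"
  using integrable_cong_AE[OF borel_measurable_integrable[OF assms(2)] assms(3,1)] assms(2) by simp

section \<open>Sobolev functions on a triangulated domain\<close>

locale sobolev_domain =
  fixes \<Omega> :: "(real ^ 'n) set" and \<T> :: "(real ^ 'n) set set"
  assumes open_domain: "open \<Omega>" and bounded_domain: "bounded \<Omega>"
    and triangulated: "conforming_triangulation \<Omega> \<T>"
begin

lemma domain_sets: "\<Omega> \<in> sets lebesgue"
  using open_domain by simp

lemma H1_has_weak_gradient: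
  assumes "u \<in> H1 \<Omega>" shows "has_weak_gradient \<Omega> u (grad \<Omega> u)"
proof -
  obtain h where "has_weak_gradient \<Omega> u h" using assms by (auto simp: W1_def)
  from someI[of "has_weak_gradient \<Omega> u", OF this] show ?thesis unfolding grad_def .
qed

text \<open>Membership in \<open>H1\<close> provides some square-integrable weak gradient, while
  \<open>grad\<close> may be a different choice; the two agree almost everywhere, so the
  integrability carries over.\<close>

lemma grad_Lp2:
  assumes "u \<in> H1 \<Omega>" shows "grad \<Omega> u \<in> Lp 2 \<Omega>"
proof -
  obtain h where h: "h \<in> Lp 2 \<Omega>" "has_weak_gradient \<Omega> u h" using assms by (auto simp: W1_def)
  note g = H1_has_weak_gradient[OF assms]
  have gm: "grad \<Omega> u \<in> borel_measurable (lebesgue_on \<Omega>)"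
    by (rule locally_integrable_measurable[OF open_domain]) (use g in \<open>simp add: has_weak_gradient_def\<close>)
  have "AE x in lebesgue_on \<Omega>. h x = grad \<Omega> u x"
    using has_weak_gradient_unique[OF open_domain h(2) g] .
  then have "AE x in lebesgue_on \<Omega>. (norm (h x))\<^sup>2 = (norm (grad \<Omega> u x))\<^sup>2"
    by eventually_elim simp
  moreover have "integrable (lebesgue_on \<Omega>) (\<lambda>x. (norm (h x))\<^sup>2)" using h(1) by (simp add: Lp2_integrable)
  moreover have "(\<lambda>x. (norm (grad \<Omega> u x))\<^sup>2) \<in> borel_measurable (lebesgue_on \<Omega>)" using gm by simp
  ultimately have "integrable (lebesgue_on \<Omega>) (\<lambda>x. (norm (grad \<Omega> u x))\<^sup>2)"
    by (rule AE_measurable_transfer)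
  with gm show ?thesis unfolding Lp2_integrable by (rule conjI)
qed

lemma H1_Lp2: "u \<in> H1 \<Omega> \<Longrightarrow> u \<in> Lp 2 \<Omega>"
  by (simp add: W1_def)

lemma H1_integrable:
  assumes "u \<in> H1 \<Omega>"
  shows "u \<in> borel_measurable (lebesgue_on \<Omega>)" "integrable (lebesgue_on \<Omega>) (\<lambda>x. (u x)\<^sup>2)"
    "grad \<Omega> u \<in> borel_measurable (lebesgue_on \<Omega>)" "integrable (lebesgue_on \<Omega>) (\<lambda>x. (norm (grad \<Omega> u x))\<^sup>2)"
  using H1_Lp2[OF assms] grad_Lp2[OF assms] by (auto simp: Lp2_integrable)

text \<open>The gradient of the difference is chosen independently of the other two. Since the
  difference of the chosen gradients is also a weak gradient, uniqueness gives linearity, but only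
  almost everywhere.\<close>

lemma H1_diff:
  assumes "u \<in> H1 \<Omega>" "w \<in> H1 \<Omega>"
  shows "(\<lambda>x. u x - w x) \<in> H1 \<Omega>"
    and "AE x in lebesgue_on \<Omega>. grad \<Omega> (\<lambda>x. u x - w x) x = grad \<Omega> u x - grad \<Omega> w x"
proof -
  have L2: "(\<lambda>x. f x - g x) \<in> Lp 2 \<Omega>" if "f \<in> Lp 2 \<Omega>" "g \<in> Lp 2 \<Omega>"
    for f g :: "real ^ 'n \<Rightarrow> 'c::euclidean_space"
  proof -
    have m: "(\<lambda>x. f x - g x) \<in> borel_measurable (lebesgue_on \<Omega>)"
      using that unfolding Lp2_integrable by (intro borel_measurable_diff) auto
    moreover have "integrable (lebesgue_on \<Omega>) (\<lambda>x. (norm (f x - g x))\<^sup>2)"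
    proof (rule Bochner_Integration.integrable_bound)
      show "integrable (lebesgue_on \<Omega>) (\<lambda>x. 2 * (norm (f x))\<^sup>2 + 2 * (norm (g x))\<^sup>2)"
        using that by (simp add: Lp2_integrable)
      show "(\<lambda>x. (norm (f x - g x))\<^sup>2) \<in> borel_measurable (lebesgue_on \<Omega>)" using m by simp
      have "(norm (f x - g x))\<^sup>2 \<le> 2 * (norm (f x))\<^sup>2 + 2 * (norm (g x))\<^sup>2" for x
        using zero_le_power2[of "norm (f x + g x)"]
        by (simp add: power2_norm_eq_inner inner_diff_left inner_diff_right inner_add_left inner_add_right inner_commute)
      then show "AE x in lebesgue_on \<Omega>. norm ((norm (f x - g x))\<^sup>2) \<le> norm (2 * (norm (f x))\<^sup>2 + 2 * (norm (g x))\<^sup>2)"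
        by (intro AE_I2) simp
    qed
    ultimately show ?thesis by (simp add: Lp2_integrable)
  qed
  note d = has_weak_gradient_diff[OF open_domain H1_has_weak_gradient[OF assms(1)] H1_has_weak_gradient[OF assms(2)]]
  show 1: "(\<lambda>x. u x - w x) \<in> H1 \<Omega>"
    unfolding W1_def using L2[OF H1_Lp2[OF assms(1)] H1_Lp2[OF assms(2)]] L2[OF grad_Lp2[OF assms(1)] grad_Lp2[OF assms(2)]] d
    by blast
  show "AE x in lebesgue_on \<Omega>. grad \<Omega> (\<lambda>x. u x - w x) x = grad \<Omega> u x - grad \<Omega> w x"
    by (rule has_weak_gradient_unique[OF open_domain H1_has_weak_gradient[OF 1] d])
qed

lemma triangulation_finite: "finite \<T>"
  and triangle: "T \<in> \<T> \<Longrightarrow> convex T" "T \<in> \<T> \<Longrightarrow> bounded T" "T \<in> \<T> \<Longrightarrow> interior T \<subseteq> \<Omega>"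
  and triangles_cover: "\<Omega> \<subseteq> \<Union>\<T>"
  using triangulated convex_simplex compact_simplex compact_imp_bounded closure_subset[of \<Omega>]
  unfolding conforming_triangulation_def triangulation_def by blast+

text \<open>Frontiers of convex sets are negligible and there are finitely many cells. The estimates
  on cell interiors therefore cover the domain up to a null set.\<close>

lemma AE_in_triangle_interior: "AE x in lebesgue. x \<in> \<Omega> \<longrightarrow> (\<exists>T\<in>\<T>. x \<in> interior T)"
proof -
  have "negligible (\<Union>(frontier ` \<T>))"
    using triangulation_finite triangle(1) negligible_convex_frontier by (intro negligible_Union) auto
  then have "\<Union>(frontier ` \<T>) \<in> null_sets lebesgue"
    by (simp only: negligible_iff_null_sets)
  then have "AE x in lebesgue. x \<notin> \<Union>(frontier ` \<T>)"
    by (rule AE_not_in)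
  then show ?thesis
  proof eventually_elim
    case (elim x)
    show ?case
    proof
      assume "x \<in> \<Omega>"
      then obtain T where T: "T \<in> \<T>" "x \<in> T" using triangles_cover by blast
      then have "x \<in> interior T"
        using elim closure_subset by (force simp: frontier_def)
      with T show "\<exists>T\<in>\<T>. x \<in> interior T" by blast
    qed
  qed
qed

text \<open>The sum of the cellwise integrable functions dominates almost everywhere, because nearly
  every point lies in some cell interior and all summands are nonnegative.\<close>

theorem sobolev_embedding:
  assumes u: "u \<in> H1 \<Omega>" and p: "2 \<le> p" "real CARD('n) * (p / 2 - 1) < p"
  shows "integrable (lebesgue_on \<Omega>) (\<lambda>x. \<bar>u x\<bar> powr p)"
  unfolding integrable_lebesgue_on_iff[OF domain_sets]
proof (rule Bochner_Integration.integrable_bound)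
  have "integrable (lebesgue_on (interior T)) (\<lambda>x. \<bar>u x\<bar> powr p)" if "T \<in> \<T>" for T
    by (rule sobolev_embedding_convex[OF open_domain H1_has_weak_gradient[OF u]
        Lp2_imp_integrable[OF domain_sets bounded_domain H1_Lp2[OF u]]
        Lp2_imp_integrable[OF domain_sets bounded_domain grad_Lp2[OF u]] H1_integrable(4)[OF u] triangle[OF that] p])
  then show "integrable lebesgue (\<lambda>x. \<Sum>T\<in>\<T>. indicator (interior T) x *\<^sub>R (\<bar>u x\<bar> powr p))"
    by (intro Bochner_Integration.integrable_sum) (simp add: integrable_lebesgue_on_iff)
  have "(\<lambda>x. \<bar>u x\<bar> powr p) \<in> borel_measurable (lebesgue_on \<Omega>)"
    using H1_integrable(1)[OF u] by measurable
  then show "(\<lambda>x. indicator \<Omega> x *\<^sub>R (\<bar>u x\<bar> powr p)) \<in> borel_measurable lebesgue"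
    by (rule iffD1[OF borel_measurable_lebesgue_on_iff[OF domain_sets]])
  show "AE x in lebesgue. norm (indicator \<Omega> x *\<^sub>R (\<bar>u x\<bar> powr p)) \<le> norm (\<Sum>T\<in>\<T>. indicator (interior T) x *\<^sub>R (\<bar>u x\<bar> powr p))"
    using AE_in_triangle_interior
  proof eventually_elim
    case (elim x)
    have nn: "0 \<le> (\<Sum>T\<in>\<T>. indicator (interior T) x *\<^sub>R (\<bar>u x\<bar> powr p))" by (intro sum_nonneg) simp
    show ?case
    proof (cases "x \<in> \<Omega>")
      case True
      with elim obtain T where T: "T \<in> \<T>" "x \<in> interior T" by blast
      have "\<bar>u x\<bar> powr p = indicator (interior T) x *\<^sub>R (\<bar>u x\<bar> powr p)" using T by simp
      also have "\<dots> \<le> (\<Sum>T\<in>\<T>. indicator (interior T) x *\<^sub>R (\<bar>u x\<bar> powr p))"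
        using T by (intro member_le_sum triangulation_finite) auto
      finally show ?thesis using True by simp
    qed (use nn in simp)
  qed
qed

text \<open>For \<open>p = 4\<close> the Sobolev condition reads \<open>n < 4\<close>.\<close>

lemma H1_integrable_fourth_power:
  assumes "u \<in> H1 \<Omega>" "CARD('n) = 2 \<or> CARD('n) = 3"
  shows "integrable (lebesgue_on \<Omega>) (\<lambda>x. (u x) ^ 4)"
proof -
  have "\<bar>u x\<bar> powr 4 = (u x) ^ 4" for x by (cases "u x = 0") (auto simp: powr_numeral)
  then show ?thesis using sobolev_embedding[OF assms(1), of 4] assms(2) by auto
qed

lemma H_div_component: "v \<in> H_div \<Omega> \<Longrightarrow> (\<lambda>x. v x $ i) \<in> H1 \<Omega>"
  by (simp add: H_div_def H1_0_def)

lemma H_div_Lp2: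
  assumes v: "v \<in> H_div \<Omega>" shows "v \<in> Lp 2 \<Omega>"
proof -
  have "v \<in> borel_measurable (lebesgue_on \<Omega>)"
    using H1_integrable(1)[OF H_div_component[OF v]]
    by (subst borel_measurable_euclidean_space) (auto simp: Basis_vec_def inner_axis)
  moreover have "(norm (v x))\<^sup>2 = (\<Sum>i\<in>UNIV. (v x $ i)\<^sup>2)" for x
    unfolding power2_norm_eq_inner inner_vec_def by (simp add: power2_eq_square)
  ultimately show ?thesis
    using H1_integrable(2)[OF H_div_component[OF v]] by (simp add: Lp2_integrable)
qed

text \<open>Young's inequality used twice gives
  \<open>\<bar>a * (b * c)\<bar> \<le> b^2 + (a^4 + c^4)\<close>: the gradient is only square
  integrable, so the other two factors have to be integrable to the fourth power.\<close>

lemma integrable_capillary_work: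
  assumes \<mu>: "\<mu> \<in> H1 \<Omega>" and \<phi>: "\<phi> \<in> H1 \<Omega>" and v: "v \<in> H_div \<Omega>" and dim: "CARD('n) = 2 \<or> CARD('n) = 3"
  shows "integrable (lebesgue_on \<Omega>) (\<lambda>x. (\<mu> x *\<^sub>R grad \<Omega> \<phi> x) \<bullet> v x)"
proof -
  have "integrable (lebesgue_on \<Omega>) (\<lambda>x. \<mu> x * (grad \<Omega> \<phi> x $ i * v x $ i))" for i
  proof (rule Bochner_Integration.integrable_bound)
    show "integrable (lebesgue_on \<Omega>) (\<lambda>x. (norm (grad \<Omega> \<phi> x))\<^sup>2 + ((\<mu> x) ^ 4 + (v x $ i) ^ 4))"
      using H1_integrable_fourth_power dim \<mu> H_div_component[OF v] H1_integrable(4)[OF \<phi>]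
      by (intro Bochner_Integration.integrable_add) auto
    have "(\<lambda>x. grad \<Omega> \<phi> x $ i) \<in> borel_measurable (lebesgue_on \<Omega>)"
      using borel_measurable_continuous_on[OF _ H1_integrable(3)[OF \<phi>], of "\<lambda>y. y $ i"] by (simp add: continuous_intros)
    then show "(\<lambda>x. \<mu> x * (grad \<Omega> \<phi> x $ i * v x $ i)) \<in> borel_measurable (lebesgue_on \<Omega>)"
      using H1_integrable(1)[OF \<mu>] H1_integrable(1)[OF H_div_component[OF v]] by measurable
    show "AE x in lebesgue_on \<Omega>. norm (\<mu> x * (grad \<Omega> \<phi> x $ i * v x $ i)) \<le> norm ((norm (grad \<Omega> \<phi> x))\<^sup>2 + ((\<mu> x) ^ 4 + (v x $ i) ^ 4))"
    proof (rule AE_I2)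
      fix x
      have "\<bar>a * (b * c)\<bar> \<le> b\<^sup>2 + (a ^ 4 + c ^ 4)" for a b c :: real
      proof -
        have "\<bar>a * (b * c)\<bar> = \<bar>b\<bar> * \<bar>a * c\<bar>" by (simp add: abs_mult)
        moreover have "2 * \<bar>b\<bar> * \<bar>a * c\<bar> \<le> b\<^sup>2 + (a * c)\<^sup>2"
          using sum_squares_bound[of "\<bar>b\<bar>" "\<bar>a * c\<bar>"] by (simp only: power2_abs)
        moreover have "2 * (a * c)\<^sup>2 \<le> a ^ 4 + c ^ 4"
          using sum_squares_bound[of "a\<^sup>2" "c\<^sup>2"] by (simp add: power_mult_distrib)
        moreover have "0 \<le> b\<^sup>2" "0 \<le> a ^ 4" "0 \<le> c ^ 4" by simp_all
        ultimately show ?thesis by linarith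
      qed
      then have "norm (\<mu> x * (grad \<Omega> \<phi> x $ i * v x $ i)) \<le> (grad \<Omega> \<phi> x $ i)\<^sup>2 + ((\<mu> x) ^ 4 + (v x $ i) ^ 4)"
        by simp
      also have "(grad \<Omega> \<phi> x $ i)\<^sup>2 \<le> (norm (grad \<Omega> \<phi> x))\<^sup>2"
        using component_le_norm_cart[of "grad \<Omega> \<phi> x" i] by (metis abs_ge_zero power2_abs power_mono)
      finally show "norm (\<mu> x * (grad \<Omega> \<phi> x $ i * v x $ i)) \<le> norm ((norm (grad \<Omega> \<phi> x))\<^sup>2 + ((\<mu> x) ^ 4 + (v x $ i) ^ 4))"
        by simp
    qed
  qed
  then have "integrable (lebesgue_on \<Omega>) (\<lambda>x. \<Sum>i\<in>UNIV. \<mu> x * (grad \<Omega> \<phi> x $ i * v x $ i))"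
    by (intro Bochner_Integration.integrable_sum)
  then show ?thesis by (simp add: inner_vec_def mult.assoc)
qed

end

section \<open>Integrability and measurability of the individual terms\<close>

lemma integrable_weighted_inner:
  fixes f g :: "'a \<Rightarrow> 'b::euclidean_space"
  assumes c: "c \<in> borel_measurable M" "\<And>x. \<bar>c x\<bar> \<le> B"
    and f: "f \<in> borel_measurable M" "integrable M (\<lambda>x. (norm (f x))\<^sup>2)"
    and g: "g \<in> borel_measurable M" "integrable M (\<lambda>x. (norm (g x))\<^sup>2)"
  shows "integrable M (\<lambda>x. c x * (f x \<bullet> g x) :: real)"
proof -
  have "integrable M (\<lambda>x. f x \<bullet> g x)"
  proof (rule Bochner_Integration.integrable_bound)
    show "integrable M (\<lambda>x. (norm (f x))\<^sup>2 + (norm (g x))\<^sup>2)" using f g by simp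
    show "(\<lambda>x. f x \<bullet> g x) \<in> borel_measurable M" using f g by simp
    show "AE x in M. norm (f x \<bullet> g x) \<le> norm ((norm (f x))\<^sup>2 + (norm (g x))\<^sup>2)"
    proof (rule AE_I2)
      fix x
      have "\<bar>f x \<bullet> g x\<bar> \<le> norm (f x) * norm (g x)" by (rule Cauchy_Schwarz_ineq2)
      also have "\<dots> \<le> (norm (f x))\<^sup>2 + (norm (g x))\<^sup>2"
        using sum_squares_bound[of "norm (f x)" "norm (g x)"] mult_nonneg_nonneg[OF norm_ge_zero norm_ge_zero, of "f x" "g x"]
        unfolding mult.assoc by linarith
      finally show "norm (f x \<bullet> g x) \<le> norm ((norm (f x))\<^sup>2 + (norm (g x))\<^sup>2)" by simp
    qed
  qed
  from integrable_mult_bounded[OF this c] show ?thesis by (simp add: mult.commute)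
qed

text \<open>The two parts of the energy density are assumed differentiable, with no continuity of
  their derivatives stated; a pointwise limit of continuous difference quotients is measurable all
  the same.\<close>

lemma borel_measurable_derivative:
  fixes f :: "real \<Rightarrow> real"
  assumes "\<And>s. f differentiable (at s)"
  shows "deriv f \<in> borel_measurable borel"
proof (rule borel_measurable_LIMSEQ_real)
  have D: "(f has_real_derivative deriv f s) (at s)" for s
    using assms DERIV_deriv_iff_real_differentiable by blast
  have "continuous_on UNIV f"
    using D by (intro continuous_at_imp_continuous_on ballI DERIV_isCont)
  then have [measurable]: "f \<in> borel_measurable borel" by (rule borel_measurable_continuous_onI)
  show "(\<lambda>s. (f (s + 1 / real (Suc n)) - f s) / (1 / real (Suc n))) \<in> borel_measurable borel" for n
    by measurable
  fix s
  have "((\<lambda>h. (f (s + h) - f s) / h) \<longlongrightarrow> deriv f s) (at 0)" using D[of s] by (simp add: DERIV_def)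
  moreover have "filterlim (\<lambda>n. 1 / real (Suc n)) (at 0) sequentially"
    unfolding filterlim_at using LIMSEQ_inverse_real_of_nat by (simp add: inverse_eq_divide)
  ultimately show "(\<lambda>n. (f (s + 1 / real (Suc n)) - f s) / (1 / real (Suc n))) \<longlonglongrightarrow> deriv f s"
    by (rule filterlim_compose)
qed

lemma convex_above_tangent:
  fixes f :: "real \<Rightarrow> real"
  assumes "convex_on UNIV f" "\<And>s. f differentiable (at s)"
  shows "f t - f s \<ge> deriv f s * (t - s)"
proof -
  have "(f has_real_derivative deriv f s) (at s)"
    using assms(2) DERIV_deriv_iff_real_differentiable by blast
  from convex_on_imp_above_tangent[OF assms(1) _ _ _ this, of t] show ?thesis by simp
qed

lemma powr_le_one_plus_powr:
  fixes x a b :: real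
  assumes "0 \<le> x" "0 \<le> a" "a \<le> b"
  shows "x powr a \<le> 1 + x powr b"
proof (cases "x \<le> 1")
  case True
  then have "x powr a \<le> 1" using assms by (intro powr_le1) auto
  then show ?thesis by (smt (verit) powr_ge_zero)
next
  case False
  then have "x powr a \<le> x powr b" using assms by (intro powr_mono) auto
  then show ?thesis by simp
qed

text \<open>The 2 collects the constant of the growth bound and the 1 lost in passing from exponent
  \<open>q\<close> to the larger \<open>p\<close>.\<close>

lemma growth_bound_le:
  assumes "growth_bound C q f" "0 \<le> C" "0 \<le> q" "q \<le> p"
  shows "\<bar>f s\<bar> \<le> C * (2 + \<bar>s\<bar> powr p)"
proof -
  have "\<bar>f s\<bar> \<le> C * (1 + (if q = 0 then 1 else \<bar>s\<bar> powr q))" using assms(1) by (simp add: growth_bound_def)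
  also have "\<dots> \<le> C * (2 + \<bar>s\<bar> powr p)"
    using powr_le_one_plus_powr[of "\<bar>s\<bar>" q p] assms by (intro mult_left_mono) auto
  finally show ?thesis .
qed

text \<open>Both arguments are replaced by their maximum \<open>m\<close>, so that the missing power
  is restored: \<open>m powr (q - 1) * m\<close> is \<open>m powr q\<close>. The 3 counts two copies
  of \<open>m\<close> and one of \<open>m powr q\<close>, each at most
  \<open>1 + m powr p\<close>.\<close>

lemma growth_bound_mult_le:
  assumes f: "growth_bound C (q - 1) f" and C: "0 \<le> C" and q: "1 \<le> q" "q \<le> p"
  shows "\<bar>f s * t\<bar> \<le> C * (3 + 3 * \<bar>s\<bar> powr p + 3 * \<bar>t\<bar> powr p)"
proof -
  define m where "m = max \<bar>s\<bar> \<bar>t\<bar>"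
  have m: "0 \<le> m" "\<bar>s\<bar> \<le> m" "\<bar>t\<bar> \<le> m" by (auto simp: m_def)
  have "\<bar>f s\<bar> \<le> C * (1 + (if q - 1 = 0 then 1 else \<bar>s\<bar> powr (q - 1)))" using f by (simp add: growth_bound_def)
  also have "\<dots> \<le> C * (2 + m powr (q - 1))"
    using C powr_mono2[of "q - 1" "\<bar>s\<bar>" m] q m by (intro mult_left_mono) (auto simp: add_increasing)
  finally have "\<bar>f s\<bar> * \<bar>t\<bar> \<le> (C * (2 + m powr (q - 1))) * m"
    using m C by (intro mult_mono) (auto simp: add_nonneg_nonneg)
  also have "\<dots> = C * (2 * m powr 1 + m powr (q - 1) * m powr 1)"
    using m by (simp add: algebra_simps)
  also have "m powr (q - 1) * m powr 1 = m powr q" by (simp only: powr_add[symmetric] diff_add_cancel)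
  also have "C * (2 * m powr 1 + m powr q) \<le> C * (3 + 3 * m powr p)"
    using powr_le_one_plus_powr[of m 1 p] powr_le_one_plus_powr[of m q p] m q C
    by (intro mult_left_mono) auto
  also have "\<dots> \<le> C * (3 + 3 * \<bar>s\<bar> powr p + 3 * \<bar>t\<bar> powr p)"
    using C by (intro mult_left_mono) (auto simp: m_def max_def)
  finally show ?thesis by (simp add: abs_mult)
qed

theorem theorem7:
  fixes \<Omega> :: "(real ^ 'n) set"
    and \<sigma> \<epsilon> \<tau> :: real
    and g :: "real ^ 'n \<Rightarrow> real ^ 'n"
    and \<rho> \<eta> m :: "real \<Rightarrow> real"
    and \<rho>lo \<rho>hi \<eta>lo \<eta>hi mlo mhi \<rho>1 \<rho>2 :: real
    and F Fp Fm :: "real \<Rightarrow> real"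
    and C q r :: real
    and G :: "(real ^ 'n \<Rightarrow> real) \<Rightarrow> (real ^ 'n \<Rightarrow> real) \<Rightarrow> (real ^ 'n \<Rightarrow> real) \<Rightarrow> real"
    and v v_new :: "real ^ 'n \<Rightarrow> real ^ 'n"
    and \<phi>_old \<phi> \<phi>_new \<mu> \<mu>_new :: "real ^ 'n \<Rightarrow> real"
  assumes dim: "CARD('n) = 2 \<or> CARD('n) = 3"
    and domain: "open \<Omega>" "connected \<Omega>" "\<Omega> \<noteq> {}" "bounded \<Omega>"
    and triangulable: "\<exists>\<T>. conforming_triangulation \<Omega> \<T>"
    and constants: "\<sigma> > 0" "\<epsilon> > 0" "\<tau> > 0"
    and gravity: "g \<in> Lp 2 \<Omega>"
    \<comment> \<open>coefficients\<close>
    and continuity: "continuous_on UNIV \<rho>" "continuous_on UNIV \<eta>" "continuous_on UNIV m"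
    and \<rho>_bounds: "\<rho>lo > 0" "\<And>s. \<rho>lo \<le> \<rho> s \<and> \<rho> s \<le> \<rho>hi"
    and \<eta>_bounds: "\<eta>lo > 0" "\<And>s. \<eta>lo \<le> \<eta> s \<and> \<eta> s \<le> \<eta>hi"
    and m_bounds: "mlo > 0" "\<And>s. mlo \<le> m s \<and> m s \<le> mhi"
    and \<rho>_smooth: "\<And>k s. ((deriv ^^ k) \<rho>) differentiable (at s)"
    and \<rho>_mono: "mono \<rho>"
    and \<rho>_law: "0 < \<rho>1" "\<rho>1 \<le> \<rho>2" "density_law \<rho>1 \<rho>2 \<rho>"
    \<comment> \<open>free energy density\<close>
    and F_split: "\<And>s. F s = Fp s + Fm s"
    and F_C1: "\<And>s. F differentiable (at s)" "continuous_on UNIV (deriv F)"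
    and Fp: "convex_on UNIV Fp" "\<And>s. Fp differentiable (at s)"
    and Fm: "concave_on UNIV Fm" "\<And>s. Fm differentiable (at s)"
    and exponent: "1 \<le> q" "CARD('n) = 3 \<Longrightarrow> q \<le> 4"
    and growth: "C > 0" "growth_bound C q F"
      "growth_bound C (q - 1) (deriv Fp)" "growth_bound C (q - 1) (deriv Fm)"
    and newton: "newton_derivative \<Omega> (superposition_operator \<Omega> (deriv Fp)) G"
    and newton_nonneg: "\<And>\<phi> \<delta>. \<phi> \<in> H1 \<Omega> \<Longrightarrow> \<delta> \<in> H1 \<Omega> \<Longrightarrow> G \<phi> \<delta> \<delta> \<ge> 0"
    \<comment> \<open>given data of the previous time steps\<close>
    and v: "v \<in> H_div \<Omega>"
    and \<phi>: "\<phi>_old \<in> H1 \<Omega>" "\<phi> \<in> H1 \<Omega>"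
    and \<mu>: "r > CARD('n)" "\<mu> \<in> W1 r \<Omega>"
    \<comment> \<open>solution of the time discrete system\<close>
    and new: "v_new \<in> H_div \<Omega>" "\<phi>_new \<in> H1 \<Omega>" "\<mu>_new \<in> H1 \<Omega>"
    and momentum: "\<And>w. w \<in> H_div \<Omega> \<Longrightarrow>
      1 / (2 * \<tau>) * (LINT x|lebesgue_on \<Omega>.
          (\<rho> (\<phi> x) *\<^sub>R v_new x - \<rho> (\<phi>_old x) *\<^sub>R v x) \<bullet> w x
          + (\<rho> (\<phi>_old x) *\<^sub>R (v_new x - v x)) \<bullet> w x)
      + trilinear_form \<Omega> (\<lambda>x. \<rho> (\<phi> x) *\<^sub>R v x + mass_flux \<Omega> \<rho> m \<phi> \<mu> x) v_new w
      + (LINT x|lebesgue_on \<Omega>. 2 * \<eta> (\<phi> x) * (sym_grad \<Omega> v_new x \<bullet> sym_grad \<Omega> w x))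
      - (LINT x|lebesgue_on \<Omega>. (\<mu>_new x *\<^sub>R grad \<Omega> \<phi> x) \<bullet> w x + (\<rho> (\<phi> x) *\<^sub>R g x) \<bullet> w x) = 0"
    and phase: "\<And>\<Phi>. \<Phi> \<in> H1 \<Omega> \<Longrightarrow>
      1 / \<tau> * (LINT x|lebesgue_on \<Omega>. (\<phi>_new x - \<phi> x) * \<Phi> x)
      + (LINT x|lebesgue_on \<Omega>. (v_new x \<bullet> grad \<Omega> \<phi> x) * \<Phi> x)
      + (LINT x|lebesgue_on \<Omega>. m (\<phi> x) * (grad \<Omega> \<mu>_new x \<bullet> grad \<Omega> \<Phi> x)) = 0"
    and potential: "\<And>\<Psi>. \<Psi> \<in> H1 \<Omega> \<Longrightarrow>
      \<sigma> * \<epsilon> * (LINT x|lebesgue_on \<Omega>. grad \<Omega> \<phi>_new x \<bullet> grad \<Omega> \<Psi> x)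
      - (LINT x|lebesgue_on \<Omega>. \<mu>_new x * \<Psi> x)
      + (LINT x|lebesgue_on \<Omega>. (deriv Fp (\<phi>_new x) + deriv Fm (\<phi> x)) * \<Psi> x) = 0"
  shows
    "1/2 * (LINT x|lebesgue_on \<Omega>. \<rho> (\<phi> x) * (norm (v_new x))\<^sup>2)
     + \<sigma> * \<epsilon> / 2 * (LINT x|lebesgue_on \<Omega>. (norm (grad \<Omega> \<phi>_new x))\<^sup>2)
     + (LINT x|lebesgue_on \<Omega>. F (\<phi>_new x))
     + 1/2 * (LINT x|lebesgue_on \<Omega>. \<rho> (\<phi>_old x) * (norm (v_new x - v x))\<^sup>2)
     + \<sigma> * \<epsilon> / 2 * (LINT x|lebesgue_on \<Omega>. (norm (grad \<Omega> \<phi>_new x - grad \<Omega> \<phi> x))\<^sup>2)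
     + \<tau> * (LINT x|lebesgue_on \<Omega>. 2 * \<eta> (\<phi> x) * (norm (sym_grad \<Omega> v_new x))\<^sup>2)
     + \<tau> * (LINT x|lebesgue_on \<Omega>. m (\<phi> x) * (norm (grad \<Omega> \<mu>_new x))\<^sup>2)
     \<le> 1/2 * (LINT x|lebesgue_on \<Omega>. \<rho> (\<phi>_old x) * (norm (v x))\<^sup>2)
     + \<sigma> * \<epsilon> / 2 * (LINT x|lebesgue_on \<Omega>. (norm (grad \<Omega> \<phi> x))\<^sup>2)
     + (LINT x|lebesgue_on \<Omega>. F (\<phi> x))
     + \<tau> * (LINT x|lebesgue_on \<Omega>. (\<rho> (\<phi> x) *\<^sub>R g x) \<bullet> v_new x)"
proof -
  obtain \<T> where \<T>: "conforming_triangulation \<Omega> \<T>" using triangulable by blast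
  interpret sobolev_domain \<Omega> \<T> by unfold_locales (use domain \<T> in auto)
  let ?M = "lebesgue_on \<Omega>"
  have cm: "(\<lambda>x. c (\<psi> x)) \<in> borel_measurable ?M" if "continuous_on UNIV c" "\<psi> \<in> H1 \<Omega>" for c :: "real \<Rightarrow> real" and \<psi>
    using borel_measurable_continuous_on[OF that(1) H1_integrable(1)[OF that(2)]] .
  have vL: "v \<in> borel_measurable ?M" "integrable ?M (\<lambda>x. (norm (v x))\<^sup>2)"
    and vnL: "v_new \<in> borel_measurable ?M" "integrable ?M (\<lambda>x. (norm (v_new x))\<^sup>2)"
    and gL: "g \<in> borel_measurable ?M" "integrable ?M (\<lambda>x. (norm (g x))\<^sup>2)"
    using H_div_Lp2[OF v] H_div_Lp2[OF new(1)] gravity by (auto simp: Lp2_integrable)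
  note \<rho>m = cm[OF continuity(1) \<phi>(1)] cm[OF continuity(1) \<phi>(2)]
  have \<rho>b: "\<bar>\<rho> s\<bar> \<le> \<rho>hi" for s using \<rho>_bounds by (smt (verit))

  \<comment> \<open>The momentum balance\<close>
  define a where "a = (LINT x|?M. \<rho> (\<phi> x) * (norm (v_new x))\<^sup>2)"
  define b where "b = (LINT x|?M. \<rho> (\<phi>_old x) * (norm (v_new x - v x))\<^sup>2)"
  define c where "c = (LINT x|?M. \<rho> (\<phi>_old x) * (norm (v x))\<^sup>2)"
  define visc where "visc = (LINT x|?M. 2 * \<eta> (\<phi> x) * (norm (sym_grad \<Omega> v_new x))\<^sup>2)"
  define cap where "cap = (LINT x|?M. (\<mu>_new x *\<^sub>R grad \<Omega> \<phi> x) \<bullet> v_new x)"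
  define grav where "grav = (LINT x|?M. (\<rho> (\<phi> x) *\<^sub>R g x) \<bullet> v_new x)"
  have ia: "integrable ?M (\<lambda>x. \<rho> (\<phi> x) * (norm (v_new x))\<^sup>2)"
    unfolding power2_norm_eq_inner by (rule integrable_weighted_inner[OF \<rho>m(2) \<rho>b vnL vnL])
  have ic: "integrable ?M (\<lambda>x. \<rho> (\<phi>_old x) * (norm (v x))\<^sup>2)"
    unfolding power2_norm_eq_inner by (rule integrable_weighted_inner[OF \<rho>m(1) \<rho>b vL vL])
  have ib: "integrable ?M (\<lambda>x. \<rho> (\<phi>_old x) * (norm (v_new x - v x))\<^sup>2)"
  proof -
    have "integrable ?M (\<lambda>x. \<rho> (\<phi>_old x) * (v_new x \<bullet> v_new x) - 2 * (\<rho> (\<phi>_old x) * (v_new x \<bullet> v x)) + \<rho> (\<phi>_old x) * (v x \<bullet> v x))"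
      by (intro Bochner_Integration.integrable_add Bochner_Integration.integrable_diff integrable_mult_right
          integrable_weighted_inner[OF \<rho>m(1) \<rho>b] vnL vL)
    then show ?thesis
      by (simp add: power2_norm_eq_inner inner_diff_left inner_diff_right inner_commute algebra_simps)
  qed
  have icap: "integrable ?M (\<lambda>x. (\<mu>_new x *\<^sub>R grad \<Omega> \<phi> x) \<bullet> v_new x)"
    using integrable_capillary_work[OF new(3) \<phi>(2) new(1) dim] .
  have igrav: "integrable ?M (\<lambda>x. (\<rho> (\<phi> x) *\<^sub>R g x) \<bullet> v_new x)"
    unfolding inner_scaleR_left by (rule integrable_weighted_inner[OF \<rho>m(2) \<rho>b gL vnL])
  have mom: "1 / (2 * \<tau>) * (a + b - c) + visc - (cap + grav) = 0"
  proof -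
    \<comment> \<open>Completing the square in the terms weighted with the old density turns the
      discrete time derivative into a difference of kinetic energies plus the numerical dissipation
      \<open>b\<close>.\<close>
    have "(\<rho> (\<phi> x) *\<^sub>R v_new x - \<rho> (\<phi>_old x) *\<^sub>R v x) \<bullet> v_new x + (\<rho> (\<phi>_old x) *\<^sub>R (v_new x - v x)) \<bullet> v_new x
       = \<rho> (\<phi> x) * (norm (v_new x))\<^sup>2 + \<rho> (\<phi>_old x) * (norm (v_new x - v x))\<^sup>2 - \<rho> (\<phi>_old x) * (norm (v x))\<^sup>2" for x
      unfolding power2_norm_eq_inner by (simp add: inner_diff_left inner_diff_right inner_commute algebra_simps)
    then have "(LINT x|?M. (\<rho> (\<phi> x) *\<^sub>R v_new x - \<rho> (\<phi>_old x) *\<^sub>R v x) \<bullet> v_new x + (\<rho> (\<phi>_old x) *\<^sub>R (v_new x - v x)) \<bullet> v_new x)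
       = a + b - c"
      using ia ib ic by (simp add: a_def b_def c_def)
    moreover have "(LINT x|?M. (\<mu>_new x *\<^sub>R grad \<Omega> \<phi> x) \<bullet> v_new x + (\<rho> (\<phi> x) *\<^sub>R g x) \<bullet> v_new x) = cap + grav"
      unfolding cap_def grav_def by (rule Bochner_Integration.integral_add[OF icap igrav])
    moreover have "(LINT x|?M. 2 * \<eta> (\<phi> x) * (sym_grad \<Omega> v_new x \<bullet> sym_grad \<Omega> v_new x)) = visc"
      unfolding visc_def power2_norm_eq_inner ..
    \<comment> \<open>With equal second and third arguments the two integrals in the form are
      literally the same real number, so they cancel.\<close>
    moreover have "trilinear_form \<Omega> (\<lambda>x. \<rho> (\<phi> x) *\<^sub>R v x + mass_flux \<Omega> \<rho> m \<phi> \<mu> x) v_new v_new = 0"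
      unfolding trilinear_form_def by (rule diff_self)
    ultimately show ?thesis using momentum[OF new(1)] by (simp only: add_0_right)
  qed

  \<comment> \<open>The phase balance\<close>
  define X where "X = (LINT x|?M. (\<phi>_new x - \<phi> x) * \<mu>_new x)"
  define diss where "diss = (LINT x|?M. m (\<phi> x) * (norm (grad \<Omega> \<mu>_new x))\<^sup>2)"
  have phs: "1 / \<tau> * X + cap + diss = 0"
  proof -
    \<comment> \<open>The transport term is the same integral as the capillary work in the momentum
      balance, so \<open>cap\<close> names both and can be eliminated later.\<close>
    have "(\<lambda>x. (v_new x \<bullet> grad \<Omega> \<phi> x) * \<mu>_new x) = (\<lambda>x. (\<mu>_new x *\<^sub>R grad \<Omega> \<phi> x) \<bullet> v_new x)"
      by (simp add: inner_commute mult.commute)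
    then show ?thesis
      using phase[OF new(3)] unfolding X_def cap_def diss_def power2_norm_eq_inner by simp
  qed

  \<comment> \<open>The chemical potential balance\<close>
  define d where "d = (LINT x|?M. (norm (grad \<Omega> \<phi>_new x))\<^sup>2)"
  define e where "e = (LINT x|?M. (norm (grad \<Omega> \<phi> x))\<^sup>2)"
  define f where "f = (LINT x|?M. (norm (grad \<Omega> \<phi>_new x - grad \<Omega> \<phi> x))\<^sup>2)"
  define N where "N = (LINT x|?M. (deriv Fp (\<phi>_new x) + deriv Fm (\<phi> x)) * (\<phi>_new x - \<phi> x))"
  note gn = H1_integrable(3,4)[OF new(2)] and gp = H1_integrable(3,4)[OF \<phi>(2)]
  have pot: "\<sigma> * \<epsilon> * ((d - e + f) / 2) - X + N = 0"
  proof -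
    have ip: "integrable ?M (\<lambda>x. grad \<Omega> \<phi>_new x \<bullet> grad \<Omega> \<phi> x)"
      using integrable_weighted_inner[of "\<lambda>_. 1" ?M 1, OF _ _ gn gp] by simp
    have i_f: "integrable ?M (\<lambda>x. (norm (grad \<Omega> \<phi>_new x - grad \<Omega> \<phi> x))\<^sup>2)"
    proof -
      have "integrable ?M (\<lambda>x. (norm (grad \<Omega> \<phi>_new x))\<^sup>2 - 2 * (grad \<Omega> \<phi>_new x \<bullet> grad \<Omega> \<phi> x) + (norm (grad \<Omega> \<phi> x))\<^sup>2)"
        using gn gp ip by simp
      then show ?thesis
        unfolding power2_norm_eq_inner by (simp add: inner_diff_left inner_diff_right inner_commute algebra_simps)
    qed
    \<comment> \<open>The identity \<open>p \<bullet> (p - q) = (p \<bullet> p - q \<bullet> q + (p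
      - q) \<bullet> (p - q)) / 2\<close>, valid only almost everywhere here because the gradient of
      the difference is a separate choice.\<close>
    have "(LINT x|?M. grad \<Omega> \<phi>_new x \<bullet> grad \<Omega> (\<lambda>x. \<phi>_new x - \<phi> x) x)
       = (LINT x|?M. ((norm (grad \<Omega> \<phi>_new x))\<^sup>2 - (norm (grad \<Omega> \<phi> x))\<^sup>2 + (norm (grad \<Omega> \<phi>_new x - grad \<Omega> \<phi> x))\<^sup>2) / 2)"
    proof (rule integral_cong_AE)
      show "AE x in ?M. grad \<Omega> \<phi>_new x \<bullet> grad \<Omega> (\<lambda>x. \<phi>_new x - \<phi> x) x
         = ((norm (grad \<Omega> \<phi>_new x))\<^sup>2 - (norm (grad \<Omega> \<phi> x))\<^sup>2 + (norm (grad \<Omega> \<phi>_new x - grad \<Omega> \<phi> x))\<^sup>2) / 2"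
        using H1_diff(2)[OF new(2) \<phi>(2)]
      proof eventually_elim
        case (elim x)
        show ?case unfolding elim power2_norm_eq_inner
          by (simp add: inner_diff_left inner_diff_right inner_commute field_simps)
      qed
      show "(\<lambda>x. grad \<Omega> \<phi>_new x \<bullet> grad \<Omega> (\<lambda>x. \<phi>_new x - \<phi> x) x) \<in> borel_measurable ?M"
        using gn(1) H1_integrable(3)[OF H1_diff(1)[OF new(2) \<phi>(2)]] by (rule borel_measurable_inner)
      show "(\<lambda>x. ((norm (grad \<Omega> \<phi>_new x))\<^sup>2 - (norm (grad \<Omega> \<phi> x))\<^sup>2 + (norm (grad \<Omega> \<phi>_new x - grad \<Omega> \<phi> x))\<^sup>2) / 2) \<in> borel_measurable ?M"
        using gn(2) gp(2) i_f by (intro borel_measurable_integrable) simp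
    qed
    also have "\<dots> = (d - e + f) / 2"
      using gn(2) gp(2) i_f by (simp add: d_def e_def f_def)
    finally have eq: "(LINT x|?M. grad \<Omega> \<phi>_new x \<bullet> grad \<Omega> (\<lambda>x. \<phi>_new x - \<phi> x) x) = (d - e + f) / 2" .
    have "X = (LINT x|?M. \<mu>_new x * (\<phi>_new x - \<phi> x))" by (simp add: X_def mult.commute)
    then show ?thesis
      using potential[OF H1_diff(1)[OF new(2) \<phi>(2)], unfolded eq] by (simp only: N_def)
  qed

  \<comment> \<open>The bulk energy\<close>
  define p where "p = (if CARD('n) = 3 then 4 else max 4 q)"
  \<comment> \<open>In three dimensions the Sobolev condition means \<open>p < 6\<close>, and 4
    covers every admissible \<open>q\<close>. In the plane it reads \<open>p - 2 < p\<close>, so any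
    \<open>q\<close> can be accommodated.\<close>
  have p: "2 \<le> p" "q \<le> p" "real CARD('n) * (p / 2 - 1) < p"
    using dim exponent by (auto simp: p_def)
  have iP: "integrable ?M (\<lambda>x. \<bar>\<psi> x\<bar> powr p)" if "\<psi> \<in> H1 \<Omega>" for \<psi>
    using sobolev_embedding[OF that p(1,3)] .
  have const: "integrable ?M (\<lambda>x. k :: real)" for k
    using integrable_const_bounded[OF domain_sets bounded_domain] .
  have Fcont: "continuous_on UNIV F"
    using F_C1(1) by (intro continuous_at_imp_continuous_on ballI differentiable_imp_continuous_within)
  have iF: "integrable ?M (\<lambda>x. F (\<psi> x))" if \<psi>: "\<psi> \<in> H1 \<Omega>" for \<psi>
  proof (rule Bochner_Integration.integrable_bound)
    show "integrable ?M (\<lambda>x. C * (2 + \<bar>\<psi> x\<bar> powr p))"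
      by (intro integrable_mult_right Bochner_Integration.integrable_add const iP \<psi>)
    show "AE x in ?M. norm (F (\<psi> x)) \<le> norm (C * (2 + \<bar>\<psi> x\<bar> powr p))"
      unfolding real_norm_def
      by (intro AE_I2 order_trans[OF growth_bound_le[OF growth(2)] abs_ge_self]) (use growth(1) exponent(1) p(2) in auto)
  qed (rule cm[OF Fcont \<psi>])
  have iD: "integrable ?M (\<lambda>x. deriv f (\<psi> x) * \<xi> x)"
    if f: "\<And>s. f differentiable (at s)" "growth_bound C (q - 1) (deriv f)" and \<psi>: "\<psi> \<in> H1 \<Omega>" and \<xi>: "\<xi> \<in> H1 \<Omega>"
    for f :: "real \<Rightarrow> real" and \<psi> \<xi>
  proof (rule Bochner_Integration.integrable_bound)
    show "integrable ?M (\<lambda>x. C * (3 + 3 * \<bar>\<psi> x\<bar> powr p + 3 * \<bar>\<xi> x\<bar> powr p))"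
      by (intro integrable_mult_right Bochner_Integration.integrable_add const iP \<psi> \<xi>)
    show "(\<lambda>x. deriv f (\<psi> x) * \<xi> x) \<in> borel_measurable ?M"
      using measurable_compose[OF H1_integrable(1)[OF \<psi>] borel_measurable_derivative[OF f(1)]] H1_integrable(1)[OF \<xi>]
      by (rule borel_measurable_times)
    show "AE x in ?M. norm (deriv f (\<psi> x) * \<xi> x) \<le> norm (C * (3 + 3 * \<bar>\<psi> x\<bar> powr p + 3 * \<bar>\<xi> x\<bar> powr p))"
      unfolding real_norm_def
      by (intro AE_I2 order_trans[OF growth_bound_mult_le[OF f(2)] abs_ge_self]) (use growth(1) exponent(1) p(2) in auto)
  qed
  have energy: "(LINT x|?M. F (\<phi>_new x)) - (LINT x|?M. F (\<phi> x)) \<le> N"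
  proof -
    note dif = H1_diff(1)[OF new(2) \<phi>(2)]
    have i1: "integrable ?M (\<lambda>x. F (\<phi>_new x) - F (\<phi> x))" using iF[OF new(2)] iF[OF \<phi>(2)] by simp
    have i2: "integrable ?M (\<lambda>x. (deriv Fp (\<phi>_new x) + deriv Fm (\<phi> x)) * (\<phi>_new x - \<phi> x))"
      unfolding distrib_right
      using iD[OF Fp(2) growth(3) new(2) dif] iD[OF Fm(2) growth(4) \<phi>(2) dif] by (rule Bochner_Integration.integrable_add)
    \<comment> \<open>The tangents are taken at different points, as in the scheme: the convex part
      at the new value \<open>t\<close>, which it treats implicitly, and the concave part at the old
      value \<open>s\<close>, which it treats explicitly. Both tangent inequalities then point in
      the same direction.\<close>
    have "F t - F s \<le> (deriv Fp t + deriv Fm s) * (t - s)" for s t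
    proof -
      have "Fp s - Fp t \<ge> deriv Fp t * (s - t)" by (rule convex_above_tangent[OF Fp])
      moreover have "- Fm t - - Fm s \<ge> deriv (\<lambda>s. - Fm s) s * (t - s)"
        using Fm by (intro convex_above_tangent) (auto simp: concave_on_def)
      moreover have "deriv (\<lambda>s. - Fm s) s = - deriv Fm s"
        using Fm(2) by (intro DERIV_imp_deriv DERIV_minus) (simp add: DERIV_deriv_iff_real_differentiable)
      ultimately show ?thesis by (simp add: F_split algebra_simps)
    qed
    from integral_mono[OF i1 i2 this] show ?thesis
      using iF[OF new(2)] iF[OF \<phi>(2)] by (simp add: N_def)
  qed

  \<comment> \<open>Combination of the balances after multiplication by the time step\<close>
  from mom have mom': "(a + b - c) / 2 + \<tau> * visc - \<tau> * cap - \<tau> * grav = 0"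
    using constants(3) by (simp add: field_simps)
  from phs have phs': "X + \<tau> * cap + \<tau> * diss = 0"
    using constants(3) by (simp add: field_simps)
  show ?thesis
    unfolding a_def[symmetric] b_def[symmetric] c_def[symmetric] d_def[symmetric] e_def[symmetric] f_def[symmetric]
      visc_def[symmetric] diss_def[symmetric] grav_def[symmetric]
    using mom' phs' pot energy by (simp add: algebra_simps add_divide_distrib diff_divide_distrib)
qed

end
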